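(* Suppose that $h=h_n$ is chosen such that $h\to0$ and $\log n/(nh^{d+4})\to0$ as $n\to\infty$. Consider a mode $x_*$ of $f$. For any point $x_0$ in the basin of attraction of $x_*$, the following is true with probability tending to one as $n\to\infty$: when initialized at $x_0$, for $\theta$ small enough, each of the hill-climbing methods listed in the context (Max Shift, Max Slope Shift, Euler Shift, Line Search Shift, with neighborhood size parameter $\theta$) produces a sequence that converges to $x_*$.
   Context: Density. $f$ is a probability density on $\mathbb{R}^d$ with respect to Lebesgue measure such that: (i) $f(x)\to0$ as $\|x\|\to\infty$; (ii) $f$ is twice differentiable everywhere, with bounded and uniformly continuous zeroth, first and second derivatives; (iii) the Hessian of $f$ is non-singular at every critical point of $f$. A mode is a local maximum of $f$. Gradient flow. For $x\in\mathbb{R}^d$, $\gamma_x$ is the solution of $\gamma_x(0)=x$, $\dot\gamma_x(t)=\nabla f(\gamma_x(t))$, $t\ge0$; $\gamma_x(t)$ converges to a critical point of $f$ as $t\to\infty$, denoted $\gamma_x(\infty)$. The basin of attraction of $x_*$ is $\{x:\gamma_x(\infty)=x_*\}$. Kernel density estimator. $x_1,\dots,x_n$ is an i.i.d. sample from $f$ and $\hat f_{n,h}(x)=\frac{1}{nh^d}\sum_{i=1}^nK\big((x-x_i)/h\big)$, where the kernel $K:\mathbb{R}^d\to\mathbb{R}$ (with $\int K=1$) is nonnegative, twice continuously differentiable, compactly supported, and of the form $K(x)=k(\|x\|^2)$. Methods. These are the following algorithms applied to the estimate $g=\hat f_{n,h}$ in place of $f$. $B$ and $\bar B$ denote open and closed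 balls; $\theta$ denotes $\varepsilon$ or $\rho$ according to the method; each sequence starts at $\hat x(0)=x_0$, and $k\ge0$. - Max Shift ($\theta=\varepsilon$): $\hat x(k+1)\in\operatorname{arg\,max}_{x\in\bar B(\hat x(k),\varepsilon)}g(x)$; ties are broken in an arbitrary but deterministic way, and the process stops if $g(\hat x(k+1))=g(\hat x(k))$. - Max Slope Shift ($\theta=\varepsilon$, with $0<c<1$ arbitrary but fixed beforehand): $\hat x(k+1)$ is chosen among the local maxima of $g$ in $B(\hat x(k),\varepsilon)$ if there are any (and the process stops there); otherwise $\hat x(k+1)\in\operatorname{arg\,max}\{(g(x)-g(\hat x(k)))/\|x-\hat x(k)\|:x\in\bar B(\hat x(k),\varepsilon)\setminus B(\hat x(k),c\varepsilon)\}$. - Euler Shift ($\theta=\rho$): $\hat x(k+1)=\hat x(k)+\rho\nabla g(\hat x(k))$. - Line Search Shift ($\theta=\rho$): $\hat x(k+1)=\hat x(k)+\rho_k\nabla g(\hat x(k))$, $\rho_k\in\operatorname{arg\,max}_{r\in[0,\rho]}g(\hat x(k)+r\nabla g(\hat x(k)))$.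
   Formalization: The sequences are shown to converge not to x_* itself (impossible, as the estimate's gradient at x_* is nonzero with probability tending to one) but to a mode of the kernel estimate that lies within η of x_*, for every fixed η > 0, with probability tending to one. *)

theory Defs
  imports "HOL-Probability.Probability"
begin

definition grad :: "('a::euclidean_space \<Rightarrow> real) \<Rightarrow> 'a \<Rightarrow> 'a" where
  "grad g x = (THE D. GDERIV g x :> D)"

(* The Hessian as a bounded linear operator, so that boundedness and (uniform) continuity of
   x \<mapsto> hess g x refer to the operator norm.  Meaningful where grad g is differentiable. *)
definition hess :: "('a::euclidean_space \<Rightarrow> real) \<Rightarrow> 'a \<Rightarrow> 'a \<Rightarrow>\<^sub>L 'a" where
  "hess g x = Blinfun (frechet_derivative (grad g) (at x))"

definition twice_differentiable :: "('a::euclidean_space \<Rightarrow> real) \<Rightarrow> bool" where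
  "twice_differentiable g \<longleftrightarrow>
     (\<forall>x. g differentiable (at x)) \<and> (\<forall>x. grad g differentiable (at x))"

definition is_mode :: "('a::euclidean_space \<Rightarrow> real) \<Rightarrow> 'a \<Rightarrow> bool" where
  "is_mode g x \<longleftrightarrow> (\<exists>e>0. \<forall>y\<in>ball x e. g y \<le> g x)"

definition probability_density :: "('a::euclidean_space \<Rightarrow> real) \<Rightarrow> bool" where
  "probability_density f \<longleftrightarrow>
     f \<in> borel_measurable lborel \<and> (\<forall>x. 0 \<le> f x) \<and>
     integrable lborel f \<and> integral\<^sup>L lborel f = 1"

definition regular_density :: "('a::euclidean_space \<Rightarrow> real) \<Rightarrow> bool" where
  "regular_density f \<longleftrightarrow>
     probability_density f \<and>
     (f \<longlongrightarrow> 0) at_infinity \<and>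
     twice_differentiable f \<and>
     bounded (range f) \<and> uniformly_continuous_on UNIV f \<and>
     bounded (range (grad f)) \<and> uniformly_continuous_on UNIV (grad f) \<and>
     bounded (range (hess f)) \<and> uniformly_continuous_on UNIV (hess f) \<and>
     (\<forall>x. grad f x = 0 \<longrightarrow> bij (blinfun_apply (hess f x)))"

definition gradient_flow ::
  "('a::euclidean_space \<Rightarrow> real) \<Rightarrow> 'a \<Rightarrow> (real \<Rightarrow> 'a) \<Rightarrow> bool" where
  "gradient_flow f x \<gamma> \<longleftrightarrow>
     \<gamma> 0 = x \<and>
     (\<forall>t\<ge>0. (\<gamma> has_vector_derivative grad f (\<gamma> t)) (at t within {0..}))"

(* The flow line exists and is unique for the densities considered, grad f being Lipschitz;
   "there is a flow line" and "the flow line" therefore say the same thing here. *)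
definition basin_of_attraction :: "('a::euclidean_space \<Rightarrow> real) \<Rightarrow> 'a \<Rightarrow> 'a set" where
  "basin_of_attraction f z = {x. \<exists>\<gamma>. gradient_flow f x \<gamma> \<and> (\<gamma> \<longlongrightarrow> z) at_top}"

definition smoothing_kernel :: "('a::euclidean_space \<Rightarrow> real) \<Rightarrow> bool" where
  "smoothing_kernel K \<longleftrightarrow>
     (\<forall>x. 0 \<le> K x) \<and>
     integrable lborel K \<and> integral\<^sup>L lborel K = 1 \<and>
     twice_differentiable K \<and> continuous_on UNIV (hess K) \<and>
     compact (closure {x. K x \<noteq> 0}) \<and>
     (\<exists>k :: real \<Rightarrow> real. \<forall>x. K x = k ((norm x)\<^sup>2))"

definition kde ::
  "('a::euclidean_space \<Rightarrow> real) \<Rightarrow> real \<Rightarrow> nat \<Rightarrow> (nat \<Rightarrow> 'a) \<Rightarrow> 'a \<Rightarrow> real" where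
  "kde K h n xs x =
     1 / (real n * h ^ DIM('a)) * (\<Sum>i<n. K ((x - xs i) /\<^sub>R h))"

(* Each method is the relation "xs is a sequence the method may produce from x0".  Ties are
   left free, which covers every tie-breaking rule.  A process that stops is
   represented by a sequence that stays at its last point. *)

(* The process has stopped before step k once some earlier step did not change the value of g. *)
definition max_shift ::
  "('a::euclidean_space \<Rightarrow> real) \<Rightarrow> real \<Rightarrow> 'a \<Rightarrow> (nat \<Rightarrow> 'a) \<Rightarrow> bool" where
  "max_shift g \<epsilon> x0 xs \<longleftrightarrow>
     xs 0 = x0 \<and>
     (\<forall>k. if \<exists>j<k. g (xs (Suc j)) = g (xs j)
          then xs (Suc k) = xs k
          else is_arg_max g (\<lambda>y. y \<in> cball (xs k) \<epsilon>) (xs (Suc k)))"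

definition max_slope_shift ::
  "real \<Rightarrow> ('a::euclidean_space \<Rightarrow> real) \<Rightarrow> real \<Rightarrow> 'a \<Rightarrow> (nat \<Rightarrow> 'a) \<Rightarrow> bool" where
  "max_slope_shift c g \<epsilon> x0 xs \<longleftrightarrow>
     xs 0 = x0 \<and>
     (\<forall>k. if \<exists>y\<in>ball (xs k) \<epsilon>. is_mode g y
          then xs (Suc k) \<in> ball (xs k) \<epsilon> \<and> is_mode g (xs (Suc k)) \<and>
               (\<forall>j\<ge>Suc k. xs j = xs (Suc k))
          else is_arg_max (\<lambda>y. (g y - g (xs k)) / norm (y - xs k))
                 (\<lambda>y. y \<in> cball (xs k) \<epsilon> - ball (xs k) (c * \<epsilon>)) (xs (Suc k)))"

definition euler_shift ::
  "('a::euclidean_space \<Rightarrow> real) \<Rightarrow> real \<Rightarrow> 'a \<Rightarrow> (nat \<Rightarrow> 'a) \<Rightarrow> bool" where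
  "euler_shift g \<rho> x0 xs \<longleftrightarrow>
     xs 0 = x0 \<and> (\<forall>k. xs (Suc k) = xs k + \<rho> *\<^sub>R grad g (xs k))"

definition line_search_shift ::
  "('a::euclidean_space \<Rightarrow> real) \<Rightarrow> real \<Rightarrow> 'a \<Rightarrow> (nat \<Rightarrow> 'a) \<Rightarrow> bool" where
  "line_search_shift g \<rho> x0 xs \<longleftrightarrow>
     xs 0 = x0 \<and>
     (\<forall>k. \<exists>r. is_arg_max (\<lambda>s. g (xs k + s *\<^sub>R grad g (xs k))) (\<lambda>s. s \<in> {0..\<rho>}) r \<and>
              xs (Suc k) = xs k + r *\<^sub>R grad g (xs k))"

definition hill_climbing_methods ::
  "real \<Rightarrow> (('a::euclidean_space \<Rightarrow> real) \<Rightarrow> real \<Rightarrow> 'a \<Rightarrow> (nat \<Rightarrow> 'a) \<Rightarrow> bool) set" where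
  "hill_climbing_methods c = {max_shift, max_slope_shift c, euler_shift, line_search_shift}"

(* The limit z does not depend on \<theta>, on the method or on how ties are broken.  For a density
   estimate g the limit is a critical point of g; it can only be near the mode of the density,
   so the consistency statement asks for a mode z of g close to that mode. *)
definition all_methods_climb_to ::
  "real \<Rightarrow> ('a::euclidean_space \<Rightarrow> real) \<Rightarrow> 'a \<Rightarrow> 'a \<Rightarrow> bool" where
  "all_methods_climb_to c g x0 z \<longleftrightarrow>
     (\<exists>\<theta>0>0. \<forall>\<theta>. 0 < \<theta> \<and> \<theta> < \<theta>0 \<longrightarrow>
        (\<forall>run\<in>hill_climbing_methods c.
           (\<exists>xs. run g \<theta> x0 xs) \<and> (\<forall>xs. run g \<theta> x0 xs \<longrightarrow> xs \<longlonglongrightarrow> z)))"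

(* Inner probability tending to one: the events E n are not required to be measurable. *)
definition with_probability_tending_to_one ::
  "'w measure \<Rightarrow> (nat \<Rightarrow> 'w \<Rightarrow> bool) \<Rightarrow> bool" where
  "with_probability_tending_to_one M E \<longleftrightarrow>
     (\<exists>A. (\<forall>n. A n \<in> sets M \<and> (\<forall>\<omega>\<in>A n. E n \<omega>)) \<and> (\<lambda>n. measure M (A n)) \<longlonglongrightarrow> 1)"

end

(* The Hessian of a kernel density estimate with a merely twice continuously differentiable kernel need
   not be uniformly consistent: its modulus of continuity is not controlled, so no polynomial grid
   works. Two weaker facts suffice. The gradient, whose kernel is Lipschitz, is uniformly consistent
   (Chernoff bound on a polynomial grid; the bias is controlled by integration by parts). And with
   probability tending to one the estimate is uniformly strictly concave at each of its critical
   points near the mode: at a fixed point the Hessian is bad with probability at most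
   exp(-c n h^(d+4)), and conditionally on that a single observation, placed where grad K is
   expanding, makes the gradient delta-small only with probability O((n delta)^d), which pays for a
   delta-grid of any fineness.

   Deterministically, such a surface has exactly one critical point near the mode, because the basins
   of the Euler map are open and cover a ball, which is connected. Every method is a
   perturbed Euler scheme of the gradient flow of the density away from critical points, so it is
   carried into the ball; it is trapped there and, being an ascent method, converges to that point. *)

theory Submission
  imports Defs
begin

subsection \<open>Gradients\<close>

text \<open>The order of the choices shapes the proof. The Lipschitz constant obtained for
  \<open>grad g\<close> of an estimate is of order h^-(d+2), so nothing demanded of the sample may
  depend on it: the tolerance \<epsilon> and the radius R of \<open>climbing_consistent\<close> are
  fixed from f alone, and L is seen only by the threshold on \<theta>, which may depend on the
  surface.

  The rate d + 4 comes from one Hessian entry: a sum of n terms with second moments of order h^d has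
  to deviate by order n h^(d+2), and the squared deviation over n h^d is n h^(d+4). The gradient and
  covering events have the larger exponents n h^(d+2) and n h^d and are weakened to the same form.

  The Hessian deviation is measured on the other n - 1 observations, so that conditioning on them
  fixes it; dropping one term costs O(1) against n h^(d+2). An observation at a prescribed relative
  position must then exist near every point, hence f must be bounded below near the mode. Positivity
  there is not assumed: a mode at height 0 would have a zero Hessian.\<close>

lemma norm_add_scaleR_square:
  fixes x v :: "'a::real_inner"
  shows "(norm (x + t *\<^sub>R v))\<^sup>2 = (norm x)\<^sup>2 + 2 * t * (v \<bullet> x) + t\<^sup>2 * (norm v)\<^sup>2"
  unfolding power2_norm_eq_inner inner_add_left inner_add_right inner_scaleR_left inner_scaleR_right
    inner_commute[of x v] power2_eq_square[of t]
  by (simp add: algebra_simps)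

text \<open>\<open>grad\<close> is a definite description, so both existence and uniqueness are
  needed. Existence is the Riesz representation of the derivative in coordinates, uniqueness that of
  the Frechet derivative.\<close>

lemma GDERIV_grad:
  assumes "g differentiable (at x)"
  shows "GDERIV g x :> grad g x"
proof -
  obtain D where D: "(g has_derivative D) (at x)"
    using assms by (auto simp: differentiable_def)
  interpret D: bounded_linear D using D by (rule has_derivative_bounded_linear)
  define d where "d = (\<Sum>b\<in>Basis. D b *\<^sub>R b)"
  have "D v = v \<bullet> d" for v
  proof -
    have "D v = D (\<Sum>b\<in>Basis. (v \<bullet> b) *\<^sub>R b)" by (simp add: euclidean_representation)
    also have "\<dots> = (\<Sum>b\<in>Basis. (v \<bullet> b) * D b)" by (simp add: D.sum D.scaleR)
    also have "\<dots> = v \<bullet> d" by (simp add: d_def inner_sum_right mult.commute)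
    finally show ?thesis .
  qed
  hence "D = (\<lambda>v. v \<bullet> d)" by (rule ext)
  hence gd: "GDERIV g x :> d" using D by (simp add: gderiv_def)
  have "d' = d" if "GDERIV g x :> d'" for d'
  proof -
    have "(\<lambda>h. h \<bullet> d') = (\<lambda>h. h \<bullet> d)"
      using that gd unfolding gderiv_def by (rule has_derivative_unique)
    hence "\<And>h. h \<bullet> d' = h \<bullet> d" by meson
    thus ?thesis by (metis vector_eq_ldot)
  qed
  thus ?thesis unfolding grad_def using gd by (metis theI)
qed

lemma GDERIV_imp_grad:
  assumes "GDERIV g x :> D" shows "grad g x = D"
proof -
  have "GDERIV g x :> grad g x"
    using assms by (intro GDERIV_grad) (auto simp: gderiv_def differentiable_def)
  hence "(\<lambda>h. h \<bullet> grad g x) = (\<lambda>h. h \<bullet> D)"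
    using assms unfolding gderiv_def by (rule has_derivative_unique)
  hence "\<forall>h. h \<bullet> grad g x = h \<bullet> D" by meson
  thus ?thesis using vector_eq_ldot by blast
qed

lemma blinfun_apply_hess:
  assumes "grad g differentiable (at x)"
  shows "(grad g has_derivative blinfun_apply (hess g x)) (at x)"
proof -
  have d: "(grad g has_derivative frechet_derivative (grad g) (at x)) (at x)"
    using assms frechet_derivative_works by blast
  hence "blinfun_apply (hess g x) = frechet_derivative (grad g) (at x)"
    unfolding hess_def by (intro bounded_linear_Blinfun_apply has_derivative_bounded_linear)
  with d show ?thesis by simp
qed

lemma GDERIV_line:
  assumes "GDERIV g (x + s *\<^sub>R w) :> D"
  shows "((\<lambda>s. g (x + s *\<^sub>R w)) has_real_derivative D \<bullet> w) (at s)"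
proof -
  have "((\<lambda>s. x + s *\<^sub>R w) has_derivative (\<lambda>h. h *\<^sub>R w)) (at s)"
    by (auto intro!: derivative_eq_intros)
  from has_derivative_compose[OF this assms[unfolded gderiv_def]]
  show ?thesis
    by (simp add: has_field_derivative_def inner_commute[of w] mult_commute_abs)
qed

lemma gradient_mvt:
  assumes "\<And>x. GDERIV g x :> grad g x" and "0 < (a::real)"
  obtains s where "0 < s" "s < a" "g (x + a *\<^sub>R w) - g x = a * (grad g (x + s *\<^sub>R w) \<bullet> w)"
proof -
  have "\<exists>s>0. s < a \<and> g (x + a *\<^sub>R w) - g (x + 0 *\<^sub>R w) = (a - 0) * (grad g (x + s *\<^sub>R w) \<bullet> w)"
    using assms by (intro MVT2 GDERIV_line) auto
  thus ?thesis using that by auto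
qed

lemma is_mode_imp_grad_0:
  assumes "is_mode g x" and "g differentiable (at x)"
  shows "grad g x = 0"
proof -
  obtain e where e: "e > 0" "\<forall>y\<in>ball x e. g y \<le> g x" using assms by (auto simp: is_mode_def)
  have "(\<lambda>h. h \<bullet> grad g x) = (\<lambda>h. 0)"
    using GDERIV_grad[OF assms(2)] e unfolding gderiv_def
    by (intro differential_zero_maxmin[of x "ball x e" g]) auto
  hence "\<And>h. h \<bullet> grad g x = 0" by meson
  thus ?thesis by (metis inner_eq_zero_iff)
qed

text \<open>The second difference over the parallelogram spanned by t v and t w is symmetric in v
  and w. A mean value step in direction w, followed by the first-order expansion of
  \<open>grad g\<close> at \<open>x\<close>, shows that it equals t^2 times the Hessian form up to
  o(t^2). Differentiability of \<open>grad g\<close> at the single point \<open>x\<close> suffices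
  for this.\<close>

lemma second_derivative_symmetric:
  fixes g :: "'a::euclidean_space \<Rightarrow> real"
  assumes D: "\<And>x. GDERIV g x :> grad g x" and H: "(grad g has_derivative H) (at x)"
  shows "H v \<bullet> w = H w \<bullet> v"
proof -
  interpret H: bounded_linear H using H by (rule has_derivative_bounded_linear)
  define N where "N = norm v + norm w + 1"
  have N: "0 < N" by (simp add: N_def add_nonneg_pos)
  have asym: "\<bar>H v \<bullet> w - H w \<bullet> v\<bar> \<le> 4 * e * N\<^sup>2" if e: "e > 0" for e
  proof -
    from H e obtain d where d: "d > 0"
      and dd: "\<And>y. norm (y - x) < d \<Longrightarrow> norm (grad g y - grad g x - H (y - x)) \<le> e * norm (y - x)"
      unfolding has_derivative_at_alt by blast
    \<comment> \<open>All displacements below have length at most t N, hence stay inside the radius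
      \<open>d\<close> of the expansion.\<close>
    define t where "t = d / (2 * N)"
    have t: "0 < t" "t * N < d" using d N by (auto simp: t_def)
    have diff: "\<bar>g (x + t *\<^sub>R v + t *\<^sub>R w) - g (x + t *\<^sub>R v) - g (x + t *\<^sub>R w) + g x - t\<^sup>2 * (H v \<bullet> w)\<bar>
        \<le> 2 * e * N\<^sup>2 * t\<^sup>2" if vw: "norm v + norm w \<le> N" for v w
    proof -
      have "\<exists>s>0. s < t \<and> (g (x + t *\<^sub>R v + t *\<^sub>R w) - g (x + t *\<^sub>R w))
          - (g (x + t *\<^sub>R v + 0 *\<^sub>R w) - g (x + 0 *\<^sub>R w))
          = (t - 0) * (grad g (x + t *\<^sub>R v + s *\<^sub>R w) \<bullet> w - grad g (x + s *\<^sub>R w) \<bullet> w)"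
        using t by (intro MVT2 DERIV_diff GDERIV_line D) auto
      then obtain s where s: "0 < s" "s < t"
        and eq: "g (x + t *\<^sub>R v + t *\<^sub>R w) - g (x + t *\<^sub>R w) - g (x + t *\<^sub>R v) + g x
          = t * ((grad g (x + (t *\<^sub>R v + s *\<^sub>R w)) - grad g (x + s *\<^sub>R w)) \<bullet> w)"
        by (auto simp: inner_diff_left algebra_simps)
      have nn: "norm (t *\<^sub>R v + s *\<^sub>R w) \<le> t * N" "norm (s *\<^sub>R w) \<le> t * N"
      proof -
        have "norm (t *\<^sub>R v + s *\<^sub>R w) \<le> t * norm v + s * norm w"
          using t s by (metis (no_types) abs_of_pos norm_scaleR norm_triangle_ineq)
        also have "\<dots> \<le> t * norm v + t * norm w" using s by (intro add_left_mono mult_right_mono) auto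
        also have "\<dots> \<le> t * N" using vw t by (metis distrib_left mult_left_mono less_imp_le)
        finally show "norm (t *\<^sub>R v + s *\<^sub>R w) \<le> t * N" .
        have "norm (s *\<^sub>R w) \<le> t * norm w" using s by (simp add: mult_right_mono)
        also have "\<dots> \<le> t * N" using vw t norm_ge_zero[of v] by (intro mult_left_mono) linarith+
        finally show "norm (s *\<^sub>R w) \<le> t * N" .
      qed
      define E where "E y = grad g (x + y) - grad g x - H y" for y
      have E: "norm (E y) \<le> e * (t * N)" if "norm y \<le> t * N" for y
      proof -
        have "norm (E y) \<le> e * norm y" using dd[of "x + y"] that t by (simp add: E_def)
        also have "\<dots> \<le> e * (t * N)" using that e by (intro mult_left_mono) auto
        finally show ?thesis .
      qed
      have "grad g (x + (t *\<^sub>R v + s *\<^sub>R w)) - grad g (x + s *\<^sub>R w)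
          = t *\<^sub>R H v + (E (t *\<^sub>R v + s *\<^sub>R w) - E (s *\<^sub>R w))"
        by (simp add: E_def H.add H.scaleR)
      hence "(grad g (x + (t *\<^sub>R v + s *\<^sub>R w)) - grad g (x + s *\<^sub>R w)) \<bullet> w
          = t * (H v \<bullet> w) + (E (t *\<^sub>R v + s *\<^sub>R w) - E (s *\<^sub>R w)) \<bullet> w"
        by (simp add: inner_add_left)
      from eq[unfolded this]
      have "g (x + t *\<^sub>R v + t *\<^sub>R w) - g (x + t *\<^sub>R v) - g (x + t *\<^sub>R w) + g x - t\<^sup>2 * (H v \<bullet> w)
        = t * ((E (t *\<^sub>R v + s *\<^sub>R w) - E (s *\<^sub>R w)) \<bullet> w)"
        by (simp add: distrib_left power2_eq_square)
      also have "\<bar>\<dots>\<bar> \<le> t * ((2 * (e * (t * N))) * N)"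
      proof -
        have "\<bar>(E (t *\<^sub>R v + s *\<^sub>R w) - E (s *\<^sub>R w)) \<bullet> w\<bar>
            \<le> norm (E (t *\<^sub>R v + s *\<^sub>R w) - E (s *\<^sub>R w)) * norm w"
          by (rule Cauchy_Schwarz_ineq2)
        also have "\<dots> \<le> (2 * (e * (t * N))) * N"
        proof (rule mult_mono)
          show "norm (E (t *\<^sub>R v + s *\<^sub>R w) - E (s *\<^sub>R w)) \<le> 2 * (e * (t * N))"
            using E[OF nn(1)] E[OF nn(2)] norm_triangle_ineq4[of "E (t *\<^sub>R v + s *\<^sub>R w)" "E (s *\<^sub>R w)"]
            by linarith
          show "norm w \<le> N" using vw norm_ge_zero[of v] by linarith
        qed (use e t N in auto)
        finally show ?thesis using t by (simp add: abs_mult mult_left_mono)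
      qed
      also have "\<dots> = 2 * e * N\<^sup>2 * t\<^sup>2" by (simp add: power2_eq_square)
      finally show ?thesis .
    qed
    \<comment> \<open>Both instances of \<open>diff\<close> speak of the same second difference, so
      the two Hessian values differ by at most twice the error.\<close>
    have "\<bar>t\<^sup>2 * (H v \<bullet> w) - t\<^sup>2 * (H w \<bullet> v)\<bar> \<le> 4 * e * N\<^sup>2 * t\<^sup>2"
      using diff[of v w] diff[of w v] by (simp add: N_def add.commute add.left_commute) 
    hence "t\<^sup>2 * \<bar>H v \<bullet> w - H w \<bullet> v\<bar> \<le> t\<^sup>2 * (4 * e * N\<^sup>2)"
      unfolding right_diff_distrib[symmetric] abs_mult by (simp add: mult.commute)
    thus ?thesis using t by simp
  qed
  have "\<bar>H v \<bullet> w - H w \<bullet> v\<bar> \<le> 0 + e" if "e > 0" for e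
    using asym[of "e / (4 * N\<^sup>2)"] that N by simp
  hence "\<bar>H v \<bullet> w - H w \<bullet> v\<bar> \<le> 0" by (rule field_le_epsilon)
  thus ?thesis by simp
qed

locale lipschitz_gradient =
  fixes g :: "'a::euclidean_space \<Rightarrow> real" and L :: real
  assumes grad: "GDERIV g x :> grad g x"
    and lip: "norm (grad g x - grad g y) \<le> L * norm (x - y)"
    and L_pos: "0 < L"
begin

lemma diff: "g differentiable (at x)"
  using grad[of x] by (auto simp: gderiv_def differentiable_def)

lemma continuous_g: "continuous_on S g"
  using diff by (meson continuous_at_imp_continuous_on differentiable_imp_continuous_within)

lemma continuous_grad: "continuous_on S (grad g)"
proof -
  have "L-lipschitz_on S (grad g)"
    using lip L_pos by (intro lipschitz_onI) (auto simp: dist_norm)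
  thus ?thesis by (rule lipschitz_on_continuous_on)
qed

lemma taylor: "\<bar>g (x + w) - g x - grad g x \<bullet> w\<bar> \<le> L * (norm w)\<^sup>2"
proof -
  obtain s where s: "0 < s" "s < 1" "g (x + 1 *\<^sub>R w) - g x = 1 * (grad g (x + s *\<^sub>R w) \<bullet> w)"
    using gradient_mvt[of g 1 x w] grad by auto
  hence "\<bar>g (x + w) - g x - grad g x \<bullet> w\<bar> = \<bar>(grad g (x + s *\<^sub>R w) - grad g x) \<bullet> w\<bar>"
    by (simp add: inner_diff_left)
  also have "\<dots> \<le> norm (grad g (x + s *\<^sub>R w) - grad g x) * norm w" by (rule Cauchy_Schwarz_ineq2)
  also have "\<dots> \<le> (L * norm w) * norm w"
  proof (rule mult_right_mono)
    have "norm (grad g (x + s *\<^sub>R w) - grad g x) \<le> L * (s * norm w)"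
      using lip[of "x + s *\<^sub>R w" x] s by simp
    also have "\<dots> \<le> L * (1 * norm w)" using s L_pos by (intro mult_left_mono mult_right_mono) auto
    finally show "norm (grad g (x + s *\<^sub>R w) - grad g x) \<le> L * norm w" by simp
  qed simp
  finally show ?thesis by (simp add: power2_eq_square)
qed

text \<open>Half of the first-order gain survives because the quadratic remainder takes at most the
  other half. This is the guaranteed increase for every method that does at least as well as a
  gradient step.\<close>

lemma gradient_step_gain:
  assumes "0 \<le> s" "2 * L * s \<le> 1"
  shows "g x + s / 2 * (norm (grad g x))\<^sup>2 \<le> g (x + s *\<^sub>R grad g x)"
proof -
  have "g (x + s *\<^sub>R grad g x) \<ge> g x + s * (norm (grad g x))\<^sup>2 - L * (s * norm (grad g x))\<^sup>2"
    using taylor[of x "s *\<^sub>R grad g x"] assms(1) by (simp add: power2_norm_eq_inner abs_le_iff)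
  moreover have "L * (s * norm (grad g x))\<^sup>2 \<le> s / 2 * (norm (grad g x))\<^sup>2"
  proof -
    have "(2 * L * s) * (s * (norm (grad g x))\<^sup>2) \<le> 1 * (s * (norm (grad g x))\<^sup>2)"
      using assms by (intro mult_right_mono) auto
    thus ?thesis by (simp add: power2_eq_square algebra_simps)
  qed
  ultimately show ?thesis by (simp add: field_simps)
qed

lemma direction_gain:
  assumes "0 \<le> s"
  shows "g x + s * norm (grad g x) - L * s\<^sup>2 \<le> g (x + s *\<^sub>R sgn (grad g x))"
proof -
  have "grad g x \<bullet> sgn (grad g x) = norm (grad g x)"
    by (cases "grad g x = 0") (simp_all add: sgn_div_norm power2_norm_eq_inner[symmetric] power2_eq_square)
  moreover have "(norm (s *\<^sub>R sgn (grad g x)))\<^sup>2 \<le> s\<^sup>2"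
    using assms by (simp add: norm_sgn)
  hence "L * (norm (s *\<^sub>R sgn (grad g x)))\<^sup>2 \<le> L * s\<^sup>2" using L_pos by simp
  ultimately show ?thesis using taylor[of x "s *\<^sub>R sgn (grad g x)"]
    by (simp add: abs_le_iff)
qed

text \<open>A move of length at most s that does as well as the one of length s along the gradient
  has nearly the full first-order gain, hence nearly full length and the gradient direction. The
  inner product falls short by O(s^2), so the squared distance is O(s^3) and the deviation s^(3/2)
  is o(s).\<close>

lemma step_direction:
  assumes m: "0 < m" "m \<le> norm (grad g x)" and s: "0 < s" "norm w \<le> s"
    and ge: "g (x + s *\<^sub>R sgn (grad g x)) \<le> g (x + w)"
  shows "(norm (w - s *\<^sub>R sgn (grad g x)))\<^sup>2 \<le> 4 * L * s ^ 3 / m"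
proof -
  define G where "G = norm (grad g x)"
  define u where "u = sgn (grad g x)"
  have G: "0 < G" "m \<le> G" using m by (auto simp: G_def)
  have u: "norm u = 1" "grad g x = G *\<^sub>R u" using G by (auto simp: u_def G_def norm_sgn sgn_div_norm)
  have "(norm w)\<^sup>2 \<le> s\<^sup>2" using s by (simp add: power_mono)
  hence "L * (norm w)\<^sup>2 \<le> L * s\<^sup>2" using L_pos by simp
  hence "g (x + w) \<le> g x + G * (u \<bullet> w) + L * s\<^sup>2"
    using taylor[of x w] u by (simp add: abs_le_iff)
  moreover have "g x + s * G - L * s\<^sup>2 \<le> g (x + w)"
    using direction_gain[of s x] ge s by (simp add: G_def)
  ultimately have "G * (s - u \<bullet> w) \<le> 2 * L * s\<^sup>2" by (simp add: algebra_simps)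
  moreover have sw: "u \<bullet> w \<le> s" using u s norm_cauchy_schwarz[of u w] by simp
  hence "m * (s - u \<bullet> w) \<le> G * (s - u \<bullet> w)" using G by (intro mult_right_mono) auto
  ultimately have "m * (s - u \<bullet> w) \<le> 2 * L * s\<^sup>2" by linarith
  hence le: "s - u \<bullet> w \<le> 2 * L * s\<^sup>2 / m" using m by (simp add: field_simps)
  have "(norm (w - s *\<^sub>R u))\<^sup>2 = (norm w)\<^sup>2 - 2 * s * (u \<bullet> w) + s\<^sup>2 * (norm u)\<^sup>2"
    using norm_add_scaleR_square[of w "- s" u] by simp
  also have "\<dots> \<le> s\<^sup>2 - 2 * s * (u \<bullet> w) + s\<^sup>2" using \<open>(norm w)\<^sup>2 \<le> s\<^sup>2\<close> u by simp
  also have "\<dots> = 2 * s * (s - u \<bullet> w)" by (simp add: power2_eq_square algebra_simps)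
  also have "\<dots> \<le> 2 * s * (2 * L * s\<^sup>2 / m)" using le s by (intro mult_left_mono) auto
  also have "\<dots> = 4 * L * s ^ 3 / m" by (simp add: power2_eq_square power3_eq_cube)
  finally show ?thesis by (simp add: u_def)
qed

text \<open>The witness is \<tau> = s / |grad g x|: a move of length s along the gradient is an
  Euler step of this duration. The smallness conditions on s turn the deviation of order s^(3/2)
  into a relative error \<alpha>, and the lower bound on \<tau> ensures that time advances.\<close>

lemma shift_step:
  assumes m: "0 < m" "m \<le> norm (grad g x)" and B: "norm (grad g x) \<le> B"
    and s: "0 < s" "norm w \<le> s" and \<alpha>: "0 < \<alpha>" "s \<le> \<alpha> * m" "4 * L * s * B\<^sup>2 \<le> \<alpha>\<^sup>2 * m"
    and ge: "g (x + s *\<^sub>R sgn (grad g x)) \<le> g (x + w)"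
  shows "\<exists>\<tau>. s / B \<le> \<tau> \<and> \<tau> \<le> \<alpha> \<and> norm (w - \<tau> *\<^sub>R grad g x) \<le> \<tau> * \<alpha>"
proof (intro exI conjI)
  define G where "G = norm (grad g x)"
  have G: "0 < G" "m \<le> G" "G \<le> B" using m B by (auto simp: G_def)
  show "s / B \<le> s / G" using G s by (simp add: frac_le)
  have "s \<le> \<alpha> * G" using \<alpha> G mult_left_mono[of m G \<alpha>] by linarith
  thus "s / G \<le> \<alpha>" using G by (simp add: field_simps)
  have "(norm (w - s *\<^sub>R sgn (grad g x)))\<^sup>2 \<le> 4 * L * s ^ 3 / m"
    using step_direction[OF m s ge] .
  also have "\<dots> \<le> (s / G * \<alpha>)\<^sup>2"
  proof -
    have "4 * L * s * G\<^sup>2 \<le> 4 * L * s * B\<^sup>2" using G s L_pos by (intro mult_left_mono power_mono) auto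
    hence "4 * L * s * G\<^sup>2 \<le> \<alpha>\<^sup>2 * m" using \<alpha> by simp
    hence "s\<^sup>2 * (4 * L * s * G\<^sup>2) \<le> s\<^sup>2 * (\<alpha>\<^sup>2 * m)" by (intro mult_left_mono) auto
    thus ?thesis using G m by (simp add: field_simps power2_eq_square power3_eq_cube)
  qed
  finally have "norm (w - s *\<^sub>R sgn (grad g x)) \<le> s / G * \<alpha>"
    by (rule power2_le_imp_le) (use G s \<alpha> in auto)
  thus "norm (w - (s / G) *\<^sub>R grad g x) \<le> s / G * \<alpha>"
    by (simp add: sgn_div_norm G_def divide_inverse)
qed

end

subsection \<open>Existence of runs\<close>

lemma continuous_on_compact_arg_max:
  fixes \<phi> :: "'a::topological_space \<Rightarrow> real"
  assumes "compact S" "S \<noteq> {}" "continuous_on S \<phi>"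
  shows "\<exists>y. is_arg_max \<phi> (\<lambda>y. y \<in> S) y"
proof -
  obtain y where "y \<in> S" "\<forall>z\<in>S. \<phi> z \<le> \<phi> y"
    using continuous_attains_sup[OF assms] by auto
  thus ?thesis by (auto simp: is_arg_max_def not_less intro!: exI[of _ y])
qed

lemma is_arg_max_iff: "is_arg_max (\<phi> :: 'a \<Rightarrow> real) P y \<longleftrightarrow> P y \<and> (\<forall>z. P z \<longrightarrow> \<phi> z \<le> \<phi> y)"
  by (auto simp: is_arg_max_def not_less)

lemma compact_annulus:
  fixes x :: "'a::euclidean_space"
  assumes "0 < \<epsilon>" "c < 1"
  shows "compact (cball x \<epsilon> - ball x (c * \<epsilon>))" and "cball x \<epsilon> - ball x (c * \<epsilon>) \<noteq> {}"
proof -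
  show "compact (cball x \<epsilon> - ball x (c * \<epsilon>))" by (intro compact_diff) auto
  obtain b :: 'a where "b \<in> Basis" using nonempty_Basis by blast
  moreover have "c * \<epsilon> \<le> \<epsilon>" using assms by (simp add: mult_left_le_one_le less_imp_le)
  ultimately have "x + \<epsilon> *\<^sub>R b \<in> cball x \<epsilon> - ball x (c * \<epsilon>)" using assms by (simp add: dist_norm)
  thus "cball x \<epsilon> - ball x (c * \<epsilon>) \<noteq> {}" by auto
qed

lemma max_shift_exists:
  fixes g :: "'a::euclidean_space \<Rightarrow> real"
  assumes g: "continuous_on UNIV g" and \<epsilon>: "0 < \<epsilon>"
  shows "\<exists>xs. max_shift g \<epsilon> x0 xs"
proof -
  define best where "best x = is_arg_max g (\<lambda>y. y \<in> cball x \<epsilon>)" for x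
  \<comment> \<open>Ties are broken in favour of staying. A step that does not change the value of g
    then starts at a maximiser of its ball, which \<open>S\<close> fixes, so the iteration of
    \<open>S\<close> stops by itself as \<open>max_shift\<close> demands.\<close>
  define S where "S x = (if best x x then x else SOME y. best x y)" for x
  define xs where "xs k = (S ^^ k) x0" for k
  have S: "best x (S x)" for x
  proof -
    have "\<exists>y. best x y" unfolding best_def
      using \<epsilon> continuous_on_subset[OF g] by (intro continuous_on_compact_arg_max) auto
    thus ?thesis by (auto simp: S_def intro: someI_ex)
  qed
  have step: "xs (Suc k) = S (xs k)" for k by (simp add: xs_def)
  have stop: "xs k = xs j" if eq: "g (xs (Suc j)) = g (xs j)" and "j \<le> k" for j k
  proof -
    have "best (xs j) (xs j)" using S[of "xs j"] eq \<epsilon> by (auto simp: step best_def is_arg_max_iff)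
    hence fx: "S (xs j) = xs j" by (simp add: S_def)
    show ?thesis using \<open>j \<le> k\<close> by (induction k rule: dec_induct) (auto simp: step fx)
  qed
  have "max_shift g \<epsilon> x0 xs" unfolding max_shift_def
  proof (intro conjI allI)
    fix k
    show "if \<exists>j<k. g (xs (Suc j)) = g (xs j) then xs (Suc k) = xs k
          else is_arg_max g (\<lambda>y. y \<in> cball (xs k) \<epsilon>) (xs (Suc k))"
      using S[of "xs k"] stop[of _ k] stop[of _ "Suc k"] by (auto simp: step best_def)
  qed (simp add: xs_def)
  thus ?thesis by blast
qed

lemma max_slope_shift_exists:
  fixes g :: "'a::euclidean_space \<Rightarrow> real"
  assumes g: "continuous_on UNIV g" and \<epsilon>: "0 < \<epsilon>" and c: "0 < c" "c < 1"
  shows "\<exists>xs. max_slope_shift c g \<epsilon> x0 xs"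
proof -
  define best where "best x = is_arg_max (\<lambda>y. (g y - g x) / norm (y - x))
    (\<lambda>y. y \<in> cball x \<epsilon> - ball x (c * \<epsilon>))" for x
  define near where "near x y \<longleftrightarrow> y \<in> ball x \<epsilon> \<and> is_mode g y" for x y
  \<comment> \<open>A mode must be kept once reached: it lies in its own ball, so the first branch
    of \<open>max_slope_shift\<close> stays active and demands a constant sequence from then
    on.\<close>
  define S where "S x = (if is_mode g x then x else if \<exists>y. near x y then SOME y. near x y
    else SOME y. best x y)" for x
  define xs where "xs k = (S ^^ k) x0" for k
  have step: "xs (Suc k) = S (xs k)" for k by (simp add: xs_def)
  have "\<exists>y. best x y" for x
  proof -
    have "continuous_on (cball x \<epsilon> - ball x (c * \<epsilon>)) (\<lambda>y. (g y - g x) / norm (y - x))"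
      using \<epsilon> c by (intro continuous_intros continuous_on_subset[OF g]) auto
    thus ?thesis unfolding best_def
      using \<epsilon> c compact_annulus[of \<epsilon> c x] by (intro continuous_on_compact_arg_max) auto
  qed
  hence best: "best x (S x)" if "\<not> (\<exists>y. near x y)" for x
    using that \<epsilon> by (auto simp: S_def near_def intro: someI_ex)
  have near: "near x (S x)" if "\<exists>y. near x y" for x
  proof -
    have "near x (SOME y. near x y)" by (rule someI_ex[OF that])
    moreover have "near x x" if "is_mode g x" using that \<epsilon> by (simp add: near_def)
    ultimately show ?thesis using that by (simp add: S_def)
  qed
  have const: "xs j = xs k" if "is_mode g (xs k)" "k \<le> j" for j k
    using that(2,1) by (induction j rule: dec_induct) (auto simp: step S_def)
  have "max_slope_shift c g \<epsilon> x0 xs" unfolding max_slope_shift_def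
  proof (intro conjI allI)
    fix k
    show "if \<exists>y\<in>ball (xs k) \<epsilon>. is_mode g y
          then xs (Suc k) \<in> ball (xs k) \<epsilon> \<and> is_mode g (xs (Suc k)) \<and> (\<forall>j\<ge>Suc k. xs j = xs (Suc k))
          else is_arg_max (\<lambda>y. (g y - g (xs k)) / norm (y - xs k))
                 (\<lambda>y. y \<in> cball (xs k) \<epsilon> - ball (xs k) (c * \<epsilon>)) (xs (Suc k))"
    proof (cases "\<exists>y. near (xs k) y")
      case True
      hence n: "near (xs k) (xs (Suc k))" by (simp add: step near)
      have ex: "\<exists>y\<in>ball (xs k) \<epsilon>. is_mode g y" using True by (auto simp: near_def)
      show ?thesis unfolding if_P[OF ex]
        using n const[of "Suc k"] unfolding near_def by blast
    next
      case False
      hence "best (xs k) (xs (Suc k))" by (simp add: step best)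
      moreover have "\<not> (\<exists>y\<in>ball (xs k) \<epsilon>. is_mode g y)" using False by (auto simp: near_def)
      ultimately show ?thesis by (simp add: best_def)
    qed
  qed (simp add: xs_def)
  thus ?thesis by blast
qed

lemma euler_shift_exists: "\<exists>xs. euler_shift g \<rho> x0 xs"
proof -
  have "euler_shift g \<rho> x0 (\<lambda>k. ((\<lambda>x. x + \<rho> *\<^sub>R grad g x) ^^ k) x0)" by (simp add: euler_shift_def)
  thus ?thesis by blast
qed

lemma line_search_shift_exists:
  fixes g :: "'a::euclidean_space \<Rightarrow> real"
  assumes g: "continuous_on UNIV g" and \<rho>: "0 < \<rho>"
  shows "\<exists>xs. line_search_shift g \<rho> x0 xs"
proof -
  define best where "best x = is_arg_max (\<lambda>s. g (x + s *\<^sub>R grad g x)) (\<lambda>s. s \<in> {0..\<rho>})" for x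
  have "\<exists>r. best x r" for x unfolding best_def
    using \<rho> by (intro continuous_on_compact_arg_max continuous_on_compose2[OF g] continuous_intros) auto
  hence "best x (SOME r. best x r)" for x by (rule someI_ex)
  hence "line_search_shift g \<rho> x0 (\<lambda>k. ((\<lambda>x. x + (SOME r. best x r) *\<^sub>R grad g x) ^^ k) x0)"
    unfolding line_search_shift_def best_def by (auto intro!: exI)
  thus ?thesis by blast
qed

lemma hill_climbing_run_exists:
  fixes g :: "'a::euclidean_space \<Rightarrow> real"
  assumes "continuous_on UNIV g" "0 < \<theta>" "0 < c" "c < 1" "run \<in> hill_climbing_methods c"
  shows "\<exists>xs. run g \<theta> x0 xs"
  using assms max_shift_exists max_slope_shift_exists euler_shift_exists line_search_shift_exists
  by (fastforce simp: hill_climbing_methods_def)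

subsection \<open>Sequences following a vector field\<close>

text \<open>An inexact Euler scheme with variable step durations, valid only while the sequence is
  in \<open>W\<close>. One parameter \<alpha> bounds both the duration and the error per unit of
  time; \<open>\<tau>0\<close> is there only to make the accumulated time diverge, and no estimate
  for \<alpha> depends on it.\<close>

definition follows :: "('a::real_normed_vector \<Rightarrow> 'a) \<Rightarrow> 'a set \<Rightarrow> real \<Rightarrow> real \<Rightarrow> (nat \<Rightarrow> 'a) \<Rightarrow> bool" where
  "follows F W \<tau>0 \<alpha> xs \<longleftrightarrow>
     (\<forall>k. xs k \<in> W \<longrightarrow>
        (\<exists>\<tau>. \<tau>0 \<le> \<tau> \<and> \<tau> \<le> \<alpha> \<and> norm (xs (Suc k) - xs k - \<tau> *\<^sub>R F (xs k)) \<le> \<tau> * \<alpha>))"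

text \<open>Meant for the passage from the gradient of the estimate to that of the density: a
  difference \<beta> of the fields is one more error per unit of time.\<close>

lemma follows_perturb:
  assumes "follows F W \<tau>0 \<alpha> xs" "\<And>x. x \<in> W \<Longrightarrow> norm (F x - F' x) \<le> \<beta>" "0 < \<tau>0" "0 \<le> \<beta>"
  shows "follows F' W \<tau>0 (\<alpha> + \<beta>) xs"
  unfolding follows_def
proof (intro allI impI)
  fix k assume k: "xs k \<in> W"
  obtain \<tau> where \<tau>: "\<tau>0 \<le> \<tau>" "\<tau> \<le> \<alpha>" "norm (xs (Suc k) - xs k - \<tau> *\<^sub>R F (xs k)) \<le> \<tau> * \<alpha>"
    using assms(1) k by (auto simp: follows_def)
  have "norm (\<tau> *\<^sub>R (F (xs k) - F' (xs k))) \<le> \<tau> * \<beta>"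
    using assms(2)[OF k] assms(3) \<tau> by (simp add: mult_left_mono)
  hence "norm ((xs (Suc k) - xs k - \<tau> *\<^sub>R F (xs k)) + \<tau> *\<^sub>R (F (xs k) - F' (xs k))) \<le> \<tau> * (\<alpha> + \<beta>)"
    unfolding distrib_left using \<tau>(3) by (intro norm_triangle_le add_mono)
  moreover have "xs (Suc k) - xs k - \<tau> *\<^sub>R F' (xs k)
    = (xs (Suc k) - xs k - \<tau> *\<^sub>R F (xs k)) + \<tau> *\<^sub>R (F (xs k) - F' (xs k))"
    by (simp add: scaleR_diff_right)
  ultimately have "norm (xs (Suc k) - xs k - \<tau> *\<^sub>R F' (xs k)) \<le> \<tau> * (\<alpha> + \<beta>)"
    by metis
  thus "\<exists>\<tau>. \<tau>0 \<le> \<tau> \<and> \<tau> \<le> \<alpha> + \<beta> \<and> norm (xs (Suc k) - xs k - \<tau> *\<^sub>R F' (xs k)) \<le> \<tau> * (\<alpha> + \<beta>)"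
    using \<tau> assms by (intro exI[of _ \<tau>]) auto
qed

lemma follows_mono:
  assumes "follows F W \<tau>0 \<alpha> xs" "W' \<subseteq> W" "\<alpha> \<le> \<beta>" "0 < \<tau>0"
  shows "follows F W' \<tau>0 \<beta> xs"
  unfolding follows_def
proof (intro allI impI)
  fix k assume k: "xs k \<in> W'"
  hence "xs k \<in> W" using assms by auto
  then obtain \<tau> where \<tau>: "\<tau>0 \<le> \<tau>" "\<tau> \<le> \<alpha>" "norm (xs (Suc k) - xs k - \<tau> *\<^sub>R F (xs k)) \<le> \<tau> * \<alpha>"
    using assms(1) by (auto simp: follows_def)
  have "\<tau> * \<alpha> \<le> \<tau> * \<beta>" using assms \<tau> by (intro mult_left_mono) auto
  thus "\<exists>\<tau>. \<tau>0 \<le> \<tau> \<and> \<tau> \<le> \<beta> \<and> norm (xs (Suc k) - xs k - \<tau> *\<^sub>R F (xs k)) \<le> \<tau> * \<beta>"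
    using \<tau> assms by (intro exI[of _ \<tau>] conjI order_trans[OF \<tau>(3)]) auto
qed

text \<open>The second bound is the local error of an Euler step: during time \<tau> the point moves
  by at most B \<tau>, so its velocity changes by at most L B \<tau>.\<close>

lemma flow_increment:
  fixes F :: "'a::euclidean_space \<Rightarrow> 'a"
  assumes \<gamma>: "\<And>t. 0 \<le> t \<Longrightarrow> (\<gamma> has_vector_derivative F (\<gamma> t)) (at t within {0..})"
    and lip: "\<And>x y. norm (F x - F y) \<le> L * norm (x - y)" and L: "0 < L"
    and B: "\<And>x. norm (F x) \<le> B" and t: "0 \<le> t" "0 \<le> \<tau>"
  shows "norm (\<gamma> (t + \<tau>) - \<gamma> t) \<le> B * \<tau>"
    and "norm (\<gamma> (t + \<tau>) - \<gamma> t - \<tau> *\<^sub>R F (\<gamma> t)) \<le> \<tau> * (L * B * \<tau>)"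
proof -
  have der: "(\<gamma> has_vector_derivative F (\<gamma> s)) (at s within {a..b})" if "0 \<le> a" "s \<in> {a..b}" for a b s
    using has_vector_derivative_within_subset[OF \<gamma>[of s], of "{a..b}"] that by auto
  have B0: "0 \<le> B" using B[of 0] norm_ge_zero order_trans by blast
  have inc: "norm (\<gamma> b - \<gamma> a) \<le> B * (b - a)" if "0 \<le> a" "a \<le> b" for a b
  proof -
    have "norm (\<gamma> b - \<gamma> a) \<le> B * norm (b - a)"
    proof (rule differentiable_bound[where S = "{a..b}" and f' = "\<lambda>s h. h *\<^sub>R F (\<gamma> s)"])
      fix s assume "s \<in> {a..b}"
      thus "(\<gamma> has_derivative (\<lambda>h. h *\<^sub>R F (\<gamma> s))) (at s within {a..b})"
        using der[of a s b] that by (simp add: has_vector_derivative_def)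
      show "onorm (\<lambda>h. h *\<^sub>R F (\<gamma> s)) \<le> B"
        using mult_left_mono[OF B[of "\<gamma> s"]] by (intro onorm_le) (simp add: mult.commute[of B])
    qed (use that in auto)
    thus ?thesis using that by simp
  qed
  show "norm (\<gamma> (t + \<tau>) - \<gamma> t) \<le> B * \<tau>" using inc[of t "t + \<tau>"] t by simp
  define \<phi> where "\<phi> s = \<gamma> s - s *\<^sub>R F (\<gamma> t)" for s
  have "norm (\<phi> (t + \<tau>) - \<phi> t) \<le> (L * B * \<tau>) * norm (t + \<tau> - t)"
  proof (rule differentiable_bound[where S = "{t..t + \<tau>}" and f' = "\<lambda>s h. h *\<^sub>R (F (\<gamma> s) - F (\<gamma> t))"])
    fix s assume s: "s \<in> {t..t + \<tau>}"
    show "(\<phi> has_derivative (\<lambda>h. h *\<^sub>R (F (\<gamma> s) - F (\<gamma> t)))) (at s within {t..t + \<tau>})"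
      using der[of t s "t + \<tau>"] s t unfolding \<phi>_def has_vector_derivative_def
      by (auto intro!: derivative_eq_intros simp: scaleR_diff_right)
    have "norm (F (\<gamma> s) - F (\<gamma> t)) \<le> L * norm (\<gamma> s - \<gamma> t)" by (rule lip)
    also have "\<dots> \<le> L * (B * \<tau>)"
    proof (rule mult_left_mono)
      have "norm (\<gamma> s - \<gamma> t) \<le> B * (s - t)" using inc[of t s] s t by auto
      also have "\<dots> \<le> B * \<tau>" using s B0 by (intro mult_left_mono) auto
      finally show "norm (\<gamma> s - \<gamma> t) \<le> B * \<tau>" .
    qed (use L in simp)
    finally have "norm (F (\<gamma> s) - F (\<gamma> t)) \<le> L * B * \<tau>" by simp
    from mult_left_mono[OF this]
    show "onorm (\<lambda>h. h *\<^sub>R (F (\<gamma> s) - F (\<gamma> t))) \<le> L * B * \<tau>"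
      by (intro onorm_le) (simp add: mult.commute[of "L * B * \<tau>"])
  qed (use t in auto)
  thus "norm (\<gamma> (t + \<tau>) - \<gamma> t - \<tau> *\<^sub>R F (\<gamma> t)) \<le> \<tau> * (L * B * \<tau>)"
    using t by (simp add: \<phi>_def scaleR_add_left algebra_simps)
qed

text \<open>A discrete Gronwall argument: the sequence shadows the flow line at the accumulated time
  of its steps. Since \<alpha> is chosen before \<open>\<tau>0\<close>, it works for all small step
  parameters at once.\<close>

lemma follows_reaches:
  fixes F :: "'a::euclidean_space \<Rightarrow> 'a"
  assumes \<gamma>: "\<And>t. 0 \<le> t \<Longrightarrow> (\<gamma> has_vector_derivative F (\<gamma> t)) (at t within {0..})"
    and lip: "\<And>x y. norm (F x - F y) \<le> L * norm (x - y)" and L: "0 < L"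
    and B: "\<And>x. norm (F x) \<le> B" and T: "0 \<le> T" and \<epsilon>: "0 < \<epsilon>"
  shows "\<exists>\<alpha>>0. \<forall>\<tau>0>0. \<forall>xs. xs 0 = \<gamma> 0 \<and> follows F {x. \<exists>t\<in>{0..T}. dist x (\<gamma> t) \<le> \<epsilon>} \<tau>0 \<alpha> xs
           \<longrightarrow> (\<exists>k. dist (xs k) (\<gamma> T) < \<epsilon>)"
proof -
  have B0: "0 \<le> B" using B[of 0] norm_ge_zero order_trans by blast
  \<comment> \<open>D L = 1 + L B is the error per unit of time, in units of \<alpha>: 1 from the
    scheme and L B from the curvature of the flow line.\<close>
  define D where "D = (1 + L * B) / L"
  have D: "0 < D" "D * L = 1 + L * B" using L B0 by (auto simp: D_def intro!: divide_pos_pos add_pos_nonneg)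
  \<comment> \<open>The summands pay for the Gronwall error up to time T, for the distance the flow
    covers during one last step, and for strictness.\<close>
  define Q where "Q = D * exp (L * T) + B + 1"
  have Q: "0 < Q" using D B0 by (auto simp: Q_def intro!: add_nonneg_pos)
  define \<alpha> where "\<alpha> = \<epsilon> / Q"
  have \<alpha>: "0 < \<alpha>" "\<alpha> * D * exp (L * T) + B * \<alpha> < \<epsilon>"
  proof -
    show "0 < \<alpha>" using Q \<epsilon> by (simp add: \<alpha>_def)
    have "\<alpha> * D * exp (L * T) + B * \<alpha> < \<alpha> * Q" using \<open>0 < \<alpha>\<close> by (simp add: Q_def algebra_simps)
    thus "\<alpha> * D * exp (L * T) + B * \<alpha> < \<epsilon>" using Q by (simp add: \<alpha>_def)
  qed
  have "\<exists>k. dist (xs k) (\<gamma> T) < \<epsilon>"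
    if \<tau>0: "0 < \<tau>0" and xs0: "xs 0 = \<gamma> 0"
      and fol: "follows F {x. \<exists>t\<in>{0..T}. dist x (\<gamma> t) \<le> \<epsilon>} \<tau>0 \<alpha> xs" for \<tau>0 xs
  proof (rule ccontr)
    assume no: "\<nexists>k. dist (xs k) (\<gamma> T) < \<epsilon>"
    \<comment> \<open>As long as \<open>\<gamma> T\<close> is missed, the shadow time stays at most
      T although it grows by at least \<open>\<tau>0\<close> per step; a large k refutes
      this.\<close>
    have claim: "\<exists>t\<in>{0..T}. real k * \<tau>0 \<le> t \<and> norm (xs k - \<gamma> t) \<le> \<alpha> * D * (exp (L * t) - 1)" for k
    proof (induction k)
      case 0
      show ?case using xs0 T by (intro bexI[of _ 0]) auto
    next
      case (Suc k)
      then obtain t where t: "0 \<le> t" "t \<le> T" "real k * \<tau>0 \<le> t"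
        and tn: "norm (xs k - \<gamma> t) \<le> \<alpha> * D * (exp (L * t) - 1)" by auto
      have small: "\<alpha> * D * (exp (L * s) - 1) \<le> \<alpha> * D * exp (L * T)" if "s \<le> T" for s
        using that \<alpha> D L by (intro mult_left_mono) (auto intro: order_trans[of _ "exp (L * s)"])
      have "\<alpha> * D * exp (L * T) < \<epsilon>" using \<alpha> B0 by (smt (verit) mult_nonneg_nonneg)
      hence "dist (xs k) (\<gamma> t) \<le> \<epsilon>" using tn small[of t] t by (simp add: dist_norm)
      then obtain \<tau> where \<tau>: "\<tau>0 \<le> \<tau>" "\<tau> \<le> \<alpha>" "norm (xs (Suc k) - xs k - \<tau> *\<^sub>R F (xs k)) \<le> \<tau> * \<alpha>"
        using fol t unfolding follows_def mem_Collect_eq Bex_def atLeastAtMost_iff by metis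
      have \<tau>pos: "0 < \<tau>" using \<tau> \<tau>0 by simp
      \<comment> \<open>A step across time T can start only within time \<alpha> of T, and then
        \<open>xs k\<close> is already close to \<open>\<gamma> T\<close>.\<close>
      have inT: "t + \<tau> \<le> T"
      proof (rule ccontr)
        assume "\<not> t + \<tau> \<le> T"
        hence "T - t \<le> \<alpha>" using \<tau> by simp
        hence "B * (T - t) \<le> B * \<alpha>" using B0 by (intro mult_left_mono)
        moreover have "norm (\<gamma> T - \<gamma> t) \<le> B * (T - t)"
          using flow_increment(1)[of \<gamma> F L B t "T - t"] \<gamma> lip L B t by auto
        moreover have "norm (xs k - \<gamma> T) \<le> norm (xs k - \<gamma> t) + norm (\<gamma> T - \<gamma> t)"
          using norm_triangle_ineq4[of "xs k - \<gamma> t" "\<gamma> T - \<gamma> t"] by simp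
        ultimately have "dist (xs k) (\<gamma> T) < \<epsilon>"
          unfolding dist_norm using tn small[OF t(2)] \<alpha>(2) by linarith
        with no show False by blast
      qed
      define a where "a = norm (xs k - \<gamma> t)"
      \<comment> \<open>The four terms are the old error, its transport by the Lipschitz field, the
        error of the scheme and the local error of the flow.\<close>
      have "xs (Suc k) - \<gamma> (t + \<tau>) = (xs k - \<gamma> t) + \<tau> *\<^sub>R (F (xs k) - F (\<gamma> t))
        + (xs (Suc k) - xs k - \<tau> *\<^sub>R F (xs k)) - (\<gamma> (t + \<tau>) - \<gamma> t - \<tau> *\<^sub>R F (\<gamma> t))"
        by (simp add: scaleR_diff_right)
      hence "norm (xs (Suc k) - \<gamma> (t + \<tau>)) \<le> a + norm (\<tau> *\<^sub>R (F (xs k) - F (\<gamma> t)))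
        + norm (xs (Suc k) - xs k - \<tau> *\<^sub>R F (xs k)) + norm (\<gamma> (t + \<tau>) - \<gamma> t - \<tau> *\<^sub>R F (\<gamma> t))"
        unfolding a_def by (smt (verit) norm_triangle_ineq norm_triangle_ineq4)
      also have "norm (\<tau> *\<^sub>R (F (xs k) - F (\<gamma> t))) \<le> \<tau> * (L * a)"
        using lip[of "xs k" "\<gamma> t"] \<tau>pos by (simp add: a_def)
      also have "norm (\<gamma> (t + \<tau>) - \<gamma> t - \<tau> *\<^sub>R F (\<gamma> t)) \<le> \<tau> * (L * B * \<tau>)"
        using flow_increment(2)[of \<gamma> F L B t \<tau>] \<gamma> lip L B t \<tau>pos by auto
      also have "\<tau> * (L * B * \<tau>) \<le> \<tau> * (L * B * \<alpha>)"
        using \<tau> \<tau>pos L B0 by (intro mult_left_mono) auto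
      also have "norm (xs (Suc k) - xs k - \<tau> *\<^sub>R F (xs k)) \<le> \<tau> * \<alpha>" by (rule \<tau>)
      finally have "norm (xs (Suc k) - \<gamma> (t + \<tau>)) \<le> (1 + L * \<tau>) * a + \<tau> * \<alpha> * (D * L)"
        by (simp add: D algebra_simps)
      also have "\<dots> \<le> (1 + L * \<tau>) * (\<alpha> * D * (exp (L * t) - 1)) + \<tau> * \<alpha> * (D * L)"
        using tn L \<tau>pos by (intro add_right_mono mult_left_mono) (auto simp: a_def)
      also have "\<dots> = \<alpha> * D * ((1 + L * \<tau>) * exp (L * t) - 1)" by (simp add: algebra_simps)
      also have "\<dots> \<le> \<alpha> * D * (exp (L * \<tau>) * exp (L * t) - 1)"
        using \<alpha> D exp_ge_add_one_self[of "L * \<tau>"] by (intro mult_left_mono diff_right_mono mult_right_mono) auto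
      also have "exp (L * \<tau>) * exp (L * t) = exp (L * (t + \<tau>))" by (simp add: exp_add[symmetric] algebra_simps)
      finally show ?case using inT t \<tau> \<tau>pos by (intro bexI[of _ "t + \<tau>"]) (auto simp: algebra_simps)
    qed
    obtain k where "T < real k * \<tau>0" using reals_Archimedean3[OF \<tau>0] by blast
    with claim[of k] show False by auto
  qed
  with \<alpha> show ?thesis by blast
qed

text \<open>Two zones: from within r/4 a step of length r/4 cannot leave the ball of radius r/2, and
  in the shell between r/4 and r/2 the inward field beats the errors, so the distance to p does not
  grow. The scheme therefore needs to be controlled only in the shell, where the gradient does not
  vanish.\<close>

lemma follows_trapped:
  fixes F :: "'a::real_inner \<Rightarrow> 'a"
  assumes F: "\<And>x. x \<in> cball p r \<Longrightarrow> F x \<bullet> (x - p) \<le> - (\<mu> * (norm (x - p))\<^sup>2)"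
    and B: "\<And>x. norm (F x) \<le> B" and \<mu>: "0 < \<mu>" and r: "0 < r"
  shows "\<exists>\<alpha>>0. \<forall>\<tau>0>0. \<forall>xs k0. follows F {x. r / 4 \<le> dist x p \<and> dist x p \<le> r / 2} \<tau>0 \<alpha> xs \<and>
           (\<forall>k. xs k \<in> cball p r \<longrightarrow> norm (xs (Suc k) - xs k) \<le> r / 4) \<and> xs k0 \<in> cball p (r / 2)
           \<longrightarrow> (\<forall>k\<ge>k0. xs k \<in> cball p (r / 2))"
proof -
  have B0: "0 \<le> B" using B[of 0] norm_ge_zero order_trans by blast
  \<comment> \<open>The inward drift \<open>2 * \<mu> * (r / 4)\<^sup>2\<close> has to pay for the
    error of direction, at most \<alpha> r, and for the quadratic term of the step, at most
    \<open>\<alpha> * (B + 1)\<^sup>2\<close>.\<close>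
  define \<alpha> where "\<alpha> = min 1 (2 * \<mu> * (r / 4)\<^sup>2 / (r + (B + 1)\<^sup>2))"
  have den: "0 < r + (B + 1)\<^sup>2" using r by (simp add: add_pos_nonneg)
  have \<alpha>: "0 < \<alpha>" "\<alpha> \<le> 1" "\<alpha> * (r + (B + 1)\<^sup>2) \<le> 2 * \<mu> * (r / 4)\<^sup>2"
  proof -
    show "0 < \<alpha>" using den \<mu> r by (simp add: \<alpha>_def)
    have "\<alpha> \<le> 2 * \<mu> * (r / 4)\<^sup>2 / (r + (B + 1)\<^sup>2)" by (simp add: \<alpha>_def)
    thus "\<alpha> * (r + (B + 1)\<^sup>2) \<le> 2 * \<mu> * (r / 4)\<^sup>2" using den by (simp add: pos_le_divide_eq)
  qed (simp add: \<alpha>_def)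
  have step: "xs (Suc k) \<in> cball p (r / 2)"
    if \<tau>0: "0 < \<tau>0" and fol: "follows F {x. r / 4 \<le> dist x p \<and> dist x p \<le> r / 2} \<tau>0 \<alpha> xs"
      and small: "\<forall>k. xs k \<in> cball p r \<longrightarrow> norm (xs (Suc k) - xs k) \<le> r / 4"
      and k: "xs k \<in> cball p (r / 2)" for \<tau>0 xs k
  proof (cases "dist (xs k) p \<le> r / 4")
    case True
    have "dist (xs (Suc k)) p \<le> norm (xs (Suc k) - xs k) + dist (xs k) p"
      by (metis dist_norm dist_triangle)
    moreover have "xs k \<in> cball p r" using k r by simp
    ultimately have "dist (xs (Suc k)) p \<le> r / 2" using small True by force
    thus ?thesis by (simp add: dist_commute)
  next
    case False
    hence kk: "r / 4 \<le> dist (xs k) p" "dist (xs k) p \<le> r / 2" using k by (auto simp: dist_commute)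
    then obtain \<tau> where \<tau>: "\<tau>0 \<le> \<tau>" "\<tau> \<le> \<alpha>" "norm (xs (Suc k) - xs k - \<tau> *\<^sub>R F (xs k)) \<le> \<tau> * \<alpha>"
      using fol unfolding follows_def by auto
    have \<tau>pos: "0 < \<tau>" using \<tau> \<tau>0 by simp
    define d where "d = xs k - p"
    define v where "v = (1 / \<tau>) *\<^sub>R (xs (Suc k) - xs k)"
    have d: "r / 4 \<le> norm d" "norm d \<le> r / 2" using kk by (auto simp: d_def dist_norm)
    have v: "norm (v - F (xs k)) \<le> \<alpha>"
    proof -
      have "xs (Suc k) - xs k - \<tau> *\<^sub>R F (xs k) = \<tau> *\<^sub>R (v - F (xs k))"
        using \<tau>pos by (simp add: v_def scaleR_diff_right)
      thus ?thesis using \<tau>(3) \<tau>pos by simp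
    qed
    have nv: "norm v \<le> B + 1" using v B[of "xs k"] \<alpha> norm_triangle_sub[of v "F (xs k)"] by linarith
    have "v \<bullet> d = F (xs k) \<bullet> d + (v - F (xs k)) \<bullet> d" by (simp add: inner_diff_left)
    also have "\<dots> \<le> - (\<mu> * (norm d)\<^sup>2) + \<alpha> * (r / 2)"
    proof (rule add_mono)
      show "F (xs k) \<bullet> d \<le> - (\<mu> * (norm d)\<^sup>2)" using F[of "xs k"] k r by (simp add: d_def)
      have "(v - F (xs k)) \<bullet> d \<le> norm (v - F (xs k)) * norm d" by (rule norm_cauchy_schwarz)
      also have "\<dots> \<le> \<alpha> * (r / 2)" using v d \<alpha> by (intro mult_mono) auto
      finally show "(v - F (xs k)) \<bullet> d \<le> \<alpha> * (r / 2)" .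
    qed
    also have "- (\<mu> * (norm d)\<^sup>2) \<le> - (\<mu> * (r / 4)\<^sup>2)" using d \<mu> r by (simp add: power_mono)
    finally have vd: "2 * (v \<bullet> d) \<le> - (2 * \<mu> * (r / 4)\<^sup>2) + \<alpha> * r" by simp
    have "\<tau> * (norm v)\<^sup>2 \<le> \<alpha> * (B + 1)\<^sup>2" using nv \<tau> \<tau>pos \<alpha> by (intro mult_mono power_mono) auto
    hence "2 * (v \<bullet> d) + \<tau> * (norm v)\<^sup>2 \<le> 0" using vd \<alpha>(3) by (simp add: distrib_left)
    hence "\<tau> * (2 * (v \<bullet> d) + \<tau> * (norm v)\<^sup>2) \<le> 0" using \<tau>pos by (simp add: mult_nonneg_nonpos)
    moreover have "xs (Suc k) - p = d + \<tau> *\<^sub>R v" using \<tau>pos by (simp add: d_def v_def)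
    ultimately have "(norm (xs (Suc k) - p))\<^sup>2 \<le> (norm d)\<^sup>2"
      by (simp add: norm_add_scaleR_square power2_eq_square[of \<tau>] algebra_simps)
    hence "norm (xs (Suc k) - p) \<le> norm d" by (simp add: norm_le_square power2_norm_eq_inner norm_le)
    thus ?thesis using d by (simp add: dist_norm norm_minus_commute)
  qed
  have "\<forall>\<tau>0>0. \<forall>xs k0. follows F {x. r / 4 \<le> dist x p \<and> dist x p \<le> r / 2} \<tau>0 \<alpha> xs \<and>
           (\<forall>k. xs k \<in> cball p r \<longrightarrow> norm (xs (Suc k) - xs k) \<le> r / 4) \<and> xs k0 \<in> cball p (r / 2)
           \<longrightarrow> (\<forall>k\<ge>k0. xs k \<in> cball p (r / 2))"
  proof (intro allI impI, elim conjE)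
    fix \<tau>0 :: real and xs k0 and k :: nat
    assume A: "\<tau>0 > 0" "follows F {x. r / 4 \<le> dist x p \<and> dist x p \<le> r / 2} \<tau>0 \<alpha> xs"
      "\<forall>k. xs k \<in> cball p r \<longrightarrow> norm (xs (Suc k) - xs k) \<le> r / 4" "xs k0 \<in> cball p (r / 2)"
      and "k \<ge> k0"
    from this(5) show "xs k \<in> cball p (r / 2)"
      by (induction k rule: dec_induct) (use A step in blast)+
  qed
  with \<alpha> show ?thesis by blast
qed

subsection \<open>The four methods as discretised gradient flows\<close>

text \<open>At the stopping step a tie may still move the point, so the final point
  \<open>xs (Suc i)\<close> can differ from \<open>xs i\<close>. It is \<open>xs i\<close> that
  maximises g on its ball; the final point only lies in that ball and has the same value.\<close>

lemma max_shift_stopped: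
  assumes run: "max_shift g \<epsilon> x0 xs" and eq: "g (xs (Suc j)) = g (xs j)" and \<epsilon>: "0 < \<epsilon>"
  obtains i where "g (xs (Suc i)) = g (xs i)" "i \<le> j" "\<forall>y\<in>cball (xs i) \<epsilon>. g y \<le> g (xs i)"
    "xs (Suc i) \<in> cball (xs i) \<epsilon>" "\<forall>k>i. xs k = xs (Suc i)"
proof -
  define i where "i = (LEAST i. g (xs (Suc i)) = g (xs i))"
  have i: "g (xs (Suc i)) = g (xs i)" unfolding i_def using eq by (rule LeastI)
  have le: "i \<le> j" unfolding i_def using eq by (rule Least_le)
  have "\<not> (\<exists>l<i. g (xs (Suc l)) = g (xs l))" unfolding i_def using not_less_Least by blast
  hence "is_arg_max g (\<lambda>y. y \<in> cball (xs i) \<epsilon>) (xs (Suc i))"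
    using run unfolding max_shift_def by metis
  hence a: "xs (Suc i) \<in> cball (xs i) \<epsilon>" "\<forall>y\<in>cball (xs i) \<epsilon>. g y \<le> g (xs i)"
    using i by (auto simp: is_arg_max_iff)
  have "xs k = xs (Suc i)" if "k > i" for k
    using Suc_leI[OF that]
  proof (induction k rule: dec_induct)
    case (step k)
    hence "\<exists>l<k. g (xs (Suc l)) = g (xs l)" using i by (auto intro: exI[of _ i])
    hence "xs (Suc k) = xs k" using run unfolding max_shift_def by metis
    with step show ?case by simp
  qed simp
  with i a le that show ?thesis by blast
qed

context lipschitz_gradient
begin

text \<open>For \<rho> L < 1 the gradient along the whole search segment keeps a positive component
  in the starting direction, so g is strictly increasing there and the only maximiser is the far
  end.\<close>

lemma line_search_shift_imp_euler_shift:
  assumes "line_search_shift g \<rho> x0 xs" and \<rho>: "0 < \<rho>" "\<rho> * L < 1"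
  shows "euler_shift g \<rho> x0 xs"
  unfolding euler_shift_def
proof (intro conjI allI)
  show "xs 0 = x0" using assms by (simp add: line_search_shift_def)
  fix k
  obtain r where am: "is_arg_max (\<lambda>s. g (xs k + s *\<^sub>R grad g (xs k))) (\<lambda>s. s \<in> {0..\<rho>}) r"
    and xs: "xs (Suc k) = xs k + r *\<^sub>R grad g (xs k)"
    using assms by (auto simp: line_search_shift_def)
  show "xs (Suc k) = xs k + \<rho> *\<^sub>R grad g (xs k)"
  proof (cases "grad g (xs k) = 0 \<or> r = \<rho>")
    case False
    define x G where "x = xs k" and "G = grad g x"
    have r: "0 \<le> r" "r < \<rho>" "g (x + \<rho> *\<^sub>R G) \<le> g (x + r *\<^sub>R G)"
      using am False \<rho> by (auto simp: is_arg_max_iff x_def G_def)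
    obtain s where s: "0 < s" "s < \<rho> - r"
      and eq: "g (x + r *\<^sub>R G + (\<rho> - r) *\<^sub>R G) - g (x + r *\<^sub>R G) = (\<rho> - r) * (grad g (x + r *\<^sub>R G + s *\<^sub>R G) \<bullet> G)"
      using gradient_mvt[of g "\<rho> - r" "x + r *\<^sub>R G" G] grad r by auto
    have "grad g (x + r *\<^sub>R G + s *\<^sub>R G) \<bullet> G = G \<bullet> G + (grad g (x + (r + s) *\<^sub>R G) - G) \<bullet> G"
      by (simp add: inner_diff_left scaleR_add_left add.assoc)
    moreover have "\<bar>(grad g (x + (r + s) *\<^sub>R G) - G) \<bullet> G\<bar> \<le> (L * (\<rho> * norm G)) * norm G"
    proof (rule order_trans[OF Cauchy_Schwarz_ineq2 mult_right_mono])
      have "norm (grad g (x + (r + s) *\<^sub>R G) - G) \<le> L * ((r + s) * norm G)"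
        using lip[of "x + (r + s) *\<^sub>R G" x] r s by (simp add: G_def)
      also have "\<dots> \<le> L * (\<rho> * norm G)" using r s L_pos by (intro mult_left_mono mult_right_mono) auto
      finally show "norm (grad g (x + (r + s) *\<^sub>R G) - G) \<le> L * (\<rho> * norm G)" .
    qed simp
    moreover have "(L * (\<rho> * norm G)) * norm G < G \<bullet> G"
    proof -
      have "0 < G \<bullet> G" using False by (simp add: G_def x_def)
      from mult_strict_right_mono[OF \<rho>(2) this] show ?thesis
        by (simp add: power2_norm_eq_inner[symmetric] power2_eq_square mult_ac)
    qed
    ultimately have "0 < grad g (x + r *\<^sub>R G + s *\<^sub>R G) \<bullet> G" by linarith
    hence "0 < g (x + r *\<^sub>R G + (\<rho> - r) *\<^sub>R G) - g (x + r *\<^sub>R G)" unfolding eq using r by simp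
    moreover have "x + r *\<^sub>R G + (\<rho> - r) *\<^sub>R G = x + \<rho> *\<^sub>R G" by (simp add: scaleR_diff_left)
    ultimately show ?thesis using r by simp
  qed (use xs in auto)
qed

lemma max_shift_follows:
  assumes m: "0 < m" "\<And>x. x \<in> W \<Longrightarrow> m \<le> norm (grad g x)"
    and B: "\<And>x. x \<in> W \<Longrightarrow> norm (grad g x) \<le> B"
    and \<epsilon>: "0 < \<epsilon>" "\<epsilon> * L < m" and \<alpha>: "0 < \<alpha>" "\<epsilon> \<le> \<alpha> * m" "4 * L * \<epsilon> * B\<^sup>2 \<le> \<alpha>\<^sup>2 * m"
    and run: "max_shift g \<epsilon> x0 xs"
  shows "follows (grad g) W (\<epsilon> / B) \<alpha> xs"
  unfolding follows_def
proof (intro allI impI)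
  fix k assume k: "xs k \<in> W"
  \<comment> \<open>A stopped process would sit within \<epsilon> of a mode, where the gradient is
    at most L \<epsilon> < m; that is impossible in \<open>W\<close>.\<close>
  have "\<not> (\<exists>j<k. g (xs (Suc j)) = g (xs j))"
  proof
    assume "\<exists>j<k. g (xs (Suc j)) = g (xs j)"
    then obtain j where j: "j < k" "g (xs (Suc j)) = g (xs j)" by blast
    obtain i where "g (xs (Suc i)) = g (xs i)" and i: "i \<le> j" "\<forall>y\<in>cball (xs i) \<epsilon>. g y \<le> g (xs i)"
      "xs (Suc i) \<in> cball (xs i) \<epsilon>" "\<forall>k>i. xs k = xs (Suc i)"
      by (rule max_shift_stopped[OF run j(2) \<epsilon>(1)])
    have "is_mode g (xs i)" using i(2) \<epsilon>(1) unfolding is_mode_def by (intro exI[of _ \<epsilon>]) auto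
    hence "grad g (xs i) = 0" using diff by (rule is_mode_imp_grad_0)
    hence "norm (grad g (xs (Suc i))) \<le> L * norm (xs (Suc i) - xs i)" using lip[of "xs (Suc i)" "xs i"] by simp
    also have "\<dots> \<le> L * \<epsilon>" using i(3) L_pos by (simp add: dist_norm norm_minus_commute)
    also have "xs (Suc i) = xs k" using i(1,4) j(1) by (metis le_less_trans)
    finally have "norm (grad g (xs k)) \<le> L * \<epsilon>" .
    with m(2)[OF k] \<epsilon> show False by (simp add: mult.commute)
  qed
  hence am: "is_arg_max g (\<lambda>y. y \<in> cball (xs k) \<epsilon>) (xs (Suc k))"
    using run unfolding max_shift_def by metis
  hence y: "norm (xs (Suc k) - xs k) \<le> \<epsilon>" and max: "\<And>y. y \<in> cball (xs k) \<epsilon> \<Longrightarrow> g y \<le> g (xs (Suc k))"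
    by (simp_all add: is_arg_max_iff dist_norm norm_minus_commute)
  have "g (xs k + \<epsilon> *\<^sub>R sgn (grad g (xs k))) \<le> g (xs (Suc k))"
    using \<epsilon> by (intro max) (simp add: dist_norm norm_sgn)
  hence "g (xs k + \<epsilon> *\<^sub>R sgn (grad g (xs k))) \<le> g (xs k + (xs (Suc k) - xs k))" by simp
  from shift_step[OF m(1) m(2)[OF k] B[OF k] \<epsilon>(1) y \<alpha> this]
  show "\<exists>\<tau>\<ge>\<epsilon> / B. \<tau> \<le> \<alpha> \<and> norm (xs (Suc k) - xs k - \<tau> *\<^sub>R grad g (xs k)) \<le> \<tau> * \<alpha>" .
qed

lemma max_slope_shift_follows:
  assumes m: "0 < m" "\<And>x. x \<in> W \<Longrightarrow> m \<le> norm (grad g x)"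
    and B: "\<And>x. x \<in> W \<Longrightarrow> norm (grad g x) \<le> B"
    and \<epsilon>: "0 < \<epsilon>" "\<epsilon> * L < m" and \<alpha>: "0 < \<alpha>" "\<epsilon> \<le> \<alpha> * m" "4 * L * \<epsilon> * B\<^sup>2 \<le> \<alpha>\<^sup>2 * m"
    and c: "0 < c" "c < 1"
    and run: "max_slope_shift c g \<epsilon> x0 xs"
  shows "follows (grad g) W (c * \<epsilon> / B) \<alpha> xs"
  unfolding follows_def
proof (intro allI impI)
  fix k assume k: "xs k \<in> W"
  have mB: "m \<le> B" using m(2)[OF k] B[OF k] by linarith
  have "\<not> (\<exists>y\<in>ball (xs k) \<epsilon>. is_mode g y)"
  proof
    assume "\<exists>y\<in>ball (xs k) \<epsilon>. is_mode g y"
    then obtain y where y: "dist (xs k) y < \<epsilon>" "is_mode g y" by auto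
    hence "grad g y = 0" using diff by (blast intro: is_mode_imp_grad_0)
    hence "norm (grad g (xs k)) \<le> L * norm (xs k - y)" using lip[of "xs k" y] by simp
    also have "\<dots> \<le> L * \<epsilon>" using y L_pos by (simp add: dist_norm)
    finally show False using m(2)[OF k] \<epsilon> by (simp add: mult.commute)
  qed
  hence am: "is_arg_max (\<lambda>y. (g y - g (xs k)) / norm (y - xs k))
      (\<lambda>y. y \<in> cball (xs k) \<epsilon> - ball (xs k) (c * \<epsilon>)) (xs (Suc k))"
    using run unfolding max_slope_shift_def by metis
  \<comment> \<open>Comparing with a gradient move of exactly the chosen length makes the
    denominators equal, so that maximal slope becomes maximal value and \<open>shift_step\<close>
    applies.\<close>
  define s where "s = norm (xs (Suc k) - xs k)"
  have s: "c * \<epsilon> \<le> s" "s \<le> \<epsilon>" using am by (auto simp: is_arg_max_iff s_def dist_norm norm_minus_commute)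
  have s0: "0 < s" using s c \<epsilon> by (meson mult_pos_pos less_le_trans)
  have sg: "norm (sgn (grad g (xs k))) = 1" using m(2)[OF k] m(1) by (auto simp: norm_sgn)
  define y where "y = xs k + s *\<^sub>R sgn (grad g (xs k))"
  have y: "norm (y - xs k) = s" using sg s0 by (simp add: y_def)
  hence "y \<in> cball (xs k) \<epsilon> - ball (xs k) (c * \<epsilon>)" using s by (auto simp: dist_norm norm_minus_commute)
  hence "(g y - g (xs k)) / s \<le> (g (xs (Suc k)) - g (xs k)) / s"
    using am y unfolding is_arg_max_iff s_def by metis
  hence ge: "g y \<le> g (xs (Suc k))" using s0 by (simp add: divide_le_cancel)
  have "s \<le> \<alpha> * m" using s \<alpha> by simp
  moreover have "4 * L * s * B\<^sup>2 \<le> 4 * L * \<epsilon> * B\<^sup>2"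
    using s L_pos by (intro mult_right_mono mult_left_mono) auto
  hence "4 * L * s * B\<^sup>2 \<le> \<alpha>\<^sup>2 * m" using \<alpha> by linarith
  moreover have "g (xs k + s *\<^sub>R sgn (grad g (xs k))) \<le> g (xs k + (xs (Suc k) - xs k))"
    using ge by (simp add: y_def)
  ultimately obtain \<tau> where \<tau>: "s / B \<le> \<tau>" "\<tau> \<le> \<alpha>"
      "norm (xs (Suc k) - xs k - \<tau> *\<^sub>R grad g (xs k)) \<le> \<tau> * \<alpha>"
    using shift_step[OF m(1) m(2)[OF k] B[OF k] s0 eq_refl[OF s_def[symmetric]] \<alpha>(1)] by blast
  moreover have "c * \<epsilon> / B \<le> s / B" using s mB m(1) by (intro divide_right_mono) auto
  ultimately show "\<exists>\<tau>\<ge>c * \<epsilon> / B. \<tau> \<le> \<alpha> \<and> norm (xs (Suc k) - xs k - \<tau> *\<^sub>R grad g (xs k)) \<le> \<tau> * \<alpha>"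
    by (intro exI[of _ \<tau>]) auto
qed

lemma euler_shift_follows:
  assumes "euler_shift g \<rho> x0 xs" "0 < \<rho>" "\<rho> \<le> \<alpha>"
  shows "follows (grad g) W \<rho> \<alpha> xs"
  unfolding follows_def
proof (intro allI impI)
  fix k
  show "\<exists>\<tau>\<ge>\<rho>. \<tau> \<le> \<alpha> \<and> norm (xs (Suc k) - xs k - \<tau> *\<^sub>R grad g (xs k)) \<le> \<tau> * \<alpha>"
    using assms by (intro exI[of _ \<rho>]) (auto simp: euler_shift_def)
qed

lemma methods_follow:
  assumes m: "0 < m" "\<And>x. x \<in> W \<Longrightarrow> m \<le> norm (grad g x)"
    and B: "0 < B" "\<And>x. x \<in> W \<Longrightarrow> norm (grad g x) \<le> B"
    and \<alpha>: "0 < \<alpha>" and c: "0 < c" "c < 1"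
  shows "\<exists>\<theta>0>0. \<forall>\<theta>. 0 < \<theta> \<and> \<theta> < \<theta>0 \<longrightarrow> (\<forall>run\<in>hill_climbing_methods c. \<exists>\<tau>0>0. \<forall>xs.
           run g \<theta> x0 xs \<longrightarrow> follows (grad g) W \<tau>0 \<alpha> xs)"
proof -
  \<comment> \<open>In order: bounded Euler duration; line search coincides with Euler; bounded
    duration of a shift step; no stopping and no mode within reach; small deviation of a shift step
    from the gradient direction.\<close>
  define \<theta>0 where "\<theta>0 = Min {\<alpha>, 1 / L, \<alpha> * m, m / L, \<alpha>\<^sup>2 * m / (4 * L * B\<^sup>2)}"
  have pos: "0 < \<theta>0" using m \<alpha> L_pos B by (simp add: \<theta>0_def)
  have "\<exists>\<tau>0>0. \<forall>xs. run g \<theta> x0 xs \<longrightarrow> follows (grad g) W \<tau>0 \<alpha> xs"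
    if \<theta>: "0 < \<theta>" "\<theta> < \<theta>0" and run: "run \<in> hill_climbing_methods c" for \<theta> run
  proof -
    have "\<theta> < \<alpha>" "\<theta> < 1 / L" "\<theta> < \<alpha> * m" "\<theta> < m / L" "\<theta> < \<alpha>\<^sup>2 * m / (4 * L * B\<^sup>2)"
      using \<theta>(2) unfolding \<theta>0_def by simp_all
    hence le: "\<theta> \<le> \<alpha>" "\<theta> * L < 1" "\<theta> \<le> \<alpha> * m" "\<theta> * L < m" "4 * L * \<theta> * B\<^sup>2 \<le> \<alpha>\<^sup>2 * m"
      using L_pos B by (simp_all add: field_simps less_imp_le)
    show ?thesis using run unfolding hill_climbing_methods_def
    proof (elim insertE emptyE)
      assume "run = max_shift"
      thus ?thesis
        using max_shift_follows[OF m B(2) \<theta>(1) le(4) \<alpha> le(3) le(5)] \<theta> B by (auto intro!: exI[of _ "\<theta> / B"])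
    next
      assume "run = max_slope_shift c"
      thus ?thesis
        using max_slope_shift_follows[OF m B(2) \<theta>(1) le(4) \<alpha> le(3) le(5) c] \<theta> B c
        by (auto intro!: exI[of _ "c * \<theta> / B"])
    next
      assume "run = euler_shift"
      thus ?thesis using euler_shift_follows \<theta> le by blast
    next
      assume "run = line_search_shift"
      thus ?thesis using line_search_shift_imp_euler_shift[OF _ \<theta>(1) le(2)] euler_shift_follows \<theta> le by blast
    qed
  qed
  with pos show ?thesis by blast
qed

lemma methods_step_le:
  assumes B: "0 \<le> B" "\<And>x. x \<in> S \<Longrightarrow> norm (grad g x) \<le> B" and \<sigma>: "0 < \<sigma>"
  shows "\<exists>\<theta>0>0. \<forall>\<theta>. 0 < \<theta> \<and> \<theta> < \<theta>0 \<longrightarrow> (\<forall>run\<in>hill_climbing_methods c. \<forall>xs.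
           run g \<theta> x0 xs \<longrightarrow> (\<forall>k. xs k \<in> S \<longrightarrow> norm (xs (Suc k) - xs k) \<le> \<sigma>))"
proof -
  \<comment> \<open>\<open>B + 1\<close> only guards against B = 0.\<close>
  define \<theta>0 where "\<theta>0 = Min {\<sigma>, 1 / L, \<sigma> / (B + 1)}"
  have pos: "0 < \<theta>0" using \<sigma> L_pos B by (simp add: \<theta>0_def)
  have "norm (xs (Suc k) - xs k) \<le> \<sigma>"
    if \<theta>: "0 < \<theta>" "\<theta> < \<theta>0" and run: "run \<in> hill_climbing_methods c" "run g \<theta> x0 xs" and k: "xs k \<in> S"
    for \<theta> run xs k
  proof -
    have "\<theta> < \<sigma>" "\<theta> < 1 / L" "\<theta> < \<sigma> / (B + 1)" using \<theta>(2) unfolding \<theta>0_def by simp_all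
    hence le: "\<theta> \<le> \<sigma>" "\<theta> * L < 1" "\<theta> * (B + 1) \<le> \<sigma>"
      using L_pos B by (simp_all add: pos_less_divide_eq less_imp_le)
    have euler: "norm (xs (Suc k) - xs k) \<le> \<sigma>" if "euler_shift g \<theta> x0 xs"
    proof -
      have "norm (xs (Suc k) - xs k) = \<theta> * norm (grad g (xs k))"
        using that \<theta> by (simp add: euler_shift_def)
      also have "\<dots> \<le> \<theta> * (B + 1)" using B(2)[OF k] \<theta> by (intro mult_left_mono) auto
      finally show ?thesis using le by simp
    qed
    show ?thesis using run(1) unfolding hill_climbing_methods_def
    proof (elim insertE emptyE)
      assume "run = max_shift"
      hence "max_shift g \<theta> x0 xs" using run(2) by simp
      hence "xs (Suc k) = xs k \<or> is_arg_max g (\<lambda>y. y \<in> cball (xs k) \<theta>) (xs (Suc k))"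
        unfolding max_shift_def by metis
      thus ?thesis using le \<sigma> by (auto simp: is_arg_max_iff dist_norm norm_minus_commute)
    next
      assume "run = max_slope_shift c"
      hence "max_slope_shift c g \<theta> x0 xs" using run(2) by simp
      hence "xs (Suc k) \<in> ball (xs k) \<theta> \<or> xs (Suc k) \<in> cball (xs k) \<theta> - ball (xs k) (c * \<theta>)"
        unfolding max_slope_shift_def is_arg_max_iff by metis
      thus ?thesis using le \<sigma> by (auto simp: dist_norm norm_minus_commute)
    next
      assume "run = euler_shift"
      thus ?thesis using euler run by simp
    next
      assume "run = line_search_shift"
      thus ?thesis using euler line_search_shift_imp_euler_shift[OF _ \<theta>(1) le(2)] run by simp
    qed
  qed
  with pos show ?thesis by blast
qed

subsection \<open>Convergence near a nondegenerate maximum\<close>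

text \<open>A Lyapunov argument: g increases along the sequence and is bounded on C, so the
  increments and with them \<psi> tend to 0, and on a compact set this forces the only possible zero
  of \<psi>. The methods differ only in the choice of \<psi>.\<close>

lemma ascent_tendsto:
  assumes C: "compact C" and \<psi>: "continuous_on C \<psi>" "\<And>x. x \<in> C \<Longrightarrow> 0 \<le> \<psi> x"
    "\<And>x. x \<in> C \<Longrightarrow> \<psi> x = 0 \<Longrightarrow> x = z"
    and xs: "\<And>k. k \<ge> k0 \<Longrightarrow> xs k \<in> C" "\<And>k. k \<ge> k0 \<Longrightarrow> g (xs k) + \<psi> (xs k) \<le> g (xs (Suc k))"
  shows "xs \<longlonglongrightarrow> z"
proof -
  define u where "u k = g (xs (k + k0))" for k
  have step: "u k + \<psi> (xs (k + k0)) \<le> u (Suc k)" for k using xs(2)[of "k + k0"] by (simp add: u_def)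
  have \<psi>0: "0 \<le> \<psi> (xs (k + k0))" for k using \<psi>(2) xs(1) by simp
  have "bounded (g ` C)" using C continuous_g by (intro compact_imp_bounded compact_continuous_image)
  hence "bounded (range u)" by (rule bounded_subset) (auto simp: u_def intro!: xs)
  moreover have "incseq u" using step \<psi>0 by (intro incseq_SucI) (smt (verit))
  ultimately obtain l where l: "u \<longlonglongrightarrow> l" by (metis Bseq_mono_convergent Bseq_eq_bounded incseqD convergent_def)
  hence "(\<lambda>k. u (Suc k) - u k) \<longlonglongrightarrow> l - l" by (intro tendsto_diff LIMSEQ_Suc)
  hence lim: "(\<lambda>k. u (Suc k) - u k) \<longlonglongrightarrow> 0" by simp
  have \<psi>lim: "(\<lambda>k. \<psi> (xs (k + k0))) \<longlonglongrightarrow> 0"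
  proof (rule tendsto_sandwich[OF _ _ tendsto_const lim])
    show "\<forall>\<^sub>F k in sequentially. 0 \<le> \<psi> (xs (k + k0))" using \<psi>0 by (simp add: always_eventually)
    have "\<psi> (xs (k + k0)) \<le> u (Suc k) - u k" for k using step[of k] by simp
    thus "\<forall>\<^sub>F k in sequentially. \<psi> (xs (k + k0)) \<le> u (Suc k) - u k" by (simp add: always_eventually)
  qed
  have "(\<lambda>k. xs (k + k0)) \<longlonglongrightarrow> z"
  proof (rule tendstoI)
    fix e :: real assume e: "e > 0"
    show "\<forall>\<^sub>F k in sequentially. dist (xs (k + k0)) z < e"
    proof (cases "C - ball z e = {}")
      case True
      have "xs (k + k0) \<in> ball z e" for k using True xs(1)[of "k + k0"] by auto
      thus ?thesis by (intro always_eventually) (simp add: dist_commute)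
    next
      case False
      have "compact (C - ball z e)" using C by (intro compact_diff) auto
      moreover have "continuous_on (C - ball z e) \<psi>" using \<psi>(1) by (rule continuous_on_subset) auto
      ultimately obtain y where y: "y \<in> C - ball z e" "\<forall>x\<in>C - ball z e. \<psi> y \<le> \<psi> x"
        using continuous_attains_inf[of "C - ball z e" \<psi>] False by blast
      hence "0 < \<psi> y" using \<psi>(2)[of y] \<psi>(3)[of y] e by force
      with \<psi>lim have "\<forall>\<^sub>F k in sequentially. \<psi> (xs (k + k0)) < \<psi> y" by (rule order_tendstoD)
      thus ?thesis
      proof eventually_elim
        case (elim k)
        hence "xs (k + k0) \<notin> C - ball z e" using y by force
        thus ?case using xs(1)[of "k + k0"] by (auto simp: dist_commute)
      qed
    qed
  qed
  thus ?thesis by (rule LIMSEQ_offset)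
qed

lemma continuous_gradient_gain: "continuous_on C (\<lambda>x. s * (norm (grad g x))\<^sup>2)"
  by (intro continuous_intros continuous_grad)

lemma euler_shift_tendsto:
  assumes C: "compact C" "\<And>x. x \<in> C \<Longrightarrow> grad g x = 0 \<Longrightarrow> x = z"
    and \<rho>: "0 < \<rho>" "2 * L * \<rho> \<le> 1"
    and run: "euler_shift g \<rho> x0 xs" and xs: "\<And>k. k \<ge> k0 \<Longrightarrow> xs k \<in> C"
  shows "xs \<longlonglongrightarrow> z"
proof (rule ascent_tendsto[OF C(1) continuous_gradient_gain[of C "\<rho> / 2"] _ _ xs])
  show "g (xs k) + \<rho> / 2 * (norm (grad g (xs k)))\<^sup>2 \<le> g (xs (Suc k))" for k
    using gradient_step_gain[of \<rho> "xs k"] \<rho> run by (simp add: euler_shift_def)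
qed (use C \<rho> in auto)

lemma max_shift_tendsto:
  assumes C: "compact C" "\<And>x y. x \<in> C \<Longrightarrow> dist x y \<le> \<epsilon> \<Longrightarrow> grad g y = 0 \<Longrightarrow> y = z"
      "\<And>x. x \<in> C \<Longrightarrow> g x = g z \<Longrightarrow> x = z"
    and \<epsilon>: "0 < \<epsilon>" and run: "max_shift g \<epsilon> x0 xs" and xs: "\<And>k. k \<ge> k0 \<Longrightarrow> xs k \<in> C"
  shows "xs \<longlonglongrightarrow> z"
proof (cases "\<exists>j. g (xs (Suc j)) = g (xs j)")
  case True
  then obtain j where j: "g (xs (Suc j)) = g (xs j)" by blast
  obtain i where i: "g (xs (Suc i)) = g (xs i)" "i \<le> j" "\<forall>y\<in>cball (xs i) \<epsilon>. g y \<le> g (xs i)"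
      "xs (Suc i) \<in> cball (xs i) \<epsilon>" "\<forall>k>i. xs k = xs (Suc i)"
    by (rule max_shift_stopped[OF run j \<epsilon>])
  \<comment> \<open>The critical point \<open>xs i\<close> may precede \<open>k0\<close> and lie
    outside C. The final point is in C and within \<epsilon> of it, which is why uniqueness of
    critical points is assumed on an \<epsilon>-neighbourhood of C.\<close>
  have "xs (i + k0 + 1) = xs (Suc i)" by (rule i(5)[rule_format]) simp
  hence inC: "xs (Suc i) \<in> C" using xs[of "i + k0 + 1"] by simp
  have "is_mode g (xs i)" using i(3) \<epsilon> unfolding is_mode_def by (intro exI[of _ \<epsilon>]) auto
  hence "grad g (xs i) = 0" using diff by (rule is_mode_imp_grad_0)
  hence "xs i = z" using C(2)[OF inC] i(4) by (simp add: dist_commute)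
  hence "xs (Suc i) = z" using C(3)[OF inC] i(1) by simp
  hence "\<forall>\<^sub>F k in sequentially. xs k = z"
    using i(5) by (intro eventually_sequentiallyI[of "Suc i"]) (metis Suc_le_lessD)
  thus ?thesis by (rule tendsto_eventually)
next
  case False
  obtain B where B: "0 < B" "\<And>x. x \<in> C \<Longrightarrow> norm (grad g x) \<le> B"
    using compact_imp_bounded[OF compact_continuous_image[OF continuous_grad C(1)]]
    unfolding bounded_pos by auto
  \<comment> \<open>A gradient step of duration \<open>s\<close> stays in every \<epsilon>-ball
    centred in C, so the maximum over the ball gains at least as much.\<close>
  define s where "s = min (1 / (2 * L)) (\<epsilon> / B)"
  have s: "0 < s" "2 * L * s \<le> 1" "s * B \<le> \<epsilon>"
  proof -
    show "0 < s" using L_pos \<epsilon> B by (simp add: s_def)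
    have "s \<le> 1 / (2 * L)" "s \<le> \<epsilon> / B" by (auto simp: s_def)
    thus "2 * L * s \<le> 1" "s * B \<le> \<epsilon>" using L_pos B by (simp_all add: field_simps)
  qed
  show ?thesis
  proof (rule ascent_tendsto[OF C(1) continuous_gradient_gain[of C "s / 2"] _ _ xs])
    fix k assume k: "k \<ge> k0"
    have "is_arg_max g (\<lambda>y. y \<in> cball (xs k) \<epsilon>) (xs (Suc k))"
      using run False unfolding max_shift_def by metis
    moreover have "s * norm (grad g (xs k)) \<le> s * B" using B(2)[OF xs[OF k]] s by (intro mult_left_mono) auto
    hence "s * norm (grad g (xs k)) \<le> \<epsilon>" using s by linarith
    hence "xs k + s *\<^sub>R grad g (xs k) \<in> cball (xs k) \<epsilon>" using s(1) by (simp add: dist_norm)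
    ultimately have "g (xs k + s *\<^sub>R grad g (xs k)) \<le> g (xs (Suc k))" by (auto simp: is_arg_max_iff)
    thus "g (xs k) + s / 2 * (norm (grad g (xs k)))\<^sup>2 \<le> g (xs (Suc k))"
      using gradient_step_gain[of s "xs k"] s by simp
  next
    fix x assume "x \<in> C" "s / 2 * (norm (grad g x))\<^sup>2 = 0"
    thus "x = z" using C(2)[of x x] s \<epsilon> by simp
  qed (use s in auto)
qed

text \<open>If some ball contains a mode, the process stops at z. Otherwise every point is at
  distance at least \<epsilon> from z and the gain stays proportional to that distance;
  \<open>ascent_tendsto\<close> then still yields convergence, although the lower bound \<epsilon>
  shows that this case cannot really occur.\<close>

lemma max_slope_shift_tendsto:
  assumes C: "compact C" "\<And>x y. x \<in> C \<Longrightarrow> dist x y \<le> \<epsilon> \<Longrightarrow> grad g y = 0 \<Longrightarrow> y = z"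
    and bd: "\<And>x. x \<in> C \<Longrightarrow> dist x z \<le> R" and R: "0 < R"
    and \<delta>: "0 < \<delta>" and \<mu>: "0 < \<mu>"
    and near: "\<And>x. x \<in> ball z \<delta> \<Longrightarrow> grad g x \<bullet> (x - z) \<le> - (\<mu> * (norm (x - z))\<^sup>2)"
    and far: "\<And>x. x \<in> C \<Longrightarrow> x \<notin> ball z \<delta> \<Longrightarrow> m \<le> norm (grad g x)" and m: "0 < m"
    and z: "is_mode g z" and c: "0 < c" "c < 1" and \<epsilon>: "0 < \<epsilon>" "2 * L * \<epsilon> \<le> m"
    and run: "max_slope_shift c g \<epsilon> x0 xs" and xs: "\<And>k. k \<ge> k0 \<Longrightarrow> xs k \<in> C"
  shows "xs \<longlonglongrightarrow> z"
proof (cases "\<exists>k\<ge>k0. \<exists>y\<in>ball (xs k) \<epsilon>. is_mode g y")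
  case True
  then obtain k where k: "k \<ge> k0" "\<exists>y\<in>ball (xs k) \<epsilon>. is_mode g y" by blast
  hence a: "xs (Suc k) \<in> ball (xs k) \<epsilon>" "is_mode g (xs (Suc k))" "\<forall>j\<ge>Suc k. xs j = xs (Suc k)"
    using run unfolding max_slope_shift_def by metis+
  have "xs (Suc k) = z"
    using C(2)[OF xs[OF k(1)], of "xs (Suc k)"] a(1) is_mode_imp_grad_0[OF a(2) diff] by simp
  hence "\<forall>\<^sub>F k in sequentially. xs k = z"
    using a(3) by (intro eventually_sequentiallyI[of "Suc k"]) metis
  thus ?thesis by (rule tendsto_eventually)
next
  case False
  \<comment> \<open>The least step length times the least slope per unit of distance to z; the two
    slopes come from the regions near z and away from it.\<close>
  define \<kappa> where "\<kappa> = c * \<epsilon> * min ((1 - c) * \<mu>) (m / (2 * R))"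
  have \<kappa>: "0 < \<kappa>" using c \<epsilon> \<mu> m R by (simp add: \<kappa>_def)
  have c\<epsilon>: "0 < c * \<epsilon>" "c * \<epsilon> \<le> \<epsilon>" using c \<epsilon> by (auto simp: mult_left_le_one_le less_imp_le)
  show ?thesis
  proof (rule ascent_tendsto[OF C(1), of "\<lambda>x. \<kappa> * norm (x - z)", OF _ _ _ xs])
    fix k assume k: "k \<ge> k0"
    define x where "x = xs k"
    have xC: "x \<in> C" using xs k by (simp add: x_def)
    have xz: "\<epsilon> \<le> norm (x - z)" using False k z by (force simp: x_def dist_norm)
    have am: "is_arg_max (\<lambda>y. (g y - g x) / norm (y - x)) (\<lambda>y. y \<in> cball x \<epsilon> - ball x (c * \<epsilon>)) (xs (Suc k))"
      using run False k unfolding max_slope_shift_def x_def by metis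
    have gain: "\<exists>w. norm w = 1 \<and> min ((1 - c) * \<mu>) (m / (2 * R)) * norm (x - z) \<le> (g (x + (c * \<epsilon>) *\<^sub>R w) - g x) / (c * \<epsilon>)"
    proof (cases "x \<in> ball z \<delta>")
      case True
      define n where "n = norm (x - z)"
      \<comment> \<open>Near z the competitor heads straight for z. Its length c \<epsilon> is less
        than the distance n, so z is not passed and the slope at an intermediate point is at least
        \<mu> times the remaining distance, which is at least (1 - c) n.\<close>
      define w where "w = (1 / n) *\<^sub>R (z - x)"
      have n: "\<epsilon> \<le> n" "0 < n" "n < \<delta>" using xz \<epsilon> True by (auto simp: n_def dist_norm norm_minus_commute)
      have w: "norm w = 1" "z - x = n *\<^sub>R w" using n by (auto simp: w_def n_def norm_minus_commute)
      obtain s where s: "0 < s" "s < c * \<epsilon>"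
        and eq: "g (x + (c * \<epsilon>) *\<^sub>R w) - g x = (c * \<epsilon>) * (grad g (x + s *\<^sub>R w) \<bullet> w)"
        using gradient_mvt[of g "c * \<epsilon>" x w] grad c\<epsilon> by blast
      have sn: "s < n" using s c\<epsilon> n by linarith
      have "x + s *\<^sub>R w - z = - ((n - s) *\<^sub>R w)"
      proof -
        have "x + s *\<^sub>R w - z = s *\<^sub>R w - (z - x)" by simp
        thus ?thesis unfolding w(2) by (simp add: scaleR_diff_left)
      qed
      hence "norm (x + s *\<^sub>R w - z) = n - s" "grad g (x + s *\<^sub>R w) \<bullet> (x + s *\<^sub>R w - z) = - ((n - s) * (grad g (x + s *\<^sub>R w) \<bullet> w))"
        using w sn by simp_all
      moreover from this have "x + s *\<^sub>R w \<in> ball z \<delta>" using n s by (simp add: dist_norm norm_minus_commute)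
      ultimately have "(n - s) * (\<mu> * (n - s)) \<le> (n - s) * (grad g (x + s *\<^sub>R w) \<bullet> w)"
        using near[of "x + s *\<^sub>R w"] by (simp add: power2_eq_square mult_ac)
      hence "\<mu> * (n - s) \<le> grad g (x + s *\<^sub>R w) \<bullet> w" using sn by simp
      moreover have "c * \<epsilon> \<le> c * n" using n c by simp
      hence "(1 - c) * n \<le> n - s" using s by (simp add: algebra_simps)
      hence "\<mu> * ((1 - c) * n) \<le> \<mu> * (n - s)" using \<mu> by simp
      moreover have "min ((1 - c) * \<mu>) (m / (2 * R)) * n \<le> ((1 - c) * \<mu>) * n" using n by (intro mult_right_mono) auto
      ultimately have "min ((1 - c) * \<mu>) (m / (2 * R)) * n \<le> grad g (x + s *\<^sub>R w) \<bullet> w" by (simp add: mult_ac)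
      moreover have "(g (x + (c * \<epsilon>) *\<^sub>R w) - g x) / (c * \<epsilon>) = grad g (x + s *\<^sub>R w) \<bullet> w"
        unfolding eq using c \<epsilon>(1) by simp
      ultimately show ?thesis using w(1) unfolding n_def by (intro exI[of _ w]) simp
    next
      case False
      have G: "m \<le> norm (grad g x)" using far xC False by blast
      have "norm (sgn (grad g x)) = 1" using G m by (auto simp: norm_sgn)
      moreover have "(c * \<epsilon>) * (m / 2) \<le> g (x + (c * \<epsilon>) *\<^sub>R sgn (grad g x)) - g x"
      proof -
        have "L * (c * \<epsilon>) \<le> L * \<epsilon>" using c\<epsilon> L_pos by simp
        hence "m / 2 \<le> norm (grad g x) - L * (c * \<epsilon>)" using \<epsilon>(2) G by simp
        hence "(c * \<epsilon>) * (m / 2) \<le> (c * \<epsilon>) * (norm (grad g x) - L * (c * \<epsilon>))" using c\<epsilon> by (intro mult_left_mono) auto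
        thus ?thesis using direction_gain[of "c * \<epsilon>" x] c\<epsilon> by (simp add: algebra_simps power2_eq_square)
      qed
      moreover have "min ((1 - c) * \<mu>) (m / (2 * R)) * norm (x - z) \<le> m / (2 * R) * R"
        using bd[OF xC] m R by (intro mult_mono) (auto simp: dist_norm)
      hence "min ((1 - c) * \<mu>) (m / (2 * R)) * norm (x - z) \<le> m / 2" using R by simp
      moreover have "m / 2 \<le> (g (x + (c * \<epsilon>) *\<^sub>R sgn (grad g x)) - g x) / (c * \<epsilon>)"
        using calculation(2) c\<epsilon>(1) by (simp only: pos_le_divide_eq mult.commute)
      ultimately show ?thesis by (intro exI[of _ "sgn (grad g x)"] conjI) linarith+
    qed
    then obtain w where w: "norm w = 1"
      and wg: "min ((1 - c) * \<mu>) (m / (2 * R)) * norm (x - z) \<le> (g (x + (c * \<epsilon>) *\<^sub>R w) - g x) / (c * \<epsilon>)" by blast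
    define y where "y = x + (c * \<epsilon>) *\<^sub>R w"
    have "norm (y - x) = c * \<epsilon>" using w c\<epsilon> by (simp add: y_def)
    moreover from this have "y \<in> cball x \<epsilon> - ball x (c * \<epsilon>)" using c\<epsilon> by (simp add: dist_norm norm_minus_commute)
    hence "(g y - g x) / norm (y - x) \<le> (g (xs (Suc k)) - g x) / norm (xs (Suc k) - x)"
      using am by (auto simp: is_arg_max_iff)
    ultimately have slope: "min ((1 - c) * \<mu>) (m / (2 * R)) * norm (x - z) \<le> (g (xs (Suc k)) - g x) / norm (xs (Suc k) - x)"
      using wg by (simp add: y_def)
    have len: "c * \<epsilon> \<le> norm (xs (Suc k) - x)" using am by (auto simp: is_arg_max_iff dist_norm norm_minus_commute)
    have min0: "0 \<le> min ((1 - c) * \<mu>) (m / (2 * R)) * norm (x - z)" using c \<mu> m R by simp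
    have "\<kappa> * norm (x - z) = (c * \<epsilon>) * (min ((1 - c) * \<mu>) (m / (2 * R)) * norm (x - z))" by (simp add: \<kappa>_def mult.assoc)
    also have "\<dots> \<le> norm (xs (Suc k) - x) * ((g (xs (Suc k)) - g x) / norm (xs (Suc k) - x))"
      using len slope min0 c\<epsilon> by (intro mult_mono) auto
    also have "\<dots> = g (xs (Suc k)) - g x" using len c\<epsilon> by auto
    finally show "g (xs k) + \<kappa> * norm (xs k - z) \<le> g (xs (Suc k))" by (simp add: x_def)
  qed (use \<kappa> in \<open>auto intro!: continuous_intros\<close>)
qed

lemma methods_tendsto:
  assumes C: "compact C" "z \<in> C" and e: "0 < e"
      "\<And>x y. x \<in> C \<Longrightarrow> dist x y \<le> e \<Longrightarrow> grad g y = 0 \<Longrightarrow> y = z" "\<And>x. x \<in> C \<Longrightarrow> g x = g z \<Longrightarrow> x = z"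
    and \<delta>: "0 < \<delta>" and \<mu>: "0 < \<mu>"
    and near: "\<And>x. x \<in> ball z \<delta> \<Longrightarrow> grad g x \<bullet> (x - z) \<le> - (\<mu> * (norm (x - z))\<^sup>2)"
    and z: "is_mode g z" and c: "0 < c" "c < 1"
  shows "\<exists>\<theta>0>0. \<forall>\<theta>. 0 < \<theta> \<and> \<theta> < \<theta>0 \<longrightarrow> (\<forall>run\<in>hill_climbing_methods c. \<forall>xs k0.
           run g \<theta> x0 xs \<and> (\<forall>k\<ge>k0. xs k \<in> C) \<longrightarrow> xs \<longlonglongrightarrow> z)"
proof -
  have crit: "x = z" if "x \<in> C" "grad g x = 0" for x using e(2)[of x x] that e(1) by simp
  obtain R where R: "0 < R" "\<And>x. x \<in> C \<Longrightarrow> dist x z \<le> R"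
    using compact_imp_bounded[OF C(1)] unfolding bounded_any_center[where a = z]
    by (metis dist_commute less_le_trans linorder_le_cases zero_less_one)
  \<comment> \<open>This bound may depend on g in an uncontrolled way: it enters only the threshold
    on \<theta>.\<close>
  obtain m where m: "0 < m" "\<And>x. x \<in> C \<Longrightarrow> x \<notin> ball z \<delta> \<Longrightarrow> m \<le> norm (grad g x)"
  proof (cases "C - ball z \<delta> = {}")
    case True
    hence "x \<in> ball z \<delta>" if "x \<in> C" for x using that by blast
    thus ?thesis using that[of 1] by auto
  next
    case False
    have "compact (C - ball z \<delta>)" using C by (intro compact_diff) auto
    then obtain y where y: "y \<in> C - ball z \<delta>" "\<forall>x\<in>C - ball z \<delta>. norm (grad g y) \<le> norm (grad g x)"
      using continuous_attains_inf[of "C - ball z \<delta>" "\<lambda>x. norm (grad g x)"] False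
        continuous_on_norm[OF continuous_grad] by blast
    moreover have "grad g y \<noteq> 0" using y crit[of y] \<delta> by auto
    ultimately show ?thesis using that[of "norm (grad g y)"] by auto
  qed
  define \<theta>0 where "\<theta>0 = Min {e, m / (2 * L), 1 / (2 * L)}"
  have pos: "0 < \<theta>0" using e m L_pos by (simp add: \<theta>0_def)
  have "xs \<longlonglongrightarrow> z"
    if \<theta>: "0 < \<theta>" "\<theta> < \<theta>0" and run: "run \<in> hill_climbing_methods c" "run g \<theta> x0 xs"
      and xs: "\<And>k. k \<ge> k0 \<Longrightarrow> xs k \<in> C" for \<theta> run xs k0
  proof -
    have "\<theta> < e" "\<theta> < m / (2 * L)" "\<theta> < 1 / (2 * L)" using \<theta>(2) unfolding \<theta>0_def by simp_all
    hence le: "\<theta> \<le> e" "2 * L * \<theta> \<le> m" "2 * L * \<theta> \<le> 1" using L_pos by (simp_all add: field_simps)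
    have "0 < \<theta> * L" using \<theta> L_pos by simp
    hence \<theta>L: "\<theta> * L < 1" using le(3) by (simp add: mult_ac)
    have near_crit: "y = z" if "x \<in> C" "dist x y \<le> \<theta>" "grad g y = 0" for x y
      using e(2)[of x y] that le(1) by simp
    show ?thesis using run(1) unfolding hill_climbing_methods_def
    proof (elim insertE emptyE)
      assume "run = max_shift"
      hence rn: "max_shift g \<theta> x0 xs" using run by simp
      show ?thesis
        by (rule max_shift_tendsto[where C = C, OF C(1) _ _ \<theta>(1) rn]; fact near_crit e(3) xs)
    next
      assume "run = max_slope_shift c"
      hence rn: "max_slope_shift c g \<theta> x0 xs" using run by simp
      show ?thesis
        by (rule max_slope_shift_tendsto[where C = C, OF C(1) _ _ R(1) \<delta> \<mu> _ _ m(1) z c \<theta>(1) le(2) rn];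
            fact near_crit R(2) near m(2) xs)
    next
      assume "run = euler_shift"
      hence rn: "euler_shift g \<theta> x0 xs" using run by simp
      show ?thesis
        by (rule euler_shift_tendsto[where C = C, OF C(1) _ \<theta>(1) le(3) rn]; fact crit xs)
    next
      assume "run = line_search_shift"
      hence rn: "euler_shift g \<theta> x0 xs"
        using run line_search_shift_imp_euler_shift[OF _ \<theta>(1) \<theta>L] by simp
      show ?thesis
        by (rule euler_shift_tendsto[where C = C, OF C(1) _ \<theta>(1) le(3) rn]; fact crit xs)
    qed
  qed
  with pos show ?thesis by blast
qed

end

subsection \<open>Uniqueness of the critical point\<close>

lemma quadratic_decrease_near_critical:
  fixes F :: "'a::euclidean_space \<Rightarrow> 'a"
  assumes H: "(F has_derivative H) (at z)" and z: "F z = 0" and \<mu>: "0 < \<mu>"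
    and neg: "\<And>v. H v \<bullet> v \<le> - (2 * \<mu> * (norm v)\<^sup>2)"
  obtains \<delta> where "0 < \<delta>" "\<And>x. x \<in> ball z \<delta> \<Longrightarrow> F x \<bullet> (x - z) \<le> - (\<mu> * (norm (x - z))\<^sup>2)"
proof -
  obtain d where d: "d > 0" "\<And>y. norm (y - z) < d \<Longrightarrow> norm (F y - F z - H (y - z)) \<le> \<mu> * norm (y - z)"
    using H \<mu> unfolding has_derivative_at_alt by blast
  have "F x \<bullet> (x - z) \<le> - (\<mu> * (norm (x - z))\<^sup>2)" if "x \<in> ball z d" for x
  proof -
    have "norm (F x - H (x - z)) \<le> \<mu> * norm (x - z)"
      using d(2)[of x] that z by (simp add: dist_norm norm_minus_commute)
    hence "norm (F x - H (x - z)) * norm (x - z) \<le> \<mu> * (norm (x - z))\<^sup>2"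
      using mult_right_mono[OF _ norm_ge_zero] by (fastforce simp: power2_eq_square mult.assoc)
    hence "(F x - H (x - z)) \<bullet> (x - z) \<le> \<mu> * (norm (x - z))\<^sup>2"
      using norm_cauchy_schwarz order_trans by blast
    moreover have "F x \<bullet> (x - z) = H (x - z) \<bullet> (x - z) + (F x - H (x - z)) \<bullet> (x - z)"
      by (simp add: inner_diff_left)
    ultimately show ?thesis using neg[of "x - z"] by simp
  qed
  with d(1) that show ?thesis by blast
qed

context lipschitz_gradient
begin

definition "euler_map \<rho> x = x + \<rho> *\<^sub>R grad g x"

lemma continuous_euler_iterate: "continuous_on S (euler_map \<rho> ^^ k)"
proof (induction k)
  case (Suc k)
  have "continuous_on UNIV (euler_map \<rho>)"
    unfolding euler_map_def by (intro continuous_intros continuous_grad)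
  from continuous_on_compose2[OF this Suc] show ?case by (simp add: o_def)
qed auto

text \<open>In the outer half of the ball the inward component absorbs the quadratic term, so the
  distance to p does not grow; from the inner half a step of length at most r/2 cannot
  leave.\<close>

lemma euler_map_invariant_cball:
  assumes r: "0 < r" and \<kappa>: "0 < \<kappa>"
    and inw: "\<And>x. x \<in> cball p r \<Longrightarrow> r / 2 \<le> norm (x - p) \<Longrightarrow> grad g x \<bullet> (x - p) \<le> - \<kappa>"
    and B: "0 < B" "\<And>x. x \<in> cball p r \<Longrightarrow> norm (grad g x) \<le> B"
    and \<rho>: "0 < \<rho>" "\<rho> * B \<le> r / 2" "\<rho> * B\<^sup>2 \<le> 2 * \<kappa>" and x: "x \<in> cball p r"
  shows "euler_map \<rho> x \<in> cball p r"
proof -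
  have eq: "euler_map \<rho> x - p = (x - p) + \<rho> *\<^sub>R grad g x" by (simp add: euler_map_def)
  have step: "\<rho> * norm (grad g x) \<le> \<rho> * B" using B(2)[OF x] \<rho> by (intro mult_left_mono) auto
  have "norm (euler_map \<rho> x - p) \<le> r"
  proof (cases "r / 2 \<le> norm (x - p)")
    case True
    have "\<rho> * (norm (grad g x))\<^sup>2 \<le> \<rho> * B\<^sup>2" using B x \<rho> by (intro mult_left_mono power_mono) auto
    hence "2 * (grad g x \<bullet> (x - p)) + \<rho> * (norm (grad g x))\<^sup>2 \<le> 0" using inw[OF x True] \<rho> by linarith
    hence "\<rho> * (2 * (grad g x \<bullet> (x - p)) + \<rho> * (norm (grad g x))\<^sup>2) \<le> 0" using \<rho> by (simp add: mult_nonneg_nonpos)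
    hence "(norm (euler_map \<rho> x - p))\<^sup>2 \<le> (norm (x - p))\<^sup>2"
      unfolding eq norm_add_scaleR_square by (simp add: power2_eq_square[of \<rho>] distrib_left mult_ac)
    also have "\<dots> \<le> r\<^sup>2" using x by (intro power_mono) (auto simp: dist_norm norm_minus_commute)
    finally show ?thesis by (rule power2_le_imp_le) (use r in simp)
  next
    case False
    have "norm (euler_map \<rho> x - p) \<le> norm (x - p) + norm (\<rho> *\<^sub>R grad g x)"
      unfolding eq by (rule norm_triangle_ineq)
    also have "norm (\<rho> *\<^sub>R grad g x) = \<rho> * norm (grad g x)" using \<rho> by simp
    finally show ?thesis using False step \<rho>(2) by linarith
  qed
  thus ?thesis by (simp add: dist_norm norm_minus_commute)
qed

text \<open>In the expansion of the squared norm, the linear term contributes -2 \<rho> \<mu> and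
  the quadratic one at most \<rho> \<mu>, which leaves the factor 1 - \<rho> \<mu>.\<close>

lemma euler_map_contracts:
  assumes near: "\<And>x. x \<in> ball z \<delta> \<Longrightarrow> grad g x \<bullet> (x - z) \<le> - (\<mu> * (norm (x - z))\<^sup>2)"
    and z: "grad g z = 0" and \<mu>: "0 < \<mu>" and \<rho>: "0 < \<rho>" "\<rho> * L\<^sup>2 \<le> \<mu>" "\<rho> * \<mu> \<le> 1" and x: "x \<in> ball z \<delta>"
  shows "norm (euler_map \<rho> x - z) \<le> sqrt (1 - \<rho> * \<mu>) * norm (x - z)"
proof -
  have eq: "euler_map \<rho> x - z = (x - z) + \<rho> *\<^sub>R grad g x" by (simp add: euler_map_def)
  have "(norm (grad g x))\<^sup>2 \<le> (L * norm (x - z))\<^sup>2" using lip[of x z] z by (intro power_mono) auto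
  hence "\<rho> * (\<rho> * (norm (grad g x))\<^sup>2) \<le> \<rho> * (\<rho> * (L * norm (x - z))\<^sup>2)" using \<rho> by (intro mult_left_mono) auto
  also have "\<dots> = \<rho> * ((\<rho> * L\<^sup>2) * (norm (x - z))\<^sup>2)" by (simp add: power_mult_distrib)
  also have "\<dots> \<le> \<rho> * (\<mu> * (norm (x - z))\<^sup>2)" using \<rho> by (intro mult_left_mono mult_right_mono) auto
  finally have "\<rho>\<^sup>2 * (norm (grad g x))\<^sup>2 \<le> \<rho> * (\<mu> * (norm (x - z))\<^sup>2)" by (simp add: power2_eq_square mult.assoc)
  moreover have "2 * \<rho> * (grad g x \<bullet> (x - z)) \<le> 2 * \<rho> * (- (\<mu> * (norm (x - z))\<^sup>2))"
    using near[OF x] \<rho> by (intro mult_left_mono) auto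
  ultimately have "(norm (euler_map \<rho> x - z))\<^sup>2 \<le> (1 - \<rho> * \<mu>) * (norm (x - z))\<^sup>2"
    unfolding eq norm_add_scaleR_square by (simp add: algebra_simps)
  hence "sqrt ((norm (euler_map \<rho> x - z))\<^sup>2) \<le> sqrt ((1 - \<rho> * \<mu>) * (norm (x - z))\<^sup>2)" by (rule real_sqrt_le_mono)
  thus ?thesis by (simp add: real_sqrt_mult)
qed

lemma euler_map_attracted:
  assumes near: "\<And>x. x \<in> ball z \<delta> \<Longrightarrow> grad g x \<bullet> (x - z) \<le> - (\<mu> * (norm (x - z))\<^sup>2)"
    and z: "grad g z = 0" and \<mu>: "0 < \<mu>" and \<rho>: "0 < \<rho>" "\<rho> * L\<^sup>2 \<le> \<mu>" "\<rho> * \<mu> \<le> 1" and x: "x \<in> ball z \<delta>"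
  shows "(\<lambda>k. (euler_map \<rho> ^^ k) x) \<longlonglongrightarrow> z"
proof -
  define q where "q = sqrt (1 - \<rho> * \<mu>)"
  have q: "0 \<le> q" "q < 1" using \<rho> \<mu> by (auto simp: q_def)
  have bound: "norm ((euler_map \<rho> ^^ k) x - z) \<le> q ^ k * norm (x - z)" for k
  proof (induction k)
    case (Suc k)
    have "q ^ k * norm (x - z) \<le> 1 * norm (x - z)" using q by (intro mult_right_mono power_le_one) auto
    hence "(euler_map \<rho> ^^ k) x \<in> ball z \<delta>" using Suc x by (simp add: dist_norm norm_minus_commute)
    from euler_map_contracts[OF near z \<mu> \<rho> this]
    have "norm ((euler_map \<rho> ^^ Suc k) x - z) \<le> q * norm ((euler_map \<rho> ^^ k) x - z)" by (simp add: q_def)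
    also have "\<dots> \<le> q * (q ^ k * norm (x - z))" using Suc q by (intro mult_left_mono) auto
    finally show ?case by (simp add: mult.assoc)
  qed simp
  have "(\<lambda>k. q ^ k * norm (x - z)) \<longlonglongrightarrow> 0 * norm (x - z)"
    using q by (intro tendsto_mult LIMSEQ_power_zero tendsto_const) auto
  hence "(\<lambda>k. (euler_map \<rho> ^^ k) x - z) \<longlonglongrightarrow> 0"
    using Lim_null_comparison[OF always_eventually[OF allI[OF bound]]] by simp
  thus ?thesis by (simp add: LIM_zero_iff)
qed

text \<open>Compactness gives a cluster point only. It is critical because the gains along the orbit
  are summable; convergence of the whole orbit follows later, once an iterate enters the contraction
  ball of that point.\<close>

lemma euler_orbit_cluster:
  assumes C: "compact C" "\<And>x. x \<in> C \<Longrightarrow> euler_map \<rho> x \<in> C"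
    and \<rho>: "0 < \<rho>" "2 * L * \<rho> \<le> 1" and x: "x \<in> C"
  obtains z \<sigma> where "z \<in> C" "grad g z = 0" "strict_mono \<sigma>" "(\<lambda>k. (euler_map \<rho> ^^ \<sigma> k) x) \<longlonglongrightarrow> z"
proof -
  define y where "y k = (euler_map \<rho> ^^ k) x" for k
  have y: "y k \<in> C" for k by (induction k) (auto simp: y_def x C)
  have gain: "g (y k) + \<rho> / 2 * (norm (grad g (y k)))\<^sup>2 \<le> g (y (Suc k))" for k
    using gradient_step_gain[of \<rho> "y k"] \<rho> by (simp add: y_def euler_map_def)
  have "bounded (g ` C)" using C continuous_g by (intro compact_imp_bounded compact_continuous_image)
  hence "bounded (range (\<lambda>k. g (y k)))" by (rule bounded_subset) (auto intro!: y)
  moreover have "0 \<le> \<rho> / 2 * (norm (grad g (y k)))\<^sup>2" for k using \<rho> by simp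
  hence "incseq (\<lambda>k. g (y k))" using gain by (intro incseq_SucI) (smt (verit))
  ultimately obtain l where l: "(\<lambda>k. g (y k)) \<longlonglongrightarrow> l"
    by (metis Bseq_mono_convergent Bseq_eq_bounded incseqD convergent_def)
  hence "(\<lambda>k. g (y (Suc k)) - g (y k)) \<longlonglongrightarrow> l - l" by (intro tendsto_diff LIMSEQ_Suc)
  hence lim: "(\<lambda>k. g (y (Suc k)) - g (y k)) \<longlonglongrightarrow> 0" by simp
  have g0: "(\<lambda>k. \<rho> / 2 * (norm (grad g (y k)))\<^sup>2) \<longlonglongrightarrow> 0"
  proof (rule tendsto_sandwich[OF _ _ tendsto_const lim])
    show "\<forall>\<^sub>F k in sequentially. 0 \<le> \<rho> / 2 * (norm (grad g (y k)))\<^sup>2" using \<rho> by (simp add: always_eventually)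
    have "\<rho> / 2 * (norm (grad g (y k)))\<^sup>2 \<le> g (y (Suc k)) - g (y k)" for k using gain[of k] by simp
    thus "\<forall>\<^sub>F k in sequentially. \<rho> / 2 * (norm (grad g (y k)))\<^sup>2 \<le> g (y (Suc k)) - g (y k)" by (simp add: always_eventually)
  qed
  obtain z \<sigma> where z: "z \<in> C" "strict_mono \<sigma>" "(y \<circ> \<sigma>) \<longlonglongrightarrow> z"
    using C(1) y unfolding compact_def by meson
  have "isCont (\<lambda>x. \<rho> / 2 * (norm (grad g x))\<^sup>2) z"
    using continuous_gradient_gain[of UNIV "\<rho> / 2"] by (simp add: continuous_on_eq_continuous_at)
  from isCont_tendsto_compose[OF this z(3)]
  have "(\<lambda>k. \<rho> / 2 * (norm (grad g (y (\<sigma> k))))\<^sup>2) \<longlonglongrightarrow> \<rho> / 2 * (norm (grad g z))\<^sup>2" by simp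
  moreover have "(\<lambda>k. \<rho> / 2 * (norm (grad g (y (\<sigma> k))))\<^sup>2) \<longlonglongrightarrow> 0"
    using LIMSEQ_subseq_LIMSEQ[OF g0 z(2)] by (simp add: o_def)
  ultimately have "\<rho> / 2 * (norm (grad g z))\<^sup>2 = 0" by (rule LIMSEQ_unique)
  hence "grad g z = 0" using \<rho> by simp
  with z show ?thesis using that[of z \<sigma>] by (simp add: y_def o_def)
qed

text \<open>The basins of the explicit Euler map around the critical points are open, and they partition the
  ball, which is connected: there is only one.\<close>

lemma unique_critical_point:
  assumes r: "0 < r" and \<kappa>: "0 < \<kappa>"
    and inw: "\<And>x. x \<in> cball p r \<Longrightarrow> r / 2 \<le> norm (x - p) \<Longrightarrow> grad g x \<bullet> (x - p) \<le> - \<kappa>"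
    and \<mu>: "0 < \<mu>"
    and nondeg: "\<And>z. z \<in> cball p r \<Longrightarrow> grad g z = 0 \<Longrightarrow>
      \<exists>H. (grad g has_derivative H) (at z) \<and> (\<forall>v. H v \<bullet> v \<le> - (2 * \<mu> * (norm v)\<^sup>2))"
  obtains z \<delta> where "z \<in> ball p r" "grad g z = 0" "\<And>x. x \<in> cball p r \<Longrightarrow> grad g x = 0 \<Longrightarrow> x = z"
    "\<And>x. x \<in> cball p r \<Longrightarrow> g x \<le> g z" "\<And>x. x \<in> cball p r \<Longrightarrow> g x = g z \<Longrightarrow> x = z"
    "0 < \<delta>" "\<And>x. x \<in> ball z \<delta> \<Longrightarrow> grad g x \<bullet> (x - z) \<le> - (\<mu> * (norm (x - z))\<^sup>2)"
proof -
  define C where "C = cball p r"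
  have C: "compact C" "connected C" "C \<noteq> {}" using r by (auto simp: C_def)
  obtain B where B: "0 < B" "\<And>x. x \<in> C \<Longrightarrow> norm (grad g x) \<le> B"
    using compact_imp_bounded[OF compact_continuous_image[OF continuous_grad C(1)]]
    unfolding bounded_pos by auto
  \<comment> \<open>The first two bounds make the ball invariant, the next two give contraction near
    critical points, the last one ascent. This map serves only the topology and is unrelated to the
    \<theta> of the methods.\<close>
  define \<rho> where "\<rho> = Min {r / (2 * B), 2 * \<kappa> / B\<^sup>2, \<mu> / L\<^sup>2, 1 / \<mu>, 1 / (2 * L)}"
  have \<rho>0: "0 < \<rho>" using r \<kappa> \<mu> B L_pos by (simp add: \<rho>_def)
  have "\<rho> \<le> r / (2 * B)" "\<rho> \<le> 2 * \<kappa> / B\<^sup>2" "\<rho> \<le> \<mu> / L\<^sup>2" "\<rho> \<le> 1 / \<mu>" "\<rho> \<le> 1 / (2 * L)"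
    unfolding \<rho>_def by simp_all
  hence \<rho>: "\<rho> * B \<le> r / 2" "\<rho> * B\<^sup>2 \<le> 2 * \<kappa>" "\<rho> * L\<^sup>2 \<le> \<mu>" "\<rho> * \<mu> \<le> 1" "2 * L * \<rho> \<le> 1"
    using B(1) \<mu> L_pos by (simp_all add: field_simps)
  define T where "T = euler_map \<rho>"
  have inv: "T x \<in> C" if "x \<in> C" for x
    using euler_map_invariant_cball[OF r \<kappa> inw B(1) _ \<rho>0 \<rho>(1,2), of x] B(2) that
    unfolding T_def C_def by blast
  have invk: "(T ^^ k) x \<in> C" if "x \<in> C" for x k by (induction k) (auto simp: that inv)
  have near: "\<exists>\<delta>>0. \<forall>x\<in>ball z \<delta>. grad g x \<bullet> (x - z) \<le> - (\<mu> * (norm (x - z))\<^sup>2)"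
    if z: "z \<in> C" "grad g z = 0" for z
  proof -
    obtain H where H: "(grad g has_derivative H) (at z)" "\<And>v. H v \<bullet> v \<le> - (2 * \<mu> * (norm v)\<^sup>2)"
      using nondeg[of z] z by (auto simp: C_def)
    from quadratic_decrease_near_critical[OF H(1) z(2) \<mu> H(2)] show ?thesis by metis
  qed
  define A where "A z = {x \<in> C. (\<lambda>k. (T ^^ k) x) \<longlonglongrightarrow> z}" for z
  have shift: "(\<lambda>k. (T ^^ k) x) \<longlonglongrightarrow> z" if "(\<lambda>k. (T ^^ k) ((T ^^ N) x)) \<longlonglongrightarrow> z" for x z N
  proof -
    have "(\<lambda>k. (T ^^ (k + N)) x) \<longlonglongrightarrow> z" using that by (simp add: funpow_add)
    thus ?thesis by (rule LIMSEQ_offset)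
  qed
  have attract: "(\<lambda>k. (T ^^ k) x) \<longlonglongrightarrow> z"
    if "z \<in> C" "grad g z = 0" "0 < \<delta>" "\<forall>x\<in>ball z \<delta>. grad g x \<bullet> (x - z) \<le> - (\<mu> * (norm (x - z))\<^sup>2)"
      "x \<in> ball z \<delta>" for x z \<delta>
    unfolding T_def using euler_map_attracted[of z \<delta> \<mu> \<rho> x] that \<mu> \<rho>0 \<rho> by blast
  have cover: "\<exists>z\<in>C. grad g z = 0 \<and> x \<in> A z" if x: "x \<in> C" for x
  proof -
    obtain z \<sigma> where z: "z \<in> C" "grad g z = 0" "strict_mono \<sigma>" "(\<lambda>k. (T ^^ \<sigma> k) x) \<longlonglongrightarrow> z"
      using euler_orbit_cluster[OF C(1) _ \<rho>0 \<rho>(5) x] inv unfolding T_def by blast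
    obtain \<delta> where \<delta>: "0 < \<delta>" "\<forall>x\<in>ball z \<delta>. grad g x \<bullet> (x - z) \<le> - (\<mu> * (norm (x - z))\<^sup>2)"
      using near z by blast
    obtain k where "dist ((T ^^ \<sigma> k) x) z < \<delta>"
      using tendstoD[OF z(4) \<delta>(1)] by (auto simp: eventually_sequentially)
    hence "(\<lambda>k'. (T ^^ k') ((T ^^ \<sigma> k) x)) \<longlonglongrightarrow> z" using attract z \<delta> by (simp add: dist_commute)
    thus ?thesis using shift z x unfolding A_def by blast
  qed
  have opn: "openin (top_of_set C) (A z)" if z: "z \<in> C" "grad g z = 0" for z
  proof (subst openin_subopen, intro ballI)
    fix x assume x: "x \<in> A z"
    obtain \<delta> where \<delta>: "0 < \<delta>" "\<forall>x\<in>ball z \<delta>. grad g x \<bullet> (x - z) \<le> - (\<mu> * (norm (x - z))\<^sup>2)"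
      using near z by blast
    obtain N where N: "dist ((T ^^ N) x) z < \<delta>"
      using x tendstoD[OF _ \<delta>(1)] by (force simp: A_def eventually_sequentially)
    \<comment> \<open>Reaching the attracting ball at the fixed time \<open>N\<close> is an open
      condition, since iterates are continuous.\<close>
    define U where "U = C \<inter> (T ^^ N) -` ball z \<delta>"
    have "openin (top_of_set C) U" unfolding U_def T_def
      by (intro continuous_openin_preimage_gen continuous_euler_iterate) auto
    moreover have "x \<in> U" using x N by (auto simp: U_def A_def dist_commute)
    moreover have "U \<subseteq> A z"
    proof
      fix y assume "y \<in> U"
      hence "y \<in> C" "(T ^^ N) y \<in> ball z \<delta>" by (auto simp: U_def)
      thus "y \<in> A z" using attract[OF z \<delta>] shift unfolding A_def by blast
    qed
    ultimately show "\<exists>U. openin (top_of_set C) U \<and> x \<in> U \<and> U \<subseteq> A z" by blast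
  qed
  have fixed: "z \<in> A z" if "z \<in> C" "grad g z = 0" for z
  proof -
    have "(T ^^ k) z = z" for k using that by (induction k) (auto simp: T_def euler_map_def)
    thus ?thesis using that by (simp add: A_def)
  qed
  have uniq: "z' = z" if z: "z \<in> C" "grad g z = 0" and z': "z' \<in> C" "grad g z' = 0" for z z'
  proof (rule ccontr)
    assume ne: "z' \<noteq> z"
    define A' where "A' = (\<Union>y\<in>{y\<in>C. grad g y = 0 \<and> y \<noteq> z}. A y)"
    have "openin (top_of_set C) A'" unfolding A'_def using opn by auto
    moreover have "A z \<inter> A' = {}" unfolding A'_def A_def using LIMSEQ_unique by blast
    moreover have "C \<subseteq> A z \<union> A'" using cover unfolding A'_def by blast
    moreover have "A z \<noteq> {}" "A' \<noteq> {}" using fixed z z' ne unfolding A'_def by blast+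
    ultimately show False using C(2) opn[OF z] unfolding connected_openin by blast
  qed
  obtain z where zC: "z \<in> C" and zmax: "\<And>x. x \<in> C \<Longrightarrow> g x \<le> g z"
    using continuous_attains_sup[OF C(1,3) continuous_g] by blast
  \<comment> \<open>An Euler step stays in C, so at a maximiser over C, even one on the boundary, it
    can gain nothing. Applied to z and then to any point of equal value, this also makes the
    maximiser unique.\<close>
  have crit: "grad g x = 0" if x: "x \<in> C" "g z \<le> g x" for x
  proof -
    have "g x + \<rho> / 2 * (norm (grad g x))\<^sup>2 \<le> g (T x)"
      using gradient_step_gain[of \<rho> x] \<rho>0 \<rho>(5) by (simp add: T_def euler_map_def)
    hence "\<rho> / 2 * (norm (grad g x))\<^sup>2 \<le> 0" using zmax[OF inv[OF x(1)]] x(2) by linarith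
    thus ?thesis using \<rho>0 by (simp add: mult_le_0_iff)
  qed
  have z0: "grad g z = 0" using crit zC by simp
  have "norm (z - p) < r / 2" using inw[of z] zC z0 \<kappa> unfolding C_def by (force simp: not_less)
  hence zb: "z \<in> ball p r" using r by (simp add: dist_norm norm_minus_commute)
  obtain \<delta> where \<delta>: "0 < \<delta>" "\<forall>x\<in>ball z \<delta>. grad g x \<bullet> (x - z) \<le> - (\<mu> * (norm (x - z))\<^sup>2)"
    using near zC z0 by blast
  show ?thesis
  proof (rule that[OF zb z0 _ _ _ \<delta>(1)])
    show "x = z" if "x \<in> cball p r" "grad g x = 0" for x
      using uniq[OF zC z0] that unfolding C_def by blast
    show "g x \<le> g z" if "x \<in> cball p r" for x using zmax that by (simp add: C_def)
    show "x = z" if "x \<in> cball p r" "g x = g z" for x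
    proof -
      have "grad g x = 0" using crit[of x] that unfolding C_def by (metis order_refl)
      thus ?thesis using uniq[OF zC z0] that(1) unfolding C_def by blast
    qed
  qed (use \<delta>(2) in blast)
qed

end

subsection \<open>Regular densities near a mode\<close>

lemma regular_densityD:
  assumes "regular_density f"
  shows "\<And>x. GDERIV f x :> grad f x" "\<And>x. (grad f has_derivative blinfun_apply (hess f x)) (at x)"
    "\<And>x. 0 \<le> f x" "\<And>x. f differentiable (at x)"
  using assms by (auto simp: regular_density_def twice_differentiable_def probability_density_def
      intro: GDERIV_grad blinfun_apply_hess)

lemma bounded_hess_imp_lipschitz_grad:
  assumes "\<And>x. (grad g has_derivative blinfun_apply (hess g x)) (at x)" "bounded (range (hess g))"
  obtains L where "0 < L" "\<And>x. norm (hess g x) \<le> L" "\<And>x y. norm (grad g x - grad g y) \<le> L * norm (x - y)"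
proof -
  obtain L where L: "0 < L" "\<And>x. norm (hess g x) \<le> L" using assms(2) by (auto simp: bounded_pos)
  have "norm (grad g x - grad g y) \<le> L * norm (x - y)" for x y
    by (rule differentiable_bound[where S = UNIV and f' = "\<lambda>x. blinfun_apply (hess g x)"])
      (use assms(1) L(2) in \<open>auto simp: norm_blinfun.rep_eq[symmetric]\<close>)
  with L that show ?thesis by blast
qed

text \<open>Otherwise the slope of f along v, which is 0 at p, is positive just beyond p, and the
  mean value theorem produces higher points arbitrarily close to p.\<close>

lemma max_imp_second_derivative_nonpos:
  assumes D: "\<And>x. GDERIV f x :> grad f x" and H: "(grad f has_derivative H) (at p)" and p: "is_mode f p"
  shows "H v \<bullet> v \<le> 0"
proof (rule ccontr)
  assume "\<not> H v \<bullet> v \<le> 0"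
  hence pos: "0 < H v \<bullet> v" by simp
  have g0: "grad f p = 0"
    using is_mode_imp_grad_0[OF p] D[of p] by (auto simp: gderiv_def differentiable_def)
  obtain e where e: "e > 0" "\<And>y. y \<in> ball p e \<Longrightarrow> f y \<le> f p" using p by (auto simp: is_mode_def)
  have "((\<lambda>s. p + s *\<^sub>R v) has_derivative (\<lambda>h. h *\<^sub>R v)) (at 0)"
    by (auto intro!: derivative_eq_intros)
  hence "((\<lambda>s. grad f (p + s *\<^sub>R v)) has_derivative (\<lambda>h. H (h *\<^sub>R v))) (at 0)"
    by (rule has_derivative_compose) (use H in simp)
  hence "((\<lambda>s. grad f (p + s *\<^sub>R v) \<bullet> v) has_derivative (\<lambda>h. H (h *\<^sub>R v) \<bullet> v)) (at 0)"
    by (rule has_derivative_inner_left)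
  hence "((\<lambda>s. grad f (p + s *\<^sub>R v) \<bullet> v) has_real_derivative H v \<bullet> v) (at 0)"
    using linear_scale[OF has_derivative_linear[OF H]]
    by (simp add: has_field_derivative_def mult_commute_abs)
  from DERIV_pos_inc_right[OF this pos] obtain d where d: "d > 0"
    "\<And>h. h > 0 \<Longrightarrow> h < d \<Longrightarrow> 0 < grad f (p + h *\<^sub>R v) \<bullet> v" using g0 by auto
  define a where "a = min (d / 2) (e / (2 * (norm v + 1)))"
  have vpos: "0 < norm v + 1" by (simp add: add_nonneg_pos)
  have a: "0 < a" "a < d" using d e vpos by (auto simp: a_def min_less_iff_disj)
  have "a \<le> e / (2 * (norm v + 1))" by (simp add: a_def)
  hence "a * (norm v + 1) \<le> e / 2" using vpos by (simp add: field_simps)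
  have "a * norm v \<le> a * (norm v + 1)" using a by simp
  also have "a * (norm v + 1) < e" using \<open>a * (norm v + 1) \<le> e / 2\<close> e by linarith
  finally have "p + a *\<^sub>R v \<in> ball p e" using a by (simp add: dist_norm)
  moreover obtain s where "0 < s" "s < a" "f (p + a *\<^sub>R v) - f p = a * (grad f (p + s *\<^sub>R v) \<bullet> v)"
    using gradient_mvt[of f a p v] D a by blast
  hence "f p < f (p + a *\<^sub>R v)" using d(2)[of s] a by (smt (verit) mult_pos_pos)
  ultimately show False using e(2)[of "p + a *\<^sub>R v"] by simp
qed

text \<open>If H v were not 0, the form at v + t H v would be 2 t |H v|^2 up to O(t^2), hence
  positive for small t. This upgrades a bijective, negative semidefinite Hessian to a negative
  definite one.\<close>

lemma nonpos_symmetric_zero: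
  fixes H :: "'a::real_inner \<Rightarrow> 'a"
  assumes H: "linear H" and sym: "\<And>v w. H v \<bullet> w = H w \<bullet> v" and np: "\<And>v. H v \<bullet> v \<le> 0"
    and v: "H v \<bullet> v = 0"
  shows "H v = 0"
proof (rule ccontr)
  assume ne: "H v \<noteq> 0"
  define w where "w = H v"
  define t where "t = (w \<bullet> w) / (\<bar>H w \<bullet> w\<bar> + 1)"
  have ww: "0 < w \<bullet> w" using ne by (simp add: w_def)
  have t: "0 < t" using ww by (simp add: t_def add_nonneg_pos)
  have "H (v + t *\<^sub>R w) \<bullet> (v + t *\<^sub>R w) = H v \<bullet> v + t * (H v \<bullet> w) + t * (H w \<bullet> v) + t * (t * (H w \<bullet> w))"
    using H by (simp add: linear_add linear_scale inner_add_left inner_add_right algebra_simps)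
  also have "\<dots> = t * (2 * (w \<bullet> w) + t * (H w \<bullet> w))"
    using v sym[of w v] by (simp add: w_def algebra_simps)
  finally have "2 * (w \<bullet> w) + t * (H w \<bullet> w) \<le> 0"
    using np[of "v + t *\<^sub>R w"] t by (simp add: mult_le_0_iff)
  moreover have "t * \<bar>H w \<bullet> w\<bar> \<le> w \<bullet> w"
    using ww unfolding t_def by (simp add: field_simps add_nonneg_pos)
  moreover have "t * (- \<bar>H w \<bullet> w\<bar>) \<le> t * (H w \<bullet> w)" using t by (intro mult_left_mono) auto
  ultimately show False using ww by (simp add: mult_minus_right)
qed

lemma regular_density_mode:
  fixes f :: "'a::euclidean_space \<Rightarrow> real"
  assumes f: "regular_density f" and p: "is_mode f p"
  obtains r \<mu> m where "0 < r" "0 < \<mu>" "0 < m" "\<And>x. x \<in> cball p r \<Longrightarrow> m \<le> f x"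
    "\<And>x v. x \<in> cball p r \<Longrightarrow> hess f x v \<bullet> v \<le> - (\<mu> * (norm v)\<^sup>2)"
proof -
  note f' = regular_densityD[OF f]
  define H where "H = blinfun_apply (hess f p)"
  have H: "(grad f has_derivative H) (at p)" using f'(2) by (simp add: H_def)
  have linH: "linear H" using H by (rule has_derivative_linear)
  have g0: "grad f p = 0" using is_mode_imp_grad_0 p f'(4) by blast
  have np: "H v \<bullet> v \<le> 0" for v by (rule max_imp_second_derivative_nonpos[OF f'(1) H p])
  have "bij H" using f g0 by (simp add: regular_density_def H_def)
  hence H0: "v = 0" if "H v = 0" for v
    using that linear_0[OF linH] by (metis bij_def injD)
  have neg: "H v \<bullet> v < 0" if "v \<noteq> 0" for v
    using nonpos_symmetric_zero[OF linH second_derivative_symmetric[OF f'(1) H] np, of v] H0[of v] np[of v] that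
    by linarith
  obtain b :: 'a where b: "b \<in> Basis" using nonempty_Basis by blast
  hence "b \<in> sphere 0 1" by simp
  hence "sphere 0 1 \<noteq> ({} :: 'a set)" by blast
  moreover have "continuous_on (sphere 0 1) (\<lambda>v. H v \<bullet> v)"
    unfolding H_def by (intro continuous_intros)
  ultimately obtain u where u: "u \<in> sphere 0 1" "\<And>v. v \<in> sphere 0 1 \<Longrightarrow> H v \<bullet> v \<le> H u \<bullet> u"
    using continuous_attains_sup[of "sphere 0 1" "\<lambda>v. H v \<bullet> v"] by auto
  \<comment> \<open>Half of the extremal value on the unit sphere; the other half is given up when
    passing from p to a neighbourhood.\<close>
  define \<mu> where "\<mu> = - (H u \<bullet> u) / 2"
  have "u \<noteq> 0" using u(1) by auto
  hence \<mu>: "0 < \<mu>" using neg[of u] by (simp add: \<mu>_def)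
  have neg\<mu>: "H v \<bullet> v \<le> - (2 * \<mu> * (norm v)\<^sup>2)" for v
  proof (cases "v = 0")
    case False
    have "H v = norm v *\<^sub>R H (sgn v)" using linear_scale[OF linH, of "norm v" "sgn v"] False by (simp add: sgn_div_norm)
    moreover have "v = norm v *\<^sub>R sgn v" using False by (simp add: sgn_div_norm)
    ultimately have "H v \<bullet> v = (norm v)\<^sup>2 * (H (sgn v) \<bullet> sgn v)"
      by (metis inner_scaleR_left inner_scaleR_right mult.assoc power2_eq_square)
    also have "\<dots> \<le> (norm v)\<^sup>2 * (- (2 * \<mu>))"
      using u(2)[of "sgn v"] False by (intro mult_left_mono) (auto simp: norm_sgn \<mu>_def)
    finally show ?thesis by (simp add: mult.commute)
  qed (use linear_0[OF linH] in simp)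
  \<comment> \<open>If f p = 0, then f vanishes near p, every nearby point is a mode too,
    \<open>grad f\<close> vanishes there and so does the Hessian at p, contrary to
    injectivity.\<close>
  have fp: "0 < f p"
  proof (rule ccontr)
    assume "\<not> 0 < f p"
    hence "f p = 0" using f'(3)[of p] by simp
    then obtain e where e: "e > 0" "\<And>y. y \<in> ball p e \<Longrightarrow> f y \<le> 0" using p by (auto simp: is_mode_def)
    have flat: "0 = grad f y" if y: "y \<in> ball p e" for y
    proof -
      obtain e' where "e' > 0" "ball y e' \<subseteq> ball p e" using y open_ball openE by blast
      hence "is_mode f y" using e f'(3) unfolding is_mode_def
        by (intro exI[of _ e']) (meson order_trans subsetD)
      thus ?thesis using is_mode_imp_grad_0 f'(4) by metis
    qed
    have "p \<in> ball p e" using e by simp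
    have "(grad f has_derivative (\<lambda>h. 0)) (at p)"
      by (rule has_derivative_transform_within_open[OF has_derivative_const open_ball \<open>p \<in> ball p e\<close> flat])
    from has_derivative_unique[OF this H] have "H u = 0" by metis
    thus False using H0[of u] u(1) by auto
  qed
  have "isCont f p" using f'(4) by (simp add: differentiable_imp_continuous_within)
  hence "\<forall>\<^sub>F x in nhds p. f p / 2 < f x"
    using fp by (intro order_tendstoD(1)[of f "f p"]) (auto simp: continuous_at tendsto_at_iff_tendsto_nhds)
  then obtain e1 where e1: "e1 > 0" "\<And>x. dist x p < e1 \<Longrightarrow> f p / 2 < f x"
    by (auto simp: eventually_nhds_metric)
  obtain e2 where e2: "e2 > 0" "\<And>x. dist x p < e2 \<Longrightarrow> dist (hess f x) (hess f p) < \<mu>"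
    using f \<mu> unfolding regular_density_def uniformly_continuous_on_def by (metis UNIV_I dist_commute)
  define r where "r = min e1 e2 / 2"
  show ?thesis
  proof (rule that[of r \<mu> "f p / 2"])
    show "0 < r" using e1 e2 by (simp add: r_def)
    fix x assume x: "x \<in> cball p r"
    hence x': "dist x p < e1" "dist x p < e2" using e1 e2 by (auto simp: r_def dist_commute)
    show "f p / 2 \<le> f x" using e1(2)[OF x'(1)] by simp
    fix v
    have "(hess f x - hess f p) v \<bullet> v \<le> norm ((hess f x - hess f p) v) * norm v" by (rule norm_cauchy_schwarz)
    also have "\<dots> \<le> (norm (hess f x - hess f p) * norm v) * norm v" by (intro mult_right_mono norm_blinfun) simp
    also have "\<dots> \<le> (\<mu> * norm v) * norm v"
      using e2(2)[OF x'(2)] by (intro mult_right_mono) (auto simp: dist_norm)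
    finally show "hess f x v \<bullet> v \<le> - (\<mu> * (norm v)\<^sup>2)"
      using neg\<mu>[of v] by (simp add: blinfun.diff_left inner_diff_left H_def power2_eq_square mult.assoc)
  qed (use \<mu> fp in auto)
qed

lemma strongly_concave_gradient:
  assumes H: "\<And>x. (grad f has_derivative blinfun_apply (hess f x)) (at x)" and C: "convex C"
    and neg: "\<And>x v. x \<in> C \<Longrightarrow> hess f x v \<bullet> v \<le> - (\<mu> * (norm v)\<^sup>2)" and x: "x \<in> C" "p \<in> C"
  shows "(grad f x - grad f p) \<bullet> (x - p) \<le> - (\<mu> * (norm (x - p))\<^sup>2)"
proof -
  define v where "v = x - p"
  have der: "((\<lambda>s. grad f (p + s *\<^sub>R v) \<bullet> v) has_real_derivative hess f (p + s *\<^sub>R v) v \<bullet> v) (at s)" for s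
  proof -
    have "((\<lambda>s. p + s *\<^sub>R v) has_derivative (\<lambda>h. h *\<^sub>R v)) (at s)"
      by (auto intro!: derivative_eq_intros)
    hence "((\<lambda>s. grad f (p + s *\<^sub>R v)) has_derivative (\<lambda>h. hess f (p + s *\<^sub>R v) (h *\<^sub>R v))) (at s)"
      by (rule has_derivative_compose) (rule H)
    hence "((\<lambda>s. grad f (p + s *\<^sub>R v) \<bullet> v) has_derivative (\<lambda>h. hess f (p + s *\<^sub>R v) (h *\<^sub>R v) \<bullet> v)) (at s)"
      by (rule has_derivative_inner_left)
    thus ?thesis by (simp add: has_field_derivative_def blinfun.scaleR_right mult_commute_abs)
  qed
  have "\<exists>s>0. s < 1 \<and> grad f (p + 1 *\<^sub>R v) \<bullet> v - grad f (p + 0 *\<^sub>R v) \<bullet> v = (1 - 0) * (hess f (p + s *\<^sub>R v) v \<bullet> v)"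
    by (intro MVT2 der) simp
  then obtain s where s: "0 < s" "s < 1" and eq: "(grad f x - grad f p) \<bullet> v = hess f (p + s *\<^sub>R v) v \<bullet> v"
    by (auto simp: v_def inner_diff_left)
  have "p + s *\<^sub>R v = (1 - s) *\<^sub>R p + s *\<^sub>R x" by (simp add: v_def algebra_simps)
  hence "p + s *\<^sub>R v \<in> C" using convexD[OF C x(2,1), of "1 - s" s] s by simp
  from neg[OF this, of v] show ?thesis unfolding v_def[symmetric] eq .
qed

subsection \<open>Climbing a surface whose gradient is close to that of the density\<close>

text \<open>Uniqueness of the flow at a zero of the field: with the weight exp(-2 L s), the squared
  distance to the zero is nonincreasing, and it starts at 0.\<close>

lemma flow_stationary:
  fixes F :: "'a::euclidean_space \<Rightarrow> 'a"
  assumes \<gamma>: "\<And>t. 0 \<le> t \<Longrightarrow> (\<gamma> has_vector_derivative F (\<gamma> t)) (at t within {0..})"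
    and lip: "\<And>x y. norm (F x - F y) \<le> L * norm (x - y)"
    and t: "0 \<le> t" "F (\<gamma> t) = 0" "t \<le> s"
  shows "\<gamma> s = \<gamma> t"
proof (cases "t = s")
  case False
  define u where "u s = exp (- (2 * L * s)) * ((\<gamma> s - \<gamma> t) \<bullet> (\<gamma> s - \<gamma> t))" for s
  have "u s \<le> u t"
  proof (rule DERIV_nonpos_imp_decreasing_open[where f = u and a = t and b = s])
    show "t \<le> s" by fact
    have "continuous_on {0..} \<gamma>" using \<gamma> by (auto intro!: continuous_on_vector_derivative)
    hence "continuous_on {t..s} \<gamma>" by (rule continuous_on_subset) (use t in auto)
    thus "continuous_on {t..s} u" unfolding u_def by (intro continuous_intros)
    fix x assume x: "t < x" "x < s"
    have "at x within {0..} = at x" using x t by (intro at_within_interior) auto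
    hence d: "(\<gamma> has_derivative (\<lambda>h. h *\<^sub>R F (\<gamma> x))) (at x)"
      using \<gamma>[of x] x t by (simp add: has_vector_derivative_def)
    have "((\<lambda>s. \<gamma> s - \<gamma> t) has_derivative (\<lambda>h. h *\<^sub>R F (\<gamma> x))) (at x)"
      using has_derivative_diff[OF d has_derivative_const[of "\<gamma> t"]] by simp
    from has_derivative_inner[OF this this]
    have d2: "((\<lambda>s. (\<gamma> s - \<gamma> t) \<bullet> (\<gamma> s - \<gamma> t)) has_real_derivative 2 * (F (\<gamma> x) \<bullet> (\<gamma> x - \<gamma> t))) (at x)"
      unfolding has_field_derivative_def
      by (rule has_derivative_eq_rhs) (auto simp: inner_commute fun_eq_iff)
    have d1: "((\<lambda>s. exp (- (2 * L * s))) has_real_derivative exp (- (2 * L * x)) * (- (2 * L))) (at x)"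
      by (auto intro!: derivative_eq_intros)
    have "(u has_real_derivative exp (- (2 * L * x)) * (- (2 * L)) * ((\<gamma> x - \<gamma> t) \<bullet> (\<gamma> x - \<gamma> t))
        + 2 * (F (\<gamma> x) \<bullet> (\<gamma> x - \<gamma> t)) * exp (- (2 * L * x))) (at x)"
      unfolding u_def by (rule DERIV_mult[OF d1 d2])
    moreover have "F (\<gamma> x) \<bullet> (\<gamma> x - \<gamma> t) \<le> L * ((\<gamma> x - \<gamma> t) \<bullet> (\<gamma> x - \<gamma> t))"
    proof -
      have "F (\<gamma> x) \<bullet> (\<gamma> x - \<gamma> t) \<le> norm (F (\<gamma> x)) * norm (\<gamma> x - \<gamma> t)" by (rule norm_cauchy_schwarz)
      also have "\<dots> \<le> (L * norm (\<gamma> x - \<gamma> t)) * norm (\<gamma> x - \<gamma> t)"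
        using lip[of "\<gamma> x" "\<gamma> t"] t by (intro mult_right_mono) auto
      finally show ?thesis by (simp add: power2_norm_eq_inner[symmetric] power2_eq_square mult.assoc)
    qed
    hence "exp (- (2 * L * x)) * (F (\<gamma> x) \<bullet> (\<gamma> x - \<gamma> t)) \<le> exp (- (2 * L * x)) * (L * ((\<gamma> x - \<gamma> t) \<bullet> (\<gamma> x - \<gamma> t)))"
      by (rule mult_left_mono) simp
    ultimately show "\<exists>y. DERIV u x :> y \<and> y \<le> 0" by (intro exI conjI) (assumption, simp add: algebra_simps)
  qed
  hence "exp (- (2 * L * s)) * ((\<gamma> s - \<gamma> t) \<bullet> (\<gamma> s - \<gamma> t)) \<le> 0" by (simp add: u_def)
  hence "(\<gamma> s - \<gamma> t) \<bullet> (\<gamma> s - \<gamma> t) \<le> 0" by (simp add: mult_le_0_iff not_less)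
  thus ?thesis using inner_ge_zero[of "\<gamma> s - \<gamma> t"] by (simp add: antisym)
qed simp

text \<open>T is the first entrance into the closed ball. A zero of the field met on the way would
  be the limit p itself, hence a point of the ball no earlier than T; but at a positive first
  entrance time the distance to p is still s. The case T = 0 is exceptional because the flow may
  start at p.\<close>

lemma flow_reaches_ball:
  fixes F :: "'a::euclidean_space \<Rightarrow> 'a"
  assumes \<gamma>: "\<And>t. 0 \<le> t \<Longrightarrow> (\<gamma> has_vector_derivative F (\<gamma> t)) (at t within {0..})"
    and lip: "\<And>x y. norm (F x - F y) \<le> L * norm (x - y)"
    and lim: "(\<gamma> \<longlongrightarrow> p) at_top" and s: "0 < s" and F: "\<And>x. dist x p = s \<Longrightarrow> F x \<noteq> 0"
  obtains T where "0 \<le> T" "dist (\<gamma> T) p \<le> s" "T = 0 \<or> (\<forall>t\<in>{0..T}. F (\<gamma> t) \<noteq> 0)"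
proof -
  have cont: "continuous_on {0..} \<gamma>" using \<gamma> by (auto intro!: continuous_on_vector_derivative)
  define S where "S = {0..} \<inter> \<gamma> -` cball p s"
  have "closed S" unfolding S_def using cont by (intro continuous_closed_preimage) auto
  moreover have "\<forall>\<^sub>F t in at_top. dist (\<gamma> t) p < s \<and> 0 \<le> t"
    using tendstoD[OF lim s] eventually_ge_at_top[of 0] by (rule eventually_conj)
  then obtain t0 where "dist (\<gamma> t0) p < s" "0 \<le> t0" by (auto simp: eventually_at_top_linorder)
  hence "t0 \<in> S" by (simp add: S_def dist_commute)
  moreover have bdd: "bdd_below S" by (auto simp: S_def)
  ultimately have T: "Inf S \<in> S" by (intro closed_contains_Inf) auto
  have nz: "F (\<gamma> t) \<noteq> 0" if t: "0 \<le> t" "t \<le> Inf S" and pos: "0 < Inf S" for t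
  proof
    assume F0: "F (\<gamma> t) = 0"
    have stay: "\<gamma> u = \<gamma> t" if "t \<le> u" for u using flow_stationary[OF \<gamma> lip t(1) F0 that] .
    have "(\<gamma> \<longlongrightarrow> \<gamma> t) at_top"
      by (rule tendsto_eventually, rule eventually_at_top_linorderI[of t], rule stay)
    hence p: "\<gamma> t = p" using lim by (intro tendsto_unique[of at_top]) auto
    hence "t \<in> S" using t s by (simp add: S_def)
    hence tT: "t = Inf S" using t cInf_lower[OF _ bdd] by force
    have "s \<le> dist (\<gamma> t) p"
    proof (rule ccontr)
      assume "\<not> s \<le> dist (\<gamma> t) p"
      hence "0 < s - dist (\<gamma> t) p" by simp
      with cont t obtain d where d: "d > 0" "\<And>u. u \<ge> 0 \<Longrightarrow> dist u t < d \<Longrightarrow> dist (\<gamma> u) (\<gamma> t) < s - dist (\<gamma> t) p"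
        unfolding continuous_on_iff by (metis atLeast_iff)
      define u where "u = max (t / 2) (t - d / 2)"
      have u: "0 \<le> u" "u < t" "dist u t < d" using d tT pos by (auto simp: u_def dist_real_def)
      \<comment> \<open>By continuity an earlier time would already lie in the ball, contradicting
        the infimum.\<close>
      have "dist (\<gamma> u) p < s" using d(2)[OF u(1,3)] dist_triangle[of "\<gamma> u" p "\<gamma> t"] by linarith
      hence "u \<in> S" using u by (simp add: S_def dist_commute)
      thus False using cInf_lower[OF _ bdd, of u] u tT by simp
    qed
    thus False using p s by simp
  qed
  show ?thesis
    by (rule that[of "Inf S"]) (use T nz in \<open>auto simp: S_def dist_commute\<close>)
qed

text \<open>R and \<epsilon> precede the quantifier over g and L: the flow line, its corridor and
  all margins belong to f. Only the thresholds on \<theta> inside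
  \<open>all_methods_climb_to\<close> use the Lipschitz constant of the estimate.\<close>

lemma climbing_consistent:
  fixes f :: "'a::euclidean_space \<Rightarrow> real"
  assumes f: "regular_density f" and p: "is_mode f p" and x0: "x0 \<in> basin_of_attraction f p"
    and r: "0 < r" and \<mu>: "0 < \<mu>" and c: "0 < c" "c < 1"
    and neg: "\<And>x v. x \<in> cball p r \<Longrightarrow> hess f x v \<bullet> v \<le> - (\<mu> * (norm v)\<^sup>2)"
  shows "\<exists>R>0. \<exists>\<epsilon>>0. \<forall>g L. lipschitz_gradient g L \<and> (\<forall>x\<in>cball 0 R. norm (grad g x - grad f x) \<le> \<epsilon>) \<and>
     (\<forall>z\<in>cball p r. grad g z = 0 \<longrightarrow>
        (\<exists>H. (grad g has_derivative H) (at z) \<and> (\<forall>v. H v \<bullet> v \<le> - (\<mu> / 2 * (norm v)\<^sup>2)))) \<longrightarrow>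
     (\<exists>z\<in>ball p r. is_mode g z \<and> all_methods_climb_to c g x0 z)"
proof -
  define F where "F = grad f"
  note f' = regular_densityD[OF f, folded F_def]
  have F0: "F p = 0" using is_mode_imp_grad_0 p f'(4) by (auto simp: F_def)
  obtain L where L: "0 < L" "\<And>x y. norm (F x - F y) \<le> L * norm (x - y)"
    using bounded_hess_imp_lipschitz_grad[of f] f'(2) f unfolding regular_density_def F_def by metis
  obtain B where B: "0 < B" "\<And>x. norm (F x) \<le> B"
    using f by (auto simp: regular_density_def bounded_pos F_def)
  have inw: "F x \<bullet> (x - p) \<le> - (\<mu> * (norm (x - p))\<^sup>2)" if "x \<in> cball p r" for x
    using strongly_concave_gradient[OF f'(2)[unfolded F_def] convex_cball neg that, of p] F0 r
    by (simp add: F_def)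
  have lower: "\<mu> * norm (x - p) \<le> norm (F x)" if x: "x \<in> cball p r" for x
  proof (cases "x = p")
    case False
    have "\<mu> * (norm (x - p))\<^sup>2 \<le> norm (F x) * norm (x - p)"
      using inw[OF x] Cauchy_Schwarz_ineq2[of "F x" "x - p"] by linarith
    thus ?thesis using False by (simp add: power2_eq_square mult.assoc[symmetric])
  qed simp
  obtain \<gamma> where \<gamma>0: "\<gamma> 0 = x0"
    and \<gamma>: "\<And>t. 0 \<le> t \<Longrightarrow> (\<gamma> has_vector_derivative F (\<gamma> t)) (at t within {0..})"
    and lim: "(\<gamma> \<longlongrightarrow> p) at_top"
    using x0 by (auto simp: basin_of_attraction_def gradient_flow_def F_def)
  have r4: "0 < r / 4" using r by simp
  have nz: "F x \<noteq> 0" if "dist x p = r / 4" for x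
  proof -
    have "x \<in> cball p r" "0 < norm (x - p)" using that r by (auto simp: dist_commute dist_norm norm_minus_commute)
    thus ?thesis using lower[of x] \<mu> by (smt (verit) mult_pos_pos norm_zero)
  qed
  obtain T where T: "0 \<le> T" "dist (\<gamma> T) p \<le> r / 4" "T = 0 \<or> (\<forall>t\<in>{0..T}. F (\<gamma> t) \<noteq> 0)"
    by (rule flow_reaches_ball[OF \<gamma> L(2) lim r4 nz])
  have cF: "continuous_on S F" for S
    by (rule has_derivative_continuous_on, rule has_derivative_at_withinI, rule f'(2))
  have cont: "continuous_on {0..} \<gamma>" using \<gamma> by (auto intro!: continuous_on_vector_derivative)
  obtain m1 where m1: "0 < m1" "T = 0 \<or> (\<forall>t\<in>{0..T}. m1 \<le> norm (F (\<gamma> t)))"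
  proof (cases "T = 0")
    case False
    have "continuous_on {0..T} (\<lambda>t. norm (F (\<gamma> t)))"
      by (intro continuous_on_norm continuous_on_compose2[OF cF[of UNIV]] continuous_on_subset[OF cont]) auto
    then obtain t where t: "t \<in> {0..T}" "\<And>s. s \<in> {0..T} \<Longrightarrow> norm (F (\<gamma> t)) \<le> norm (F (\<gamma> s))"
      using continuous_attains_inf[of "{0..T}" "\<lambda>t. norm (F (\<gamma> t))"] T(1) by auto
    show ?thesis using that[of "norm (F (\<gamma> t))"] t T(3) False by auto
  qed (use that[of 1] in simp)
  \<comment> \<open>The first bound takes the end of the corridor from the ball of radius r/4 into
    the trapping ball of radius r/2; the second keeps \<open>F\<close> at least m1/2 in the
    corridor.\<close>
  define \<epsilon>1 where "\<epsilon>1 = min (r / 4) (m1 / (2 * L))"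
  have \<epsilon>1: "0 < \<epsilon>1" "\<epsilon>1 \<le> r / 4" "L * \<epsilon>1 \<le> m1 / 2"
  proof -
    show "0 < \<epsilon>1" "\<epsilon>1 \<le> r / 4" using r m1 L by (auto simp: \<epsilon>1_def)
    have "\<epsilon>1 \<le> m1 / (2 * L)" by (simp add: \<epsilon>1_def)
    thus "L * \<epsilon>1 \<le> m1 / 2" using L by (simp add: field_simps)
  qed
  define W1 where "W1 = {x. \<exists>t\<in>{0..T}. dist x (\<gamma> t) \<le> \<epsilon>1}"
  define W2 where "W2 = {x. r / 4 \<le> dist x p \<and> dist x p \<le> r / 2}"
  \<comment> \<open>For T = 0 the start is already in the trapping ball and may be p itself, where
    the gradient has no lower bound; the corridor is then left out.\<close>
  define W where "W = (if T = 0 then {} else W1) \<union> W2"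
  define m where "m = min (m1 / 2) (\<mu> * (r / 4))"
  have m: "0 < m" using m1 \<mu> r by (simp add: m_def)
  have FW: "m \<le> norm (F x)" if "x \<in> W" for x
  proof (cases "x \<in> W2")
    case True
    hence "\<mu> * (r / 4) \<le> \<mu> * norm (x - p)" using \<mu> by (intro mult_left_mono) (auto simp: W2_def dist_norm)
    moreover have "x \<in> cball p r" using True r by (auto simp: W2_def dist_commute)
    ultimately show ?thesis using lower[of x] by (simp add: m_def)
  next
    case False
    hence "T \<noteq> 0" "x \<in> W1" using that by (auto simp: W_def split: if_splits)
    then obtain t where t: "t \<in> {0..T}" "norm (x - \<gamma> t) \<le> \<epsilon>1" by (auto simp: W1_def dist_norm)
    have "norm (F x - F (\<gamma> t)) \<le> L * norm (x - \<gamma> t)" by (rule L)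
    also have "\<dots> \<le> L * \<epsilon>1" using t L by simp
    finally have "norm (F (\<gamma> t)) - norm (F x) \<le> m1 / 2"
      using \<epsilon>1(3) norm_triangle_ineq2[of "F (\<gamma> t)" "F x"] by (simp add: norm_minus_commute)
    thus ?thesis using m1 t \<open>T \<noteq> 0\<close> by (force simp: m_def)
  qed
  obtain \<alpha>1 where \<alpha>1: "0 < \<alpha>1" "\<And>\<tau>0 xs. 0 < \<tau>0 \<Longrightarrow> xs 0 = \<gamma> 0 \<Longrightarrow> follows F W1 \<tau>0 \<alpha>1 xs \<Longrightarrow>
      \<exists>k. dist (xs k) (\<gamma> T) < \<epsilon>1"
    using follows_reaches[OF \<gamma> L(2,1) B(2) T(1) \<epsilon>1(1)] unfolding W1_def[symmetric] by blast
  obtain \<alpha>2 where \<alpha>2: "0 < \<alpha>2" "\<And>\<tau>0 xs k0. 0 < \<tau>0 \<Longrightarrow> follows F W2 \<tau>0 \<alpha>2 xs \<Longrightarrow>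
      \<forall>k. xs k \<in> cball p r \<longrightarrow> norm (xs (Suc k) - xs k) \<le> r / 4 \<Longrightarrow> xs k0 \<in> cball p (r / 2) \<Longrightarrow>
      \<forall>k\<ge>k0. xs k \<in> cball p (r / 2)"
    using follows_trapped[OF inw B(2) \<mu> r] unfolding W2_def[symmetric] by blast
  define \<alpha> where "\<alpha> = min \<alpha>1 \<alpha>2"
  have \<alpha>: "0 < \<alpha>" "\<alpha> \<le> \<alpha>1" "\<alpha> \<le> \<alpha>2" using \<alpha>1 \<alpha>2 by (auto simp: \<alpha>_def)
  \<comment> \<open>In order: half of the admissible error per unit of time, the other half being
    left to the method; gradient of g at least m/2 on \<open>W\<close>; inward gradient on the outer
    shell; the bound B + 1.\<close>
  define \<epsilon> where "\<epsilon> = Min {\<alpha> / 2, m / 2, \<mu> * r / 8, 1}"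
  have \<epsilon>0: "0 < \<epsilon>" using \<alpha> m \<mu> r by (simp add: \<epsilon>_def)
  have \<epsilon>: "\<epsilon> \<le> \<alpha> / 2" "\<epsilon> \<le> m / 2" "\<epsilon> \<le> \<mu> * r / 8" "\<epsilon> \<le> 1" unfolding \<epsilon>_def by (auto intro!: Min_le)
  define R where "R = norm x0 + B * T + \<epsilon>1 + norm p + r"
  have R: "0 < R" unfolding R_def using r \<epsilon>1 B T by (intro add_nonneg_pos add_nonneg_nonneg) auto
  have inR: "x \<in> cball 0 R" if "x \<in> W \<union> cball p r" for x
  proof (cases "x \<in> cball p r")
    case True
    hence "norm x \<le> norm p + r" using norm_triangle_sub[of x p] by (simp add: dist_norm norm_minus_commute)
    also have "\<dots> \<le> R" unfolding R_def using \<epsilon>1 B T by simp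
    finally show ?thesis by simp
  next
    case False
    hence "x \<in> W1" using that r by (auto simp: W_def W2_def dist_commute split: if_splits)
    then obtain t where t: "t \<in> {0..T}" "norm (x - \<gamma> t) \<le> \<epsilon>1" by (auto simp: W1_def dist_norm)
    have "norm (\<gamma> t - \<gamma> 0) \<le> B * t"
      using flow_increment(1)[OF \<gamma> L(2,1) B(2), of 0 t] t by simp
    also have "B * t \<le> B * T" using t B by simp
    finally have "norm x \<le> norm x0 + B * T + \<epsilon>1"
      using t(2) \<gamma>0 norm_triangle_sub[of "\<gamma> t" "\<gamma> 0"] norm_triangle_sub[of x "\<gamma> t"] by simp
    also have "\<dots> \<le> R" unfolding R_def using r by simp
    finally show ?thesis by simp
  qed
  have "\<exists>z\<in>ball p r. is_mode g z \<and> all_methods_climb_to c g x0 z"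
    if lg: "lipschitz_gradient g Lg" and close: "\<forall>x\<in>cball 0 R. norm (grad g x - F x) \<le> \<epsilon>"
      and nondeg: "\<forall>z\<in>cball p r. grad g z = 0 \<longrightarrow>
        (\<exists>H. (grad g has_derivative H) (at z) \<and> (\<forall>v. H v \<bullet> v \<le> - (\<mu> / 2 * (norm v)\<^sup>2)))" for g Lg
  proof -
    interpret g: lipschitz_gradient g Lg by (rule lg)
    have near: "norm (grad g x - F x) \<le> \<epsilon>" if "x \<in> W \<union> cball p r" for x
      using close inR[OF that] by blast
    have gB: "norm (grad g x) \<le> B + 1" if "x \<in> W \<union> cball p r" for x
      using near[OF that] B(2)[of x] norm_triangle_sub[of "grad g x" "F x"] \<epsilon>(4) by linarith
    have gW: "m / 2 \<le> norm (grad g x)" if "x \<in> W" for x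
      using near[of x] FW[OF that] that norm_triangle_ineq2[of "F x" "grad g x"] \<epsilon>(2)
      by (simp add: norm_minus_commute)
    have ginw: "grad g x \<bullet> (x - p) \<le> - (\<mu> * r\<^sup>2 / 8)" if x: "x \<in> cball p r" "r / 2 \<le> norm (x - p)" for x
    proof -
      have "(r / 2)\<^sup>2 \<le> (norm (x - p))\<^sup>2" using x r by (intro power_mono) auto
      hence "\<mu> * (r / 2)\<^sup>2 \<le> \<mu> * (norm (x - p))\<^sup>2" using \<mu> by simp
      moreover have "(grad g x - F x) \<bullet> (x - p) \<le> (\<mu> * r / 8) * r"
      proof -
        have "(grad g x - F x) \<bullet> (x - p) \<le> norm (grad g x - F x) * norm (x - p)" by (rule norm_cauchy_schwarz)
        also have "\<dots> \<le> (\<mu> * r / 8) * r"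
          using near[of x] \<epsilon>(3) x \<mu> r by (intro mult_mono) (auto simp: dist_norm norm_minus_commute)
        finally show ?thesis .
      \<comment> \<open>Of the inward drift \<open>\<mu> * (r / 2)\<^sup>2\<close>, half is lost to
        the perturbation, which leaves \<open>\<mu> * r\<^sup>2 / 8\<close>.\<close>
      qed
      moreover have "grad g x \<bullet> (x - p) = F x \<bullet> (x - p) + (grad g x - F x) \<bullet> (x - p)" by (simp add: inner_diff_left)
      ultimately show ?thesis using inw[OF x(1)] by (simp add: power2_eq_square)
    qed
    have \<kappa>: "0 < \<mu> * r\<^sup>2 / 8" and \<mu>4: "0 < \<mu> / 4" using \<mu> r by auto
    have nondeg': "\<exists>H. (grad g has_derivative H) (at z) \<and> (\<forall>v. H v \<bullet> v \<le> - (2 * (\<mu> / 4) * (norm v)\<^sup>2))"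
      if "z \<in> cball p r" "grad g z = 0" for z using nondeg that by simp
    obtain z \<delta> where z: "z \<in> ball p r" "grad g z = 0" "\<And>x. x \<in> cball p r \<Longrightarrow> grad g x = 0 \<Longrightarrow> x = z"
      "\<And>x. x \<in> cball p r \<Longrightarrow> g x \<le> g z" "\<And>x. x \<in> cball p r \<Longrightarrow> g x = g z \<Longrightarrow> x = z"
      "0 < \<delta>" "\<And>x. x \<in> ball z \<delta> \<Longrightarrow> grad g x \<bullet> (x - z) \<le> - (\<mu> / 4 * (norm (x - z))\<^sup>2)"
      by (rule g.unique_critical_point[where p = p and \<mu> = "\<mu> / 4", OF r \<kappa>])
        (erule (1) ginw, rule \<mu>4, erule (1) nondeg', (rule that; assumption))
    have mode: "is_mode g z"
    proof -
      obtain e where "e > 0" "ball z e \<subseteq> ball p r" using z(1) open_ball openE by blast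
      thus ?thesis using z(4) unfolding is_mode_def by (meson ball_subset_cball subsetD)
    qed
    have zC: "z \<in> cball p (r / 2)"
    proof (rule ccontr)
      assume "z \<notin> cball p (r / 2)"
      hence "r / 2 \<le> norm (z - p)" by (simp add: dist_norm norm_minus_commute)
      thus False using ginw[of z] z(1,2) \<kappa> by simp
    qed
    have subC: "x \<in> cball p r" if "x \<in> cball p (r / 2)" for x using that r by simp
    have critC: "y = z" if "x \<in> cball p (r / 2)" "dist x y \<le> r / 2" "grad g y = 0" for x y
    proof -
      have "dist p y \<le> dist p x + dist x y" by (rule dist_triangle)
      hence "y \<in> cball p r" using that by simp
      thus ?thesis using z(3) that by blast
    qed
    have a2: "0 < \<alpha> / 2" and m2: "0 < m / 2" and B1: "0 < B + 1" and r2: "0 < r / 2"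
      using \<alpha> m B r by auto
    have gBW: "norm (grad g x) \<le> B + 1" if "x \<in> W" for x using gB that by blast
    have "\<exists>\<theta>0>0. \<forall>\<theta>. 0 < \<theta> \<and> \<theta> < \<theta>0 \<longrightarrow> (\<forall>run\<in>hill_climbing_methods c. \<exists>\<tau>0>0. \<forall>xs.
         run g \<theta> x0 xs \<longrightarrow> follows (grad g) W \<tau>0 (\<alpha> / 2) xs)"
      by (rule g.methods_follow[OF m2 _ B1 _ a2 c]; (erule gW | erule gBW))
    then obtain \<theta>1 where \<theta>1: "0 < \<theta>1" "\<forall>\<theta>. 0 < \<theta> \<and> \<theta> < \<theta>1 \<longrightarrow> (\<forall>run\<in>hill_climbing_methods c. \<exists>\<tau>0>0. \<forall>xs.
         run g \<theta> x0 xs \<longrightarrow> follows (grad g) W \<tau>0 (\<alpha> / 2) xs)"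
      by (elim exE conjE)
    have gBr: "norm (grad g x) \<le> B + 1" if "x \<in> cball p r" for x using gB that by blast
    have "\<exists>\<theta>0>0. \<forall>\<theta>. 0 < \<theta> \<and> \<theta> < \<theta>0 \<longrightarrow> (\<forall>run\<in>hill_climbing_methods c. \<forall>xs.
         run g \<theta> x0 xs \<longrightarrow> (\<forall>k. xs k \<in> cball p r \<longrightarrow> norm (xs (Suc k) - xs k) \<le> r / 4))"
      by (rule g.methods_step_le[OF less_imp_le[OF B1] _ r4]; erule gBr)
    then obtain \<theta>2 where \<theta>2: "0 < \<theta>2" "\<forall>\<theta>. 0 < \<theta> \<and> \<theta> < \<theta>2 \<longrightarrow> (\<forall>run\<in>hill_climbing_methods c. \<forall>xs.
         run g \<theta> x0 xs \<longrightarrow> (\<forall>k. xs k \<in> cball p r \<longrightarrow> norm (xs (Suc k) - xs k) \<le> r / 4))"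
      by (elim exE conjE)
    have eqC: "x = z" if "x \<in> cball p (r / 2)" "g x = g z" for x using z(5)[OF subC] that by blast
    have "\<exists>\<theta>0>0. \<forall>\<theta>. 0 < \<theta> \<and> \<theta> < \<theta>0 \<longrightarrow> (\<forall>run\<in>hill_climbing_methods c. \<forall>xs k0.
         run g \<theta> x0 xs \<and> (\<forall>k\<ge>k0. xs k \<in> cball p (r / 2)) \<longrightarrow> xs \<longlonglongrightarrow> z)"
      by (rule g.methods_tendsto[OF compact_cball zC r2 _ _ z(6) \<mu>4 _ mode c];
          (erule (2) critC | erule (1) eqC | erule z(7)))
    then obtain \<theta>3 where \<theta>3: "0 < \<theta>3" "\<forall>\<theta>. 0 < \<theta> \<and> \<theta> < \<theta>3 \<longrightarrow> (\<forall>run\<in>hill_climbing_methods c. \<forall>xs k0.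
         run g \<theta> x0 xs \<and> (\<forall>k\<ge>k0. xs k \<in> cball p (r / 2)) \<longrightarrow> xs \<longlonglongrightarrow> z)"
      by (elim exE conjE)
    \<comment> \<open>The three thresholds ensure following the field, short steps for trapping, and
      convergence once trapped.\<close>
    have "xs \<longlonglongrightarrow> z" if \<theta>: "0 < \<theta>" "\<theta> < Min {\<theta>1, \<theta>2, \<theta>3}"
      and run: "run \<in> hill_climbing_methods c" "run g \<theta> x0 xs" for \<theta> run xs
    proof -
      have \<theta>': "\<theta> < \<theta>1" "\<theta> < \<theta>2" "\<theta> < \<theta>3" using \<theta> by auto
      obtain \<tau>0 where \<tau>0: "0 < \<tau>0" "follows (grad g) W \<tau>0 (\<alpha> / 2) xs"
        using \<theta>1(2) \<theta>(1) \<theta>'(1) run by meson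
      hence "follows F W \<tau>0 (\<alpha> / 2 + \<epsilon>) xs"
        using near \<epsilon>0 by (intro follows_perturb[of "grad g"]) auto
      hence fol: "follows F W \<tau>0 \<alpha> xs"
        by (rule follows_mono) (use \<epsilon>(1) \<tau>0 in auto)
      have xs0: "xs 0 = x0"
        using run unfolding hill_climbing_methods_def
        by (auto simp: max_shift_def max_slope_shift_def euler_shift_def line_search_shift_def)
      have "\<exists>k. xs k \<in> cball p (r / 2)"
      proof (cases "T = 0")
        case True
        hence "xs 0 \<in> cball p (r / 2)" using T(2) xs0 \<gamma>0 r by (simp add: dist_commute)
        thus ?thesis by blast
      next
        case False
        have "follows F W1 \<tau>0 \<alpha>1 xs"
          using fol by (rule follows_mono) (use False \<alpha> \<tau>0 in \<open>auto simp: W_def\<close>)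
        moreover have "xs 0 = \<gamma> 0" using xs0 \<gamma>0 by simp
        ultimately obtain k where k: "dist (xs k) (\<gamma> T) < \<epsilon>1" using \<alpha>1(2) \<tau>0(1) by blast
        hence "dist (xs k) p \<le> r / 2"
          using dist_triangle[of "xs k" p "\<gamma> T"] T(2) \<epsilon>1(2) by linarith
        hence "xs k \<in> cball p (r / 2)" by (simp add: dist_commute)
        thus ?thesis by blast
      qed
      then obtain k0 where k0: "xs k0 \<in> cball p (r / 2)" by blast
      have fol2: "follows F W2 \<tau>0 \<alpha>2 xs"
        using fol by (rule follows_mono) (use \<alpha> \<tau>0 in \<open>auto simp: W_def\<close>)
      have "\<forall>k. xs k \<in> cball p r \<longrightarrow> norm (xs (Suc k) - xs k) \<le> r / 4"
        using \<theta>2(2) \<theta>(1) \<theta>'(2) run by meson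
      from \<alpha>2(2)[OF \<tau>0(1) fol2 this k0] show ?thesis
        using \<theta>3(2) \<theta>(1) \<theta>'(3) run by meson
    qed
    moreover have "\<exists>xs. run g \<theta> x0 xs" if "0 < \<theta>" "run \<in> hill_climbing_methods c" for \<theta> run
      using hill_climbing_run_exists[OF g.continuous_g that(1) c that(2)] .
    moreover have "0 < Min {\<theta>1, \<theta>2, \<theta>3}" using \<theta>1 \<theta>2 \<theta>3 by simp
    ultimately have "all_methods_climb_to c g x0 z" unfolding all_methods_climb_to_def by blast
    with z(1) mode show ?thesis by blast
  qed
  with R \<epsilon>0 show ?thesis unfolding F_def by blast
qed

subsection \<open>Convolution with a compactly supported kernel\<close>

lemma lborel_integral_affine:
  fixes \<phi> :: "'a::euclidean_space \<Rightarrow> real"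
  assumes [measurable]: "\<phi> \<in> borel_measurable borel" and c: "c \<noteq> 0"
  shows "(\<integral>x. \<phi> x \<partial>lborel) = \<bar>c\<bar> ^ DIM('a) * (\<integral>x. \<phi> (t + c *\<^sub>R x) \<partial>lborel)"
proof -
  have "(\<integral>x. \<phi> x \<partial>lborel) = (\<integral>x. \<phi> x \<partial>density (distr lborel borel (\<lambda>x. t + c *\<^sub>R x)) (\<lambda>_. \<bar>c\<bar> ^ DIM('a)))"
    by (subst lborel_affine[OF c, of t]) simp
  also have "\<dots> = (\<integral>x. \<bar>c\<bar> ^ DIM('a) * \<phi> x \<partial>distr lborel borel (\<lambda>x. t + c *\<^sub>R x))"
    by (subst integral_density) auto
  also have "\<dots> = (\<integral>x. \<bar>c\<bar> ^ DIM('a) * \<phi> (t + c *\<^sub>R x) \<partial>lborel)"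
    by (subst integral_distr) auto
  finally show ?thesis by simp
qed

lemma lborel_integral_reflect:
  fixes \<phi> :: "'a::euclidean_space \<Rightarrow> real"
  assumes "\<phi> \<in> borel_measurable borel"
  shows "(\<integral>x. \<phi> (y - x) \<partial>lborel) = (\<integral>x. \<phi> x \<partial>lborel)"
  using lborel_integral_affine[OF assms, of "-1" y] by simp

lemma integrable_indicator_cball: "integrable lborel (\<lambda>x::'a::euclidean_space. C * indicator (cball y r) x :: real)"
  using emeasure_bounded_finite[OF bounded_cball, of y r]
  by (intro integrable_mult_right integrable_real_indicator) auto

lemma integrable_continuous_support:
  fixes \<phi> :: "'a::euclidean_space \<Rightarrow> real"
  assumes "continuous_on UNIV \<phi>" "\<And>x. x \<notin> cball y r \<Longrightarrow> \<phi> x = 0"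
  shows "integrable lborel \<phi>"
proof -
  have "integrable lborel (\<lambda>x. indicator (cball y r) x *\<^sub>R \<phi> x)"
    using assms(1) by (intro borel_integrable_compact) (auto intro: continuous_on_subset)
  also have "(\<lambda>x. indicator (cball y r) x *\<^sub>R \<phi> x) = \<phi>"
    using assms(2) by (auto simp: fun_eq_iff indicator_def)
  finally show ?thesis .
qed

lemma continuous_support_bounded:
  fixes \<phi> :: "'a::euclidean_space \<Rightarrow> 'b::real_normed_vector"
  assumes "continuous_on UNIV \<phi>" "\<And>x. x \<notin> cball y r \<Longrightarrow> \<phi> x = 0"
  obtains b where "0 < b" "\<And>x. norm (\<phi> x) \<le> b"
proof -
  have "compact (\<phi> ` cball y r)"
    using assms(1) by (intro compact_continuous_image) (auto intro: continuous_on_subset)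
  then obtain b where b: "b > 0" "\<And>x. x \<in> cball y r \<Longrightarrow> norm (\<phi> x) \<le> b"
    using compact_imp_bounded[of "\<phi> ` cball y r"] unfolding bounded_pos by (metis imageI)
  have "norm (\<phi> x) \<le> b" for x using b assms(2)[of x] by (cases "x \<in> cball y r") auto
  with b(1) that show ?thesis by blast
qed

lemma continuous_support_uniformly_continuous:
  fixes \<phi> :: "'a::euclidean_space \<Rightarrow> 'b::real_normed_vector"
  assumes c: "continuous_on UNIV \<phi>" and s: "\<And>x. x \<notin> cball 0 r \<Longrightarrow> \<phi> x = 0"
  shows "uniformly_continuous_on UNIV \<phi>"
  unfolding uniformly_continuous_on_def
proof (intro allI impI)
  fix e :: real assume e: "e > 0"
  have "uniformly_continuous_on (cball 0 (r + 1)) \<phi>"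
    using c by (intro compact_uniformly_continuous) (auto intro: continuous_on_subset)
  then obtain d where d: "d > 0" "\<And>x y. x \<in> cball 0 (r + 1) \<Longrightarrow> y \<in> cball 0 (r + 1) \<Longrightarrow> dist y x < d \<Longrightarrow> dist (\<phi> y) (\<phi> x) < e"
    using e unfolding uniformly_continuous_on_def by metis
  have "dist (\<phi> y) (\<phi> x) < e" if xy: "dist y x < min d 1" for x y
  proof (cases "x \<in> cball 0 r \<or> y \<in> cball 0 r")
    case True
    hence "x \<in> cball 0 (r + 1)" "y \<in> cball 0 (r + 1)"
      using xy norm_triangle_sub[of x y] norm_triangle_sub[of y x] by (auto simp: dist_norm norm_minus_commute)
    thus ?thesis using d xy by simp
  next
    case False
    thus ?thesis using s e by simp
  qed
  thus "\<exists>d>0. \<forall>x\<in>UNIV. \<forall>x'\<in>UNIV. dist x' x < d \<longrightarrow> dist (\<phi> x') (\<phi> x) < e"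
    using d(1) by (intro exI[of _ "min d 1"]) auto
qed

text \<open>Integration by parts: both sides are the derivative at \<open>s = 0\<close> of
  \<open>\<integral>A(y + sv - x) B(x) dx = \<integral>A(x) B(y + sv - x) dx\<close>.\<close>

lemma convolution_by_parts:
  fixes A B :: "'a::euclidean_space \<Rightarrow> real"
  assumes A: "\<And>x s. ((\<lambda>s. A (x + s *\<^sub>R v)) has_real_derivative dA (x + s *\<^sub>R v)) (at s)"
    and B: "\<And>x s. ((\<lambda>s. B (x + s *\<^sub>R v)) has_real_derivative dB (x + s *\<^sub>R v)) (at s)"
    and cont: "continuous_on UNIV A" "continuous_on UNIV dA" "continuous_on UNIV B" "continuous_on UNIV dB"
    and supp: "\<And>x. x \<notin> cball 0 r \<Longrightarrow> A x = 0" "\<And>x. x \<notin> cball 0 r \<Longrightarrow> dA x = 0"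
    and b: "\<And>x. \<bar>B x\<bar> \<le> b" "\<And>x. \<bar>dB x\<bar> \<le> b"
  shows "(\<integral>x. dA (y - x) * B x \<partial>lborel) = (\<integral>x. A x * dB (y - x) \<partial>lborel)"
proof -
  have [measurable]: "A \<in> borel_measurable borel" "dA \<in> borel_measurable borel"
    "B \<in> borel_measurable borel" "dB \<in> borel_measurable borel"
    using cont by (simp_all add: borel_measurable_continuous_onI)
  obtain a where a: "0 < a" "\<And>x. norm (A x) \<le> a" using continuous_support_bounded[OF cont(1) supp(1)] by blast
  obtain a' where a': "0 < a'" "\<And>x. norm (dA x) \<le> a'" using continuous_support_bounded[OF cont(2) supp(2)] by blast
  \<comment> \<open>Dominated convergence is applied along a sequence of increments. All of them are
    at most 1, so the shifted supports lie in one fixed ball of radius r + |v|.\<close>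
  define t :: "nat \<Rightarrow> real" where "t n = inverse (real (Suc n))" for n
  have t: "0 < t n" "t n \<le> 1" for n by (auto simp: t_def inverse_le_1_iff)
  have t0: "filterlim t (at 0) sequentially"
    unfolding filterlim_at using t LIMSEQ_inverse_real_of_nat by (auto simp: t_def[abs_def] intro: always_eventually)
  have quot: "(\<lambda>n. (\<phi> (x + t n *\<^sub>R v) - \<phi> x) / t n) \<longlonglongrightarrow> d\<phi> x"
    if "\<And>s. ((\<lambda>s. \<phi> (x + s *\<^sub>R v)) has_real_derivative d\<phi> (x + s *\<^sub>R v)) (at s)" for \<phi> d\<phi> x
  proof -
    have "((\<lambda>h. (\<phi> (x + (0 + h) *\<^sub>R v) - \<phi> (x + 0 *\<^sub>R v)) / h) \<longlongrightarrow> d\<phi> (x + 0 *\<^sub>R v)) (at 0)"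
      using that[of 0] unfolding DERIV_def .
    from filterlim_compose[OF this t0] show ?thesis by simp
  qed
  have quot_le: "\<bar>(\<phi> (x + t n *\<^sub>R v) - \<phi> x) / t n\<bar> \<le> C"
    if der: "\<And>s. ((\<lambda>s. \<phi> (x + s *\<^sub>R v)) has_real_derivative d\<phi> (x + s *\<^sub>R v)) (at s)"
      and C: "\<And>x. \<bar>d\<phi> x\<bar> \<le> C" for \<phi> d\<phi> x n C
  proof -
    have "\<exists>s>0. s < t n \<and> \<phi> (x + t n *\<^sub>R v) - \<phi> (x + 0 *\<^sub>R v) = (t n - 0) * d\<phi> (x + s *\<^sub>R v)"
      using t by (intro MVT2 der)
    then obtain s where "\<phi> (x + t n *\<^sub>R v) - \<phi> x = t n * d\<phi> (x + s *\<^sub>R v)" by auto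
    thus ?thesis using C t(1)[of n] by simp
  qed
  define D where "D n = (\<integral>x. (A (y + t n *\<^sub>R v - x) - A (y - x)) / t n * B x \<partial>lborel)" for n
  have lim1: "D \<longlonglongrightarrow> (\<integral>x. dA (y - x) * B x \<partial>lborel)"
    unfolding D_def
  proof (rule integral_dominated_convergence)
    show "integrable lborel (\<lambda>x. (a' * b) * indicator (cball y (r + norm v)) x)" by (rule integrable_indicator_cball)
    show "AE x in lborel. (\<lambda>n. (A (y + t n *\<^sub>R v - x) - A (y - x)) / t n * B x) \<longlonglongrightarrow> dA (y - x) * B x"
    proof (rule AE_I2)
      fix x
      have "(\<lambda>n. (A (y - x + t n *\<^sub>R v) - A (y - x)) / t n) \<longlonglongrightarrow> dA (y - x)" by (rule quot) (rule A)
      thus "(\<lambda>n. (A (y + t n *\<^sub>R v - x) - A (y - x)) / t n * B x) \<longlonglongrightarrow> dA (y - x) * B x"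
        unfolding diff_add_eq by (rule tendsto_mult_right)
    qed
    fix n
    show "AE x in lborel. norm ((A (y + t n *\<^sub>R v - x) - A (y - x)) / t n * B x) \<le> (a' * b) * indicator (cball y (r + norm v)) x"
    proof (rule AE_I2)
      fix x
      show "norm ((A (y + t n *\<^sub>R v - x) - A (y - x)) / t n * B x) \<le> (a' * b) * indicator (cball y (r + norm v)) x"
      proof (cases "x \<in> cball y (r + norm v)")
        case True
        have "\<bar>(A (y - x + t n *\<^sub>R v) - A (y - x)) / t n\<bar> \<le> a'"
          using quot_le[of A "y - x" dA, OF A] a'(2) by simp
        hence "\<bar>(A (y - x + t n *\<^sub>R v) - A (y - x)) / t n\<bar> * \<bar>B x\<bar> \<le> a' * b"
          using b(1) a'(1) by (intro mult_mono) auto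
        thus ?thesis using True by (simp add: abs_mult diff_add_eq)
      next
        case False
        hence big: "r + norm v < norm (y - x)" by (simp add: dist_norm)
        have "norm (t n *\<^sub>R v) \<le> norm v" using t[of n] by (simp add: mult_left_le_one_le)
        hence "r < norm (y + t n *\<^sub>R v - x)"
          using big norm_triangle_ineq4[of "y + t n *\<^sub>R v - x" "t n *\<^sub>R v"] by (simp add: algebra_simps)
        moreover have "r < norm (y - x)" using big norm_ge_zero[of v] by linarith
        ultimately have "A (y + t n *\<^sub>R v - x) = 0" "A (y - x) = 0" by (auto intro!: supp(1))
        thus ?thesis using False by simp
      qed
    qed
  qed measurable
  \<comment> \<open>Reflection exchanges the factors of a convolution, so the difference quotient in
    y can be carried by either of them.\<close>
  have D_eq: "D n = (\<integral>x. A x * ((B (y - x + t n *\<^sub>R v) - B (y - x)) / t n) \<partial>lborel)" for n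
  proof -
    have AB: "integrable lborel (\<lambda>x. A (c - x) * B x)" for c
    proof (rule integrable_continuous_support[of _ c r])
      show "continuous_on UNIV (\<lambda>x. A (c - x) * B x)"
        by (intro continuous_intros continuous_on_compose2[OF cont(1)] cont(3)) auto
      show "A (c - x) * B x = 0" if "x \<notin> cball c r" for x
        using that supp(1)[of "c - x"] by (simp add: dist_norm norm_minus_commute)
    qed
    have AB': "integrable lborel (\<lambda>x. A x * B (c - x))" for c
    proof (rule integrable_continuous_support[of _ 0 r])
      show "continuous_on UNIV (\<lambda>x. A x * B (c - x))"
        by (intro continuous_intros continuous_on_compose2[OF cont(3)] cont(1)) auto
      show "A x * B (c - x) = 0" if "x \<notin> cball 0 r" for x using that supp(1)[of x] by simp
    qed
    have swap: "(\<integral>x. A (c - x) * B x \<partial>lborel) = (\<integral>x. A x * B (c - x) \<partial>lborel)" for c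
      using lborel_integral_reflect[of "\<lambda>x. A x * B (c - x)" c] by simp
    have "D n = (\<integral>x. (A (y + t n *\<^sub>R v - x) * B x - A (y - x) * B x) / t n \<partial>lborel)"
      unfolding D_def by (intro Bochner_Integration.integral_cong) (auto simp: left_diff_distrib)
    also have "\<dots> = ((\<integral>x. A x * B (y + t n *\<^sub>R v - x) \<partial>lborel) - (\<integral>x. A x * B (y - x) \<partial>lborel)) / t n"
      using AB by (simp add: swap)
    also have "\<dots> = (\<integral>x. (A x * B (y + t n *\<^sub>R v - x) - A x * B (y - x)) / t n \<partial>lborel)"
      using AB' by simp
    also have "\<dots> = (\<integral>x. A x * ((B (y - x + t n *\<^sub>R v) - B (y - x)) / t n) \<partial>lborel)"
      by (intro Bochner_Integration.integral_cong) (auto simp: right_diff_distrib diff_add_eq)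
    finally show ?thesis .
  qed
  have lim2: "D \<longlonglongrightarrow> (\<integral>x. A x * dB (y - x) \<partial>lborel)"
    unfolding D_eq
  proof (rule integral_dominated_convergence)
    show "integrable lborel (\<lambda>x::'a. (a * b) * indicator (cball 0 r) x)" by (rule integrable_indicator_cball)
    show "AE x in lborel. (\<lambda>n. A x * ((B (y - x + t n *\<^sub>R v) - B (y - x)) / t n)) \<longlonglongrightarrow> A x * dB (y - x)"
      using quot[of B _ dB, OF B] by (intro AE_I2 tendsto_mult_left)
    fix n
    show "AE x in lborel. norm (A x * ((B (y - x + t n *\<^sub>R v) - B (y - x)) / t n)) \<le> (a * b) * indicator (cball 0 r) x"
    proof (rule AE_I2)
      fix x
      show "norm (A x * ((B (y - x + t n *\<^sub>R v) - B (y - x)) / t n)) \<le> (a * b) * indicator (cball 0 r) x"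
      proof (cases "x \<in> cball 0 r")
        case True
        have "\<bar>(B (y - x + t n *\<^sub>R v) - B (y - x)) / t n\<bar> \<le> b"
          using quot_le[of B "y - x" dB, OF B] b(2) by blast
        hence "\<bar>A x\<bar> * \<bar>(B (y - x + t n *\<^sub>R v) - B (y - x)) / t n\<bar> \<le> a * b"
          using a by (intro mult_mono) auto
        thus ?thesis using True by (simp add: abs_mult)
      qed (use supp(1) in simp)
    qed
  qed measurable
  show ?thesis using lim1 lim2 by (rule LIMSEQ_unique)
qed

locale compact_kernel =
  fixes K :: "'a::euclidean_space \<Rightarrow> real" and \<rho> :: real
  assumes nonneg: "0 \<le> K x"
    and integral_K: "(\<integral>x. K x \<partial>lborel) = 1"
    and gderiv_K: "GDERIV K x :> grad K x"
    and deriv_grad_K: "(grad K has_derivative blinfun_apply (hess K x)) (at x)"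
    and continuous_hess_K: "continuous_on UNIV (hess K)"
    and \<rho>_pos: "0 < \<rho>"
    and supp_K: "x \<notin> cball 0 \<rho> \<Longrightarrow> K x = 0"
begin

lemma continuous_K: "continuous_on S K"
  using gderiv_K by (meson continuous_at_imp_continuous_on has_derivative_continuous gderiv_def)

lemma continuous_grad_K: "continuous_on S (grad K)"
  using deriv_grad_K by (meson continuous_at_imp_continuous_on has_derivative_continuous)

lemma supp_grad_K: assumes x: "x \<notin> cball 0 \<rho>" shows "grad K x = 0"
proof -
  have "((\<lambda>_. 0 :: real) has_derivative (\<lambda>h. h \<bullet> 0)) (at x)" by simp
  hence "(K has_derivative (\<lambda>h. h \<bullet> 0)) (at x)"
    by (rule has_derivative_transform_within_open[of _ _ _ _ "- cball 0 \<rho>"]) (use x supp_K in auto)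
  thus ?thesis by (intro GDERIV_imp_grad) (simp add: gderiv_def)
qed

lemma supp_hess_K: assumes x: "x \<notin> cball 0 \<rho>" shows "hess K x = 0"
proof -
  have "(grad K has_derivative (\<lambda>h. 0)) (at x)"
    by (rule has_derivative_transform_within_open[OF has_derivative_const, of "- cball 0 \<rho>"])
      (use x supp_grad_K in auto)
  from has_derivative_unique[OF this deriv_grad_K] have "blinfun_apply (hess K x) = (\<lambda>h. 0)" by simp
  thus ?thesis by (intro blinfun_eqI) simp
qed

lemma measurable_K [measurable]: "K \<in> borel_measurable borel"
  using continuous_K by (rule borel_measurable_continuous_onI)

lemma supp_scaled: "0 < h \<Longrightarrow> (x :: 'a) \<notin> cball 0 (h * \<rho>) \<Longrightarrow> x /\<^sub>R h \<notin> cball 0 \<rho>"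
  by (simp add: dist_norm field_simps)

lemma deriv_scaled_K:
  assumes "0 < h"
  shows "((\<lambda>s. K ((x + s *\<^sub>R v) /\<^sub>R h)) has_real_derivative grad K ((x + s *\<^sub>R v) /\<^sub>R h) \<bullet> v / h) (at s)"
proof -
  have "((\<lambda>s. K (x /\<^sub>R h + s *\<^sub>R (v /\<^sub>R h))) has_real_derivative grad K (x /\<^sub>R h + s *\<^sub>R (v /\<^sub>R h)) \<bullet> (v /\<^sub>R h)) (at s)"
    by (rule GDERIV_line) (rule gderiv_K)
  thus ?thesis by (simp add: scaleR_add_right mult.commute divide_inverse)
qed

lemma deriv_scaled_grad_K:
  assumes "0 < h"
  shows "((\<lambda>s. grad K ((x + s *\<^sub>R v) /\<^sub>R h) \<bullet> w) has_real_derivative hess K ((x + s *\<^sub>R v) /\<^sub>R h) v \<bullet> w / h) (at s)"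
proof -
  have "((\<lambda>s. (x + s *\<^sub>R v) /\<^sub>R h) has_derivative (\<lambda>t. (t *\<^sub>R v) /\<^sub>R h)) (at s)"
    by (auto intro!: derivative_eq_intros)
  from has_derivative_inner_left[OF has_derivative_compose[OF this deriv_grad_K]]
  show ?thesis unfolding has_field_derivative_def
    by (rule has_derivative_eq_rhs) (simp add: fun_eq_iff blinfun.scaleR_right divide_inverse)
qed

lemma integral_scaled_K: "0 < h \<Longrightarrow> (\<integral>x. K (x /\<^sub>R h) \<partial>lborel) = h ^ DIM('a)"
  using lborel_integral_affine[of "\<lambda>x. K (x /\<^sub>R h)" h 0] by (simp add: integral_K)

lemma integrable_scaled_K:
  assumes "0 < h" "continuous_on UNIV \<psi>"
  shows "integrable lborel (\<lambda>x. K (x /\<^sub>R h) * \<psi> (y - x))"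
proof (rule integrable_continuous_support[of _ 0 "h * \<rho>"])
  show "continuous_on UNIV (\<lambda>x. K (x /\<^sub>R h) * \<psi> (y - x))"
    by (intro continuous_intros continuous_on_compose2[OF continuous_K[of UNIV]] continuous_on_compose2[OF assms(2)]) auto
  show "K (x /\<^sub>R h) * \<psi> (y - x) = 0" if "x \<notin> cball 0 (h * \<rho>)" for x
    using supp_K[OF supp_scaled[OF assms(1) that]] by simp
qed

text \<open>The rescaled kernel has mass h^d and lives within distance h \<rho>, so only the
  oscillation of \<psi> over that distance enters.\<close>

lemma mollify:
  assumes h: "0 < h" and \<psi>: "continuous_on UNIV \<psi>"
    and w: "\<And>u. norm u \<le> h * \<rho> \<Longrightarrow> \<bar>\<psi> (y - u) - \<psi> y\<bar> \<le> w"
  shows "\<bar>(\<integral>x. K (x /\<^sub>R h) * \<psi> (y - x) \<partial>lborel) - h ^ DIM('a) * \<psi> y\<bar> \<le> h ^ DIM('a) * w"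
proof -
  have int1: "integrable lborel (\<lambda>x. K (x /\<^sub>R h) * \<psi> (y - x))" by (rule integrable_scaled_K[OF h \<psi>])
  have int0: "integrable lborel (\<lambda>x. K (x /\<^sub>R h) * c)" for c
    using integrable_scaled_K[OF h continuous_on_const[of UNIV c]] by simp
  have "(\<integral>x. K (x /\<^sub>R h) * \<psi> (y - x) \<partial>lborel) - h ^ DIM('a) * \<psi> y
      = (\<integral>x. K (x /\<^sub>R h) * \<psi> (y - x) \<partial>lborel) - (\<integral>x. K (x /\<^sub>R h) * \<psi> y \<partial>lborel)"
    using integral_scaled_K[OF h] by simp
  also have "\<dots> = (\<integral>x. K (x /\<^sub>R h) * \<psi> (y - x) - K (x /\<^sub>R h) * \<psi> y \<partial>lborel)"
    using int1 int0 by simp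
  also have "\<bar>\<dots>\<bar> \<le> (\<integral>x. \<bar>K (x /\<^sub>R h) * \<psi> (y - x) - K (x /\<^sub>R h) * \<psi> y\<bar> \<partial>lborel)"
    by (rule integral_abs_bound)
  also have "\<dots> \<le> (\<integral>x. K (x /\<^sub>R h) * w \<partial>lborel)"
  proof (rule integral_mono)
    show "integrable lborel (\<lambda>x. \<bar>K (x /\<^sub>R h) * \<psi> (y - x) - K (x /\<^sub>R h) * \<psi> y\<bar>)"
      using int1 int0 by simp
    fix x
    show "\<bar>K (x /\<^sub>R h) * \<psi> (y - x) - K (x /\<^sub>R h) * \<psi> y\<bar> \<le> K (x /\<^sub>R h) * w"
    proof (cases "x \<in> cball 0 (h * \<rho>)")
      case True
      thus ?thesis using w[of x] nonneg[of "x /\<^sub>R h"]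
        by (simp add: right_diff_distrib[symmetric] abs_mult mult_left_mono)
    qed (use supp_K[OF supp_scaled[OF h]] in simp)
  qed (rule int0)
  also have "\<dots> = h ^ DIM('a) * w" using integral_scaled_K[OF h] by simp
  finally show ?thesis .
qed

text \<open>Moving the derivative from the kernel onto f cancels the 1/h in the derivative of the
  rescaled kernel and leaves a mollification of \<open>grad f\<close>; hence the normalisation
  h^(d+1).\<close>

lemma bias_grad:
  fixes f :: "'a \<Rightarrow> real"
  assumes h: "0 < h" and f: "\<And>x. GDERIV f x :> grad f x" and cf: "continuous_on UNIV (grad f)"
    and b: "\<And>x. \<bar>f x\<bar> \<le> b" "\<And>x. norm (grad f x) \<le> b"
    and w: "\<And>u. norm u \<le> h * \<rho> \<Longrightarrow> \<bar>grad f (y - u) \<bullet> v - grad f y \<bullet> v\<bar> \<le> w"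
  shows "\<bar>(\<integral>x. (grad K ((y - x) /\<^sub>R h) \<bullet> v) * f x \<partial>lborel) - h ^ (DIM('a) + 1) * (grad f y \<bullet> v)\<bar>
    \<le> h ^ (DIM('a) + 1) * w"
proof -
  have cf0: "continuous_on UNIV f"
    using f by (meson continuous_at_imp_continuous_on has_derivative_continuous gderiv_def)
  have b0: "0 \<le> b" using b(1)[of 0] by linarith
  have b1: "\<bar>f x\<bar> \<le> b * (norm v + 1)" "\<bar>grad f x \<bullet> v\<bar> \<le> b * (norm v + 1)" for x
  proof -
    show "\<bar>f x\<bar> \<le> b * (norm v + 1)" using b(1)[of x] b0 by (simp add: distrib_left add_increasing)
    have "\<bar>grad f x \<bullet> v\<bar> \<le> norm (grad f x) * norm v" by (rule Cauchy_Schwarz_ineq2)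
    also have "\<dots> \<le> b * (norm v + 1)" using b(2)[of x] b0 by (intro mult_mono) auto
    finally show "\<bar>grad f x \<bullet> v\<bar> \<le> b * (norm v + 1)" .
  qed
  have parts: "(\<integral>x. grad K ((y - x) /\<^sub>R h) \<bullet> v / h * f x \<partial>lborel) = (\<integral>x. K (x /\<^sub>R h) * (grad f (y - x) \<bullet> v) \<partial>lborel)"
  proof (rule convolution_by_parts[where A = "\<lambda>x. K (x /\<^sub>R h)" and dA = "\<lambda>x. grad K (x /\<^sub>R h) \<bullet> v / h"
        and B = f and dB = "\<lambda>x. grad f x \<bullet> v" and r = "h * \<rho>" and v = v, OF deriv_scaled_K[OF h] GDERIV_line[OF f]])
    show "continuous_on UNIV (\<lambda>x. K (x /\<^sub>R h))"
      by (intro continuous_intros continuous_on_compose2[OF continuous_K[of UNIV]]) auto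
    show "continuous_on UNIV (\<lambda>x. grad K (x /\<^sub>R h) \<bullet> v / h)"
      using h by (intro continuous_intros continuous_on_compose2[OF continuous_grad_K[of UNIV]]) auto
    show "continuous_on UNIV (\<lambda>x. grad f x \<bullet> v)" by (intro continuous_intros cf)
    show "K (x /\<^sub>R h) = 0" "grad K (x /\<^sub>R h) \<bullet> v / h = 0" if "x \<notin> cball 0 (h * \<rho>)" for x
      using supp_K[OF supp_scaled[OF h that]] supp_grad_K[OF supp_scaled[OF h that]] by simp_all
  qed (use cf0 b1 in auto)
  have "(\<integral>x. (grad K ((y - x) /\<^sub>R h) \<bullet> v) * f x \<partial>lborel) = h * (\<integral>x. grad K ((y - x) /\<^sub>R h) \<bullet> v / h * f x \<partial>lborel)"
    using h by simp
  also have "\<dots> = h * (\<integral>x. K (x /\<^sub>R h) * (grad f (y - x) \<bullet> v) \<partial>lborel)" by (simp only: parts)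
  finally have eq: "(\<integral>x. (grad K ((y - x) /\<^sub>R h) \<bullet> v) * f x \<partial>lborel) - h ^ (DIM('a) + 1) * (grad f y \<bullet> v)
      = h * ((\<integral>x. K (x /\<^sub>R h) * (grad f (y - x) \<bullet> v) \<partial>lborel) - h ^ DIM('a) * (grad f y \<bullet> v))"
    by (simp add: right_diff_distrib)
  have "\<bar>(\<integral>x. K (x /\<^sub>R h) * (grad f (y - x) \<bullet> v) \<partial>lborel) - h ^ DIM('a) * (grad f y \<bullet> v)\<bar> \<le> h ^ DIM('a) * w"
    by (rule mollify[OF h _ w]) (intro continuous_intros cf)
  thus ?thesis unfolding eq using h by (simp add: abs_mult)
qed

text \<open>Two integrations by parts, first in direction v and then in direction v', with a
  reflection between them to restore the form of the first. This order yields the Hessian of f with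
  v and v' interchanged; symmetry repairs it where it is used.\<close>

lemma bias_hess:
  fixes f :: "'a \<Rightarrow> real"
  assumes h: "0 < h" and f: "\<And>x. GDERIV f x :> grad f x"
    and f2: "\<And>x. (grad f has_derivative blinfun_apply (hess f x)) (at x)"
    and cf: "continuous_on UNIV (hess f)"
    and b: "\<And>x. \<bar>f x\<bar> \<le> b" "\<And>x. norm (grad f x) \<le> b" "\<And>x. norm (hess f x) \<le> b"
    and w: "\<And>u. norm u \<le> h * \<rho> \<Longrightarrow> \<bar>hess f (y - u) v' \<bullet> v - hess f y v' \<bullet> v\<bar> \<le> w"
  shows "\<bar>(\<integral>x. (hess K ((y - x) /\<^sub>R h) v \<bullet> v') * f x \<partial>lborel) - h ^ (DIM('a) + 2) * (hess f y v' \<bullet> v)\<bar>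
    \<le> h ^ (DIM('a) + 2) * w"
proof -
  have cf0: "continuous_on UNIV f"
    using f by (meson continuous_at_imp_continuous_on has_derivative_continuous gderiv_def)
  have cf1: "continuous_on UNIV (grad f)"
    using f2 by (meson continuous_at_imp_continuous_on has_derivative_continuous)
  have b0: "0 \<le> b" using b(1)[of 0] by linarith
  define b' where "b' = b * ((norm v + 1) * (norm v' + 1))"
  have ge1: "1 \<le> (norm v + 1) * (norm v' + 1)" "norm v \<le> (norm v + 1) * (norm v' + 1)"
    "norm v' * norm v \<le> (norm v + 1) * (norm v' + 1)" by (auto simp: algebra_simps add_increasing)
  have b1: "\<bar>f x\<bar> \<le> b'" "\<bar>grad f x \<bullet> v\<bar> \<le> b'" "\<bar>hess f x v' \<bullet> v\<bar> \<le> b'" for x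
  proof -
    show "\<bar>f x\<bar> \<le> b'" using b(1)[of x] mult_left_mono[OF ge1(1) b0] by (simp add: b'_def)
    have "\<bar>grad f x \<bullet> v\<bar> \<le> norm (grad f x) * norm v" by (rule Cauchy_Schwarz_ineq2)
    also have "\<dots> \<le> b'" unfolding b'_def using b(2)[of x] ge1 b0 by (intro mult_mono) auto
    finally show "\<bar>grad f x \<bullet> v\<bar> \<le> b'" .
    have "\<bar>hess f x v' \<bullet> v\<bar> \<le> norm (hess f x v') * norm v" by (rule Cauchy_Schwarz_ineq2)
    also have "\<dots> \<le> (norm (hess f x) * norm v') * norm v" by (intro mult_right_mono norm_blinfun) simp
    also have "\<dots> \<le> b * (norm v' * norm v)" unfolding mult.assoc using b(3)[of x] by (intro mult_right_mono) auto
    also have "\<dots> \<le> b'" unfolding b'_def using ge1(3) b0 by (intro mult_left_mono)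
    finally show "\<bar>hess f x v' \<bullet> v\<bar> \<le> b'" .
  qed
  have dgf: "((\<lambda>s. grad f (x + s *\<^sub>R v') \<bullet> v) has_real_derivative hess f (x + s *\<^sub>R v') v' \<bullet> v) (at s)" for x s
  proof -
    have "((\<lambda>s. x + s *\<^sub>R v') has_derivative (\<lambda>t. t *\<^sub>R v')) (at s)" by (auto intro!: derivative_eq_intros)
    from has_derivative_inner_left[OF has_derivative_compose[OF this f2]]
    show ?thesis by (simp add: has_field_derivative_def blinfun.scaleR_right mult_commute_abs)
  qed
  have cK: "continuous_on UNIV (\<lambda>x. K (x /\<^sub>R h))" "continuous_on UNIV (\<lambda>x. grad K (x /\<^sub>R h) \<bullet> v')"
    "continuous_on UNIV (\<lambda>x. hess K (x /\<^sub>R h) v \<bullet> v' / h)"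
    using h by (intro continuous_intros continuous_on_compose2[OF continuous_K[of UNIV]]
        continuous_on_compose2[OF continuous_grad_K[of UNIV]] continuous_on_compose2[OF continuous_hess_K]; auto)+
  have cf': "continuous_on UNIV (\<lambda>x. grad f x \<bullet> v)" "continuous_on UNIV (\<lambda>x. hess f x v' \<bullet> v)"
    by (intro continuous_intros cf cf1)+
  have parts1: "(\<integral>x. hess K ((y - x) /\<^sub>R h) v \<bullet> v' / h * f x \<partial>lborel) = (\<integral>x. (grad K (x /\<^sub>R h) \<bullet> v') * (grad f (y - x) \<bullet> v) \<partial>lborel)"
  proof (rule convolution_by_parts[where A = "\<lambda>x. grad K (x /\<^sub>R h) \<bullet> v'" and dA = "\<lambda>x. hess K (x /\<^sub>R h) v \<bullet> v' / h"
        and B = f and dB = "\<lambda>x. grad f x \<bullet> v" and r = "h * \<rho>" and v = v, OF deriv_scaled_grad_K[OF h] GDERIV_line[OF f]])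
    show "grad K (x /\<^sub>R h) \<bullet> v' = 0" "hess K (x /\<^sub>R h) v \<bullet> v' / h = 0" if "x \<notin> cball 0 (h * \<rho>)" for x
      using supp_grad_K[OF supp_scaled[OF h that]] supp_hess_K[OF supp_scaled[OF h that]] by simp_all
  qed (use cf0 cf' b1 cK in auto)
  have parts2: "(\<integral>x. grad K ((y - x) /\<^sub>R h) \<bullet> v' / h * (grad f x \<bullet> v) \<partial>lborel) = (\<integral>x. K (x /\<^sub>R h) * (hess f (y - x) v' \<bullet> v) \<partial>lborel)"
  proof (rule convolution_by_parts[where A = "\<lambda>x. K (x /\<^sub>R h)" and dA = "\<lambda>x. grad K (x /\<^sub>R h) \<bullet> v' / h"
        and B = "\<lambda>x. grad f x \<bullet> v" and dB = "\<lambda>x. hess f x v' \<bullet> v" and r = "h * \<rho>" and v = v', OF deriv_scaled_K[OF h] dgf])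
    show "K (x /\<^sub>R h) = 0" "grad K (x /\<^sub>R h) \<bullet> v' / h = 0" if "x \<notin> cball 0 (h * \<rho>)" for x
      using supp_K[OF supp_scaled[OF h that]] supp_grad_K[OF supp_scaled[OF h that]] by simp_all
    show "continuous_on UNIV (\<lambda>x. grad K (x /\<^sub>R h) \<bullet> v' / h)"
      using h by (intro continuous_on_divide cK(2) continuous_on_const) auto
  qed (use cf' b1 cK in auto)
  have [measurable]: "(\<lambda>x. grad K (x /\<^sub>R h) \<bullet> v') \<in> borel_measurable borel" "(\<lambda>x. grad f x \<bullet> v) \<in> borel_measurable borel"
    using cK(2) cf'(1) by (simp_all add: borel_measurable_continuous_onI)
  have "(\<integral>x. (hess K ((y - x) /\<^sub>R h) v \<bullet> v') * f x \<partial>lborel) = h * (\<integral>x. hess K ((y - x) /\<^sub>R h) v \<bullet> v' / h * f x \<partial>lborel)"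
    using h by simp
  also have "\<dots> = h * (\<integral>x. (grad K (x /\<^sub>R h) \<bullet> v') * (grad f (y - x) \<bullet> v) \<partial>lborel)" by (simp only: parts1)
  also have "(\<integral>x. (grad K (x /\<^sub>R h) \<bullet> v') * (grad f (y - x) \<bullet> v) \<partial>lborel) = (\<integral>x. (grad K ((y - x) /\<^sub>R h) \<bullet> v') * (grad f x \<bullet> v) \<partial>lborel)"
    using lborel_integral_reflect[of "\<lambda>x. (grad K (x /\<^sub>R h) \<bullet> v') * (grad f (y - x) \<bullet> v)" y] by simp
  also have "\<dots> = h * (\<integral>x. grad K ((y - x) /\<^sub>R h) \<bullet> v' / h * (grad f x \<bullet> v) \<partial>lborel)" using h by simp
  also have "\<dots> = h * (\<integral>x. K (x /\<^sub>R h) * (hess f (y - x) v' \<bullet> v) \<partial>lborel)" by (simp only: parts2)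
  finally have eq: "(\<integral>x. (hess K ((y - x) /\<^sub>R h) v \<bullet> v') * f x \<partial>lborel) - h ^ (DIM('a) + 2) * (hess f y v' \<bullet> v)
      = h * (h * ((\<integral>x. K (x /\<^sub>R h) * (hess f (y - x) v' \<bullet> v) \<partial>lborel) - h ^ DIM('a) * (hess f y v' \<bullet> v)))"
    by (simp add: algebra_simps power2_eq_square)
  have "\<bar>(\<integral>x. K (x /\<^sub>R h) * (hess f (y - x) v' \<bullet> v) \<partial>lborel) - h ^ DIM('a) * (hess f y v' \<bullet> v)\<bar> \<le> h ^ DIM('a) * w"
    by (rule mollify[OF h cf'(2) w])
  hence "h * (h * \<bar>(\<integral>x. K (x /\<^sub>R h) * (hess f (y - x) v' \<bullet> v) \<partial>lborel) - h ^ DIM('a) * (hess f y v' \<bullet> v)\<bar>) \<le> h * (h * (h ^ DIM('a) * w))"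
    using h by (intro mult_left_mono) auto
  thus ?thesis unfolding eq using h by (simp add: abs_mult power2_eq_square mult_ac)
qed

end

subsection \<open>Exponential deviation bounds\<close>

text \<open>For negative x, multiply by exp(-x) >= 1 - x and use (1 + x + x^2)(1 - x) = 1 - x^3 >=
  1.\<close>

lemma exp_le_quadratic:
  fixes x :: real
  assumes "\<bar>x\<bar> \<le> 1"
  shows "exp x \<le> 1 + x + x\<^sup>2"
proof (cases "0 \<le> x")
  case False
  have "1 \<le> 1 - x ^ 3" using False by (simp add: power_le_zero_eq less_imp_le)
  also have "\<dots> = (1 + x + x\<^sup>2) * (1 - x)" by (simp add: algebra_simps power2_eq_square power3_eq_cube)
  also have "\<dots> \<le> (1 + x + x\<^sup>2) * exp (- x)"
  proof (rule mult_left_mono)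
    show "1 - x \<le> exp (- x)" using exp_ge_add_one_self[of "- x"] by simp
    show "0 \<le> 1 + x + x\<^sup>2" using assms by (simp add: abs_le_iff)
  qed
  finally have "1 * exp x \<le> (1 + x + x\<^sup>2) * exp (- x) * exp x" by (rule mult_right_mono) simp
  thus ?thesis by (simp add: mult.assoc exp_add[symmetric])
qed (use assms in \<open>simp add: exp_bound\<close>)

context prob_space
begin

text \<open>After centring, the exponent is at most 2 l b <= 1 in absolute value, so the quadratic
  bound on exp applies. The second moment replaces the variance, since it is what the support of the
  kernel controls.\<close>

lemma exp_moment_le:
  fixes Z :: "'a \<Rightarrow> real"
  assumes [measurable]: "random_variable borel Z" and b: "\<And>\<omega>. \<bar>Z \<omega>\<bar> \<le> b"
    and v: "expectation (\<lambda>\<omega>. (Z \<omega>)\<^sup>2) \<le> v" and l: "0 \<le> l" "2 * l * b \<le> 1"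
  shows "expectation (\<lambda>\<omega>. exp (l * (Z \<omega> - expectation Z))) \<le> exp (l\<^sup>2 * v)"
proof -
  define m where "m = expectation Z"
  have b0: "0 \<le> b" using b[of undefined] by linarith
  have int: "integrable M Z" by (rule integrable_const_bound[where B = b]) (use b in auto)
  have int2: "integrable M (\<lambda>\<omega>. (Z \<omega>)\<^sup>2)"
  proof (rule integrable_const_bound[where B = "b\<^sup>2"])
    show "AE \<omega> in M. norm ((Z \<omega>)\<^sup>2) \<le> b\<^sup>2" using b by (intro AE_I2) (simp add: abs_le_square_iff[symmetric] b0)
  qed simp
  have mb: "\<bar>m\<bar> \<le> b"
  proof -
    have "\<bar>m\<bar> \<le> expectation (\<lambda>\<omega>. \<bar>Z \<omega>\<bar>)" unfolding m_def by (rule integral_abs_bound)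
    also have "\<dots> \<le> expectation (\<lambda>\<omega>. b)" using int b by (intro integral_mono) auto
    finally show ?thesis by (simp add: prob_space)
  qed
  have small: "\<bar>l * (Z \<omega> - m)\<bar> \<le> 1" for \<omega>
  proof -
    have "\<bar>l * (Z \<omega> - m)\<bar> = l * \<bar>Z \<omega> - m\<bar>" using l by (simp add: abs_mult)
    also have "\<dots> \<le> l * (2 * b)" using b[of \<omega>] mb l by (intro mult_left_mono) linarith+
    finally show ?thesis using l by simp
  qed
  have "expectation (\<lambda>\<omega>. exp (l * (Z \<omega> - m))) \<le> expectation (\<lambda>\<omega>. 1 + l * (Z \<omega> - m) + (l * (Z \<omega> - m))\<^sup>2)"
  proof (rule integral_mono)
    show "integrable M (\<lambda>\<omega>. exp (l * (Z \<omega> - m)))"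
      by (rule integrable_const_bound[where B = "exp 1"]) (use small in \<open>auto simp: abs_le_iff\<close>)
    show "integrable M (\<lambda>\<omega>. 1 + l * (Z \<omega> - m) + (l * (Z \<omega> - m))\<^sup>2)"
    proof (rule integrable_const_bound[where B = "3"])
      show "AE \<omega> in M. norm (1 + l * (Z \<omega> - m) + (l * (Z \<omega> - m))\<^sup>2) \<le> 3"
      proof (rule AE_I2)
        fix \<omega>
        have "(l * (Z \<omega> - m))\<^sup>2 \<le> 1" using small[of \<omega>] by (simp add: abs_square_le_1)
        moreover have "0 \<le> (l * (Z \<omega> - m))\<^sup>2" by simp
        ultimately show "norm (1 + l * (Z \<omega> - m) + (l * (Z \<omega> - m))\<^sup>2) \<le> 3"
          using small[of \<omega>] unfolding real_norm_def abs_le_iff by linarith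
      qed
    qed measurable
    show "exp (l * (Z \<omega> - m)) \<le> 1 + l * (Z \<omega> - m) + (l * (Z \<omega> - m))\<^sup>2" for \<omega>
      by (rule exp_le_quadratic[OF small])
  qed
  also have "\<dots> = expectation (\<lambda>\<omega>. (1 - l * m + l\<^sup>2 * m\<^sup>2) + (l - 2 * l\<^sup>2 * m) * Z \<omega> + l\<^sup>2 * (Z \<omega>)\<^sup>2)"
    by (intro Bochner_Integration.integral_cong) (auto simp: algebra_simps power2_eq_square)
  also have "\<dots> = (1 - l * m + l\<^sup>2 * m\<^sup>2) + (l - 2 * l\<^sup>2 * m) * m + l\<^sup>2 * expectation (\<lambda>\<omega>. (Z \<omega>)\<^sup>2)"
    using int int2 by (simp add: prob_space m_def)
  also have "\<dots> = 1 - l\<^sup>2 * m\<^sup>2 + l\<^sup>2 * expectation (\<lambda>\<omega>. (Z \<omega>)\<^sup>2)"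
    by (simp add: algebra_simps power2_eq_square)
  also have "\<dots> \<le> 1 + l\<^sup>2 * v"
  proof -
    have "0 \<le> l\<^sup>2 * m\<^sup>2" by simp
    moreover have "l\<^sup>2 * expectation (\<lambda>\<omega>. (Z \<omega>)\<^sup>2) \<le> l\<^sup>2 * v" using v by (rule mult_left_mono) simp
    ultimately show ?thesis by linarith
  qed
  also have "\<dots> \<le> exp (l\<^sup>2 * v)" by (rule exp_ge_add_one_self)
  finally show ?thesis by (simp add: m_def)
qed

text \<open>The bound is stated with \<open>n\<close> above the cardinality so that it also covers
  the sums with one observation removed.\<close>

lemma chernoff_sum_ge:
  fixes Z :: "'i \<Rightarrow> 'a \<Rightarrow> real"
  assumes I: "finite I" "real (card I) \<le> n" and ind: "indep_vars (\<lambda>_. borel) Z I"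
    and b: "\<And>i \<omega>. i \<in> I \<Longrightarrow> \<bar>Z i \<omega>\<bar> \<le> b" and v: "\<And>i. i \<in> I \<Longrightarrow> expectation (\<lambda>\<omega>. (Z i \<omega>)\<^sup>2) \<le> v" and v0: "0 \<le> v"
    and l: "0 \<le> l" "2 * l * b \<le> 1" 
  shows "prob {\<omega>\<in>space M. t \<le> (\<Sum>i\<in>I. Z i \<omega> - expectation (Z i))} \<le> exp (n * (l\<^sup>2 * v) - l * t)"
proof -
  have rv [measurable]: "random_variable borel (Z i)" if "i \<in> I" for i
    using ind that unfolding indep_vars_def by blast
  define Y where "Y i \<omega> = exp (l * (Z i \<omega> - expectation (Z i)))" for i \<omega>
  have "indep_vars (\<lambda>_. borel) (\<lambda>i \<omega>. exp (l * (Z i \<omega> - expectation (Z i)))) I"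
    by (rule indep_vars_compose2[OF ind]) measurable
  hence indY: "indep_vars (\<lambda>_. borel) Y I" by (simp add: Y_def[abs_def])
  have intY: "integrable M (Y i)" if i: "i \<in> I" for i
  proof (rule integrable_const_bound[where B = "exp (l * (b + \<bar>expectation (Z i)\<bar>))"])
    show "AE \<omega> in M. norm (Y i \<omega>) \<le> exp (l * (b + \<bar>expectation (Z i)\<bar>))"
      using b[OF i] l(1) by (intro AE_I2) (auto simp: Y_def intro!: mult_left_mono, smt (verit))
    show "Y i \<in> borel_measurable M" unfolding Y_def[abs_def] using rv[OF i] by measurable
  qed
  have prodY: "expectation (\<lambda>\<omega>. \<Prod>i\<in>I. Y i \<omega>) = (\<Prod>i\<in>I. expectation (Y i))"
    by (rule indep_vars_lebesgue_integral[OF I(1) indY intY])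
  have int_prod: "integrable M (\<lambda>\<omega>. \<Prod>i\<in>I. Y i \<omega>)" by (rule indep_vars_integrable[OF I(1) indY intY])
  have prod_eq: "(\<Prod>i\<in>I. Y i \<omega>) = exp (l * (\<Sum>i\<in>I. Z i \<omega> - expectation (Z i)))" for \<omega>
    using I(1) by (simp add: Y_def exp_sum sum_distrib_left)
  have "prob {\<omega>\<in>space M. t \<le> (\<Sum>i\<in>I. Z i \<omega> - expectation (Z i))} \<le> prob {\<omega>\<in>space M. exp (l * t) \<le> (\<Prod>i\<in>I. Y i \<omega>)}"
  proof (rule finite_measure_mono)
    show "{\<omega>\<in>space M. exp (l * t) \<le> (\<Prod>i\<in>I. Y i \<omega>)} \<in> events"
      using borel_measurable_integrable[OF int_prod] by measurable
  qed (use l in \<open>auto simp: prod_eq intro: mult_left_mono\<close>)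
  also have "\<dots> \<le> expectation (\<lambda>\<omega>. \<Prod>i\<in>I. Y i \<omega>) / exp (l * t)"
    by (rule integral_Markov_inequality_measure[OF int_prod sets.top]) (auto simp: Y_def intro!: AE_I2 prod_nonneg)
  also have "expectation (\<lambda>\<omega>. \<Prod>i\<in>I. Y i \<omega>) \<le> (\<Prod>i\<in>I. exp (l\<^sup>2 * v))"
    unfolding prodY
  proof (rule prod_mono)
    fix i assume i: "i \<in> I"
    have "0 \<le> expectation (Y i)" by (intro Bochner_Integration.integral_nonneg) (simp add: Y_def)
    moreover have "expectation (Y i) \<le> exp (l\<^sup>2 * v)"
      unfolding Y_def[abs_def] by (rule exp_moment_le[OF rv[OF i] b[OF i] v[OF i] l])
    ultimately show "0 \<le> expectation (Y i) \<and> expectation (Y i) \<le> exp (l\<^sup>2 * v)" by simp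
  qed
  also have "(\<Prod>i\<in>I. exp (l\<^sup>2 * v)) = exp (real (card I) * (l\<^sup>2 * v))" by (simp add: exp_of_nat_mult)
  also have "\<dots> \<le> exp (n * (l\<^sup>2 * v))" using I(2) v0 by (simp add: mult_right_mono)
  finally show ?thesis by (simp add: exp_diff divide_right_mono)
qed

end

subsection \<open>Samples from a bounded density\<close>

locale density_sample = prob_space M for M :: "'w measure" +
  fixes X :: "nat \<Rightarrow> 'w \<Rightarrow> 'a::euclidean_space" and f :: "'a \<Rightarrow> real" and F :: real
  assumes indep: "indep_vars (\<lambda>_. borel) X UNIV"
    and dist_X: "distributed M lborel (X i) (\<lambda>x. ennreal (f x))"
    and f_meas: "f \<in> borel_measurable borel"
    and f_nonneg: "0 \<le> f x" and f_le: "f x \<le> F" and F_pos: "0 < F"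
begin

lemma rv_X [measurable]: "random_variable borel (X i)"
  using indep unfolding indep_vars_def by simp

declare f_meas [measurable]

lemma expectation_X:
  fixes \<phi> :: "'a \<Rightarrow> real"
  assumes "\<phi> \<in> borel_measurable borel"
  shows "expectation (\<lambda>\<omega>. \<phi> (X i \<omega>)) = (\<integral>x. f x * \<phi> x \<partial>lborel)"
  by (rule distributed_integral[OF dist_X, symmetric]) (use assms f_nonneg in auto)

lemma integrable_f_indicator:
  assumes [measurable]: "S \<in> sets borel" and fin: "emeasure lborel S < \<infinity>"
  shows "integrable lborel (\<lambda>x. f x * indicator S x)"
proof (rule Bochner_Integration.integrable_bound)
  show "integrable lborel (\<lambda>x. F * indicator S x :: real)" using fin by (intro integrable_mult_right integrable_real_indicator) auto
  show "AE x in lborel. norm (f x * indicator S x) \<le> norm (F * indicator S x)"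
    using f_nonneg f_le F_pos by (intro AE_I2) (auto simp: indicator_def)
qed measurable

lemma events_X: "S \<in> sets borel \<Longrightarrow> {\<omega>\<in>space M. X i \<omega> \<in> S} \<in> events"
  using measurable_sets[OF rv_X, of S i] by (simp add: vimage_def Int_def conj_commute)

lemma prob_X:
  assumes [measurable]: "S \<in> sets borel"
  shows "prob {\<omega>\<in>space M. X i \<omega> \<in> S} = (\<integral>x. f x * indicator S x \<partial>lborel)"
proof -
  have "expectation (\<lambda>\<omega>. indicator S (X i \<omega>)) = (\<integral>x. f x * indicator S x \<partial>lborel)" by (rule expectation_X) simp
  moreover have "expectation (\<lambda>\<omega>. indicator S (X i \<omega>) :: real) = expectation (indicator {\<omega>\<in>space M. X i \<omega> \<in> S})"
    by (intro Bochner_Integration.integral_cong) (auto simp: indicator_def)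
  ultimately show ?thesis by simp
qed

lemma prob_X_le:
  assumes [measurable]: "S \<in> sets borel" and fin: "emeasure lborel S < \<infinity>"
  shows "prob {\<omega>\<in>space M. X i \<omega> \<in> S} \<le> F * measure lborel S"
proof -
  have "(\<integral>x. f x * indicator S x \<partial>lborel) \<le> (\<integral>x. F * indicator S x \<partial>lborel)"
  proof (rule integral_mono)
    show "integrable lborel (\<lambda>x. F * indicator S x :: real)"
      using fin by (intro integrable_mult_right integrable_real_indicator) auto
  qed (use fin f_le in \<open>auto intro: integrable_f_indicator mult_right_mono\<close>)
  also have "\<dots> = F * measure lborel S" by simp
  finally show ?thesis unfolding prob_X[OF assms(1)] .
qed

lemma prob_X_ge:
  assumes [measurable]: "S \<in> sets borel" and fin: "emeasure lborel S < \<infinity>" and m: "\<And>x. x \<in> S \<Longrightarrow> m \<le> f x"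
  shows "m * measure lborel S \<le> prob {\<omega>\<in>space M. X i \<omega> \<in> S}"
proof -
  have "m * measure lborel S = (\<integral>x. m * indicator S x \<partial>lborel)" by simp
  also have "\<dots> \<le> (\<integral>x. f x * indicator S x \<partial>lborel)"
  proof (rule integral_mono)
    show "integrable lborel (\<lambda>x. m * indicator S x :: real)"
      using fin by (intro integrable_mult_right integrable_real_indicator) auto
    show "m * indicator S x \<le> f x * indicator S x" for x using m[of x] by (cases "x \<in> S") auto
  qed (use fin in \<open>auto intro: integrable_f_indicator\<close>)
  finally show ?thesis unfolding prob_X[OF assms(1)] .
qed

lemma prob_none_le:
  assumes [measurable]: "S \<in> sets borel" and q: "\<And>i. q \<le> prob {\<omega>\<in>space M. X i \<omega> \<in> S}"
  shows "prob {\<omega>\<in>space M. \<forall>i<n. X i \<omega> \<notin> S} \<le> exp (- (real n * q))"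
proof (cases "n = 0")
  case False
  have "{\<omega>\<in>space M. \<forall>i<n. X i \<omega> \<notin> S} = (\<Inter>i\<in>{..<n}. X i -` (- S) \<inter> space M)" using False by auto
  also have "prob \<dots> = (\<Prod>i\<in>{..<n}. prob (X i -` (- S) \<inter> space M))"
    using False by (intro indep_varsD_finite[where M' = "\<lambda>_. borel"] indep_vars_subset[OF indep]) auto
  also have "\<dots> \<le> (\<Prod>i\<in>{..<n}. exp (- q))"
  proof (intro prod_mono conjI)
    fix i
    have "X i -` (- S) \<inter> space M = space M - {\<omega>\<in>space M. X i \<omega> \<in> S}" by auto
    hence "prob (X i -` (- S) \<inter> space M) = 1 - prob {\<omega>\<in>space M. X i \<omega> \<in> S}" by (simp add: prob_compl)
    also have "\<dots> \<le> 1 + (- q)" using q by simp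
    also have "\<dots> \<le> exp (- q)" by (rule exp_ge_add_one_self)
    finally show "prob (X i -` (- S) \<inter> space M) \<le> exp (- q)" .
  qed simp
  also have "\<dots> = exp (- (real n * q))" by (simp add: exp_of_nat_mult[symmetric])
  finally show ?thesis .
qed simp

text \<open>The order p of the derivative sets the scale: p = 1 serves the gradient and p = 2 the
  Hessian, where the exponent is that of the bandwidth condition. A single rate \<open>c\<close>
  works for all points, bandwidths and index sets, as the union bounds over grids require.\<close>

definition exp_deviation :: "('a \<Rightarrow> real) \<Rightarrow> real \<Rightarrow> real \<Rightarrow> bool" where
  "exp_deviation \<phi> t c \<longleftrightarrow> (\<forall>y h n I p. 0 < h \<and> h \<le> 1 \<and> finite I \<and> card I \<le> n \<longrightarrow>
    prob {\<omega>\<in>space M. real n * h ^ (DIM('a) + p) * t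
        \<le> \<bar>\<Sum>i\<in>I. \<phi> ((y - X i \<omega>) /\<^sub>R h) - (\<integral>x. f x * \<phi> ((y - x) /\<^sub>R h) \<partial>lborel)\<bar>}
      \<le> 2 * exp (- (c * (real n * h ^ (DIM('a) + 2 * p)))))"

lemma deviation:
  fixes \<phi> :: "'a \<Rightarrow> real"
  assumes c: "continuous_on UNIV \<phi>" and b: "0 < b" "\<And>x. \<bar>\<phi> x\<bar> \<le> b"
    and supp: "\<And>x. x \<notin> cball 0 \<rho> \<Longrightarrow> \<phi> x = 0" and \<rho>: "0 < \<rho>" and t: "0 < t"
  shows "\<exists>c>0. exp_deviation \<phi> t c"
proof -
  define v0 where "v0 = b\<^sup>2 * F * unit_ball_vol (DIM('a)) * \<rho> ^ DIM('a)"
  have v0: "0 < v0" using b F_pos \<rho> by (simp add: v0_def)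
  \<comment> \<open>The Chernoff parameter will be s h^p. The second moments are at most v0 h^d, by
    the volume of the rescaled support, so the quadratic term of the exponent is at most half of the
    linear one, s t n h^(d+2p).\<close>
  define s where "s = min (1 / (2 * b)) (t / (2 * v0))"
  have s: "0 < s" "2 * s * b \<le> 1" "s * v0 \<le> t / 2"
  proof -
    show "0 < s" using b t v0 by (simp add: s_def)
    have "s \<le> 1 / (2 * b)" "s \<le> t / (2 * v0)" by (auto simp: s_def)
    thus "2 * s * b \<le> 1" "s * v0 \<le> t / 2" using b v0 by (simp_all add: field_simps)
  qed
  have one: "prob {\<omega>\<in>space M. real n * h ^ (DIM('a) + p) * t
        \<le> (\<Sum>i\<in>I. \<psi> ((y - X i \<omega>) /\<^sub>R h) - (\<integral>x. f x * \<psi> ((y - x) /\<^sub>R h) \<partial>lborel))}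
      \<le> exp (- (s * t / 2 * (real n * h ^ (DIM('a) + 2 * p))))"
    if \<psi>: "continuous_on UNIV \<psi>" "\<And>x. \<bar>\<psi> x\<bar> \<le> b" "\<And>x. x \<notin> cball 0 \<rho> \<Longrightarrow> \<psi> x = 0"
      and h: "0 < h" "h \<le> 1" and I: "finite I" "card I \<le> n" for \<psi> :: "'a \<Rightarrow> real" and y h n I p
  proof -
    have [measurable]: "\<psi> \<in> borel_measurable borel" using \<psi>(1) by (rule borel_measurable_continuous_onI)
    define Z where "Z i \<omega> = \<psi> ((y - X i \<omega>) /\<^sub>R h)" for i \<omega>
    have EZ: "expectation (Z i) = (\<integral>x. f x * \<psi> ((y - x) /\<^sub>R h) \<partial>lborel)" for i
      unfolding Z_def by (rule expectation_X) measurable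
    have vZ: "expectation (\<lambda>\<omega>. (Z i \<omega>)\<^sup>2) \<le> v0 * h ^ DIM('a)" for i
    proof -
      have rv: "random_variable borel (Z i)" unfolding Z_def by measurable
      have ev: "{\<omega>\<in>space M. X i \<omega> \<in> cball y (h * \<rho>)} \<in> events" by (rule events_X) simp
      have "expectation (\<lambda>\<omega>. (Z i \<omega>)\<^sup>2) \<le> expectation (\<lambda>\<omega>. b\<^sup>2 * indicator {\<omega>\<in>space M. X i \<omega> \<in> cball y (h * \<rho>)} \<omega>)"
      proof (rule integral_mono)
        have sq: "(Z i \<omega>)\<^sup>2 \<le> b\<^sup>2" for \<omega>
          using \<psi>(2)[of "(y - X i \<omega>) /\<^sub>R h"] b(1) by (simp add: Z_def abs_le_square_iff[symmetric])
        show "integrable M (\<lambda>\<omega>. (Z i \<omega>)\<^sup>2)"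
          by (rule integrable_const_bound[where B = "b\<^sup>2"]) (use sq rv in auto)
        show "integrable M (\<lambda>\<omega>. b\<^sup>2 * indicator {\<omega>\<in>space M. X i \<omega> \<in> cball y (h * \<rho>)} \<omega>)"
          using ev by (intro integrable_mult_right integrable_real_indicator) (auto simp: less_top[symmetric])
        fix \<omega> assume \<omega>: "\<omega> \<in> space M"
        show "(Z i \<omega>)\<^sup>2 \<le> b\<^sup>2 * indicator {\<omega>\<in>space M. X i \<omega> \<in> cball y (h * \<rho>)} \<omega>"
        proof (cases "X i \<omega> \<in> cball y (h * \<rho>)")
          case False
          hence "h * \<rho> < norm (y - X i \<omega>)" by (simp add: dist_norm)
          hence "\<rho> < norm (y - X i \<omega>) / h" using h by (simp add: pos_less_divide_eq mult.commute)
          also have "\<dots> = norm ((y - X i \<omega>) /\<^sub>R h)" using h unfolding norm_scaleR by (simp add: divide_inverse mult.commute)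
          finally have "(y - X i \<omega>) /\<^sub>R h \<notin> cball 0 \<rho>" by (simp add: dist_norm)
          thus ?thesis using \<psi>(3) by (simp add: Z_def)
        qed (use sq \<omega> in simp)
      qed
      also have "\<dots> = b\<^sup>2 * prob {\<omega>\<in>space M. X i \<omega> \<in> cball y (h * \<rho>)}" using ev by simp
      also have "\<dots> \<le> b\<^sup>2 * (F * measure lborel (cball y (h * \<rho>)))"
        using emeasure_bounded_finite[OF bounded_cball, of y "h * \<rho>"]
        by (intro mult_left_mono prob_X_le) auto
      also have "\<dots> = v0 * h ^ DIM('a)"
        using h \<rho> by (simp add: content_cball v0_def power_mult_distrib)
      finally show ?thesis .
    qed
    have ind: "indep_vars (\<lambda>_. borel) Z I"
      unfolding Z_def[abs_def]
      by (rule indep_vars_compose2[OF indep_vars_subset[OF indep subset_UNIV]]) measurable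
    have hp: "h ^ p \<le> 1" using h by (simp add: power_le_one)
    have l: "0 \<le> s * h ^ p" "2 * (s * h ^ p) * b \<le> 1"
    proof -
      show "0 \<le> s * h ^ p" using s h by simp
      have "(2 * s * b) * h ^ p \<le> 1 * 1" using s hp h b by (intro mult_mono) auto
      thus "2 * (s * h ^ p) * b \<le> 1" by (simp add: mult_ac)
    qed
    have "prob {\<omega>\<in>space M. real n * h ^ (DIM('a) + p) * t \<le> (\<Sum>i\<in>I. Z i \<omega> - expectation (Z i))}
        \<le> exp (real n * ((s * h ^ p)\<^sup>2 * (v0 * h ^ DIM('a))) - (s * h ^ p) * (real n * h ^ (DIM('a) + p) * t))"
      using I v0 h \<psi>(2) by (intro chernoff_sum_ge[OF I(1) _ ind _ vZ _ l]) (auto simp: Z_def)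
    also have "\<dots> \<le> exp (- (s * t / 2 * (real n * h ^ (DIM('a) + 2 * p))))"
    proof -
      have pw: "(h ^ p)\<^sup>2 = h ^ (2 * p)" by (simp add: power_mult[symmetric] mult.commute)
      have "s * (s * v0) \<le> s * (t / 2)" using s by (intro mult_left_mono) auto
      hence "(real n * h ^ (DIM('a) + 2 * p)) * (s * (s * v0)) \<le> (real n * h ^ (DIM('a) + 2 * p)) * (s * (t / 2))"
        by (rule mult_left_mono) (use h in simp)
      moreover have "real n * ((s * h ^ p)\<^sup>2 * (v0 * h ^ DIM('a))) = (real n * h ^ (DIM('a) + 2 * p)) * (s * (s * v0))"
        by (simp add: power_mult_distrib pw power_add power2_eq_square[of s])
      moreover have "(s * h ^ p) * (real n * h ^ (DIM('a) + p) * t) = (real n * h ^ (DIM('a) + 2 * p)) * (s * t)"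
        by (simp add: power_add mult_2)
      moreover have "s * t / 2 * (real n * h ^ (DIM('a) + 2 * p)) = (real n * h ^ (DIM('a) + 2 * p)) * (s * t) / 2"
        "(real n * h ^ (DIM('a) + 2 * p)) * (s * (t / 2)) = (real n * h ^ (DIM('a) + 2 * p)) * (s * t) / 2"
        by simp_all
      ultimately show ?thesis unfolding exp_le_cancel_iff by linarith
    qed
    finally show ?thesis unfolding EZ by (simp add: Z_def)
  qed
  show ?thesis unfolding exp_deviation_def
  proof (intro exI[of _ "s * t / 2"] conjI allI impI, goal_cases)
    case 1
    show "0 < s * t / 2" using s t by simp
  next
    case (2 y h n I p)
    hence h: "0 < h" "h \<le> 1" and I: "finite I" "card I \<le> n" by auto
    have [measurable]: "\<phi> \<in> borel_measurable borel" using c by (rule borel_measurable_continuous_onI)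
    let ?T = "real n * h ^ (DIM('a) + p) * t"
    let ?E = "exp (- (s * t / 2 * (real n * h ^ (DIM('a) + 2 * p))))"
    define U where "U \<omega> = (\<Sum>i\<in>I. \<phi> ((y - X i \<omega>) /\<^sub>R h) - (\<integral>x. f x * \<phi> ((y - x) /\<^sub>R h) \<partial>lborel))" for \<omega>
    have [measurable]: "random_variable borel U" unfolding U_def by measurable
    have up: "prob {\<omega>\<in>space M. ?T \<le> U \<omega>} \<le> ?E"
      unfolding U_def using one[OF c b(2) supp h I] by blast
    have negU: "(\<Sum>i\<in>I. - \<phi> ((y - X i \<omega>) /\<^sub>R h) - (\<integral>x. f x * - \<phi> ((y - x) /\<^sub>R h) \<partial>lborel)) = - U \<omega>" for \<omega>
      by (simp add: U_def sum_negf[symmetric])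
    have "prob {\<omega>\<in>space M. ?T \<le> (\<Sum>i\<in>I. - \<phi> ((y - X i \<omega>) /\<^sub>R h) - (\<integral>x. f x * - \<phi> ((y - x) /\<^sub>R h) \<partial>lborel))} \<le> ?E"
      by (rule one[OF continuous_on_minus[OF c] _ _ h I]) (use b supp in auto)
    \<comment> \<open>The lower tail is the upper tail for -\<phi>; the two together account for the
      factor 2.\<close>
    hence down: "prob {\<omega>\<in>space M. ?T \<le> - U \<omega>} \<le> ?E" unfolding negU .
    have "prob {\<omega>\<in>space M. ?T \<le> \<bar>U \<omega>\<bar>} \<le> prob ({\<omega>\<in>space M. ?T \<le> U \<omega>} \<union> {\<omega>\<in>space M. ?T \<le> - U \<omega>})"
      by (intro finite_measure_mono) auto
    also have "\<dots> \<le> prob {\<omega>\<in>space M. ?T \<le> U \<omega>} + prob {\<omega>\<in>space M. ?T \<le> - U \<omega>}"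
      by (intro measure_Un_le) measurable
    finally show ?case using up down by (simp add: U_def)
  qed
qed

end

subsection \<open>Grids\<close>

lemma cball_grid:
  fixes c :: "'a::euclidean_space"
  obtains C where "1 \<le> C" "\<And>\<delta>. 0 < \<delta> \<Longrightarrow> \<delta> \<le> 1 \<Longrightarrow>
    \<exists>S. finite S \<and> real (card S) \<le> (C / \<delta>) ^ DIM('a) \<and> (\<forall>x\<in>cball c R. \<exists>s\<in>S. dist x s \<le> \<delta>)"
proof -
  define d where "d = real DIM('a)"
  define Q where "Q = norm c + \<bar>R\<bar>"
  have d: "1 \<le> d" and Q: "0 \<le> Q" using DIM_positive[where 'a='a] by (auto simp: d_def Q_def Suc_le_eq simp del: DIM_positive)
  have "\<exists>S. finite S \<and> real (card S) \<le> ((2 * Q * d + 3) / \<delta>) ^ DIM('a) \<and> (\<forall>x\<in>cball c R. \<exists>s\<in>S. dist x s \<le> \<delta>)"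
    if \<delta>: "0 < \<delta>" "\<delta> \<le> 1" for \<delta>
  proof -
    \<comment> \<open>Rounding each coordinate down to a multiple of \<kappa> costs at most d
      \<kappa> = \<delta> in the l1 norm, hence in the Euclidean one.\<close>
    define \<kappa> where "\<kappa> = \<delta> / d"
    have \<kappa>: "0 < \<kappa>" using \<delta> d by (simp add: \<kappa>_def)
    define N where "N = \<lceil>Q / \<kappa>\<rceil>"
    have N: "0 \<le> N" "Q / \<kappa> \<le> of_int N" "of_int N \<le> Q / \<kappa> + 1"
    proof -
      have "0 \<le> Q / \<kappa>" using Q \<kappa> by simp
      thus "0 \<le> N" "Q / \<kappa> \<le> of_int N" "of_int N \<le> Q / \<kappa> + 1"
        unfolding N_def by linarith+
    qed
    define S where "S = (\<lambda>k. \<Sum>b\<in>Basis. (\<kappa> * of_int (k b)) *\<^sub>R b) ` (PiE (Basis :: 'a set) (\<lambda>_. {- N..N}))"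
    have "finite S" unfolding S_def by (intro finite_imageI finite_PiE) auto
    moreover have "real (card S) \<le> ((2 * Q * d + 3) / \<delta>) ^ DIM('a)"
    proof -
      have "card S \<le> card (PiE (Basis :: 'a set) (\<lambda>_. {- N..N}))" unfolding S_def by (intro card_image_le finite_PiE) auto
      also have "\<dots> = nat (2 * N + 1) ^ DIM('a)" by (simp add: card_PiE)
      finally have "real (card S) \<le> real (nat (2 * N + 1)) ^ DIM('a)" by (metis of_nat_le_iff of_nat_power)
      also have "\<dots> \<le> ((2 * Q * d + 3) / \<delta>) ^ DIM('a)"
      proof (rule power_mono)
        have "real (nat (2 * N + 1)) = 2 * of_int N + 1" using N by simp
        also have "\<dots> \<le> 2 * (Q / \<kappa> + 1) + 1" using N by simp
        also have "\<dots> = (2 * Q * d + 3 * \<delta>) / \<delta>" using \<delta> by (simp add: \<kappa>_def field_simps)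
        also have "\<dots> \<le> (2 * Q * d + 3) / \<delta>" using \<delta> by (intro divide_right_mono) auto
        finally show "real (nat (2 * N + 1)) \<le> (2 * Q * d + 3) / \<delta>" .
      qed simp
      finally show ?thesis .
    qed
    moreover have "\<exists>s\<in>S. dist x s \<le> \<delta>" if x: "x \<in> cball c R" for x
    proof -
      define k where "k b = \<lfloor>(x \<bullet> b) / \<kappa>\<rfloor>" for b
      define s where "s = (\<Sum>b\<in>Basis. (\<kappa> * of_int (k b)) *\<^sub>R b)"
      have "norm x \<le> Q" using x norm_triangle_sub[of x c] by (simp add: Q_def dist_norm norm_minus_commute)
      have "k b \<in> {- N..N}" if b: "b \<in> Basis" for b
      proof -
        have "\<bar>x \<bullet> b\<bar> \<le> Q" using Basis_le_norm[OF b, of x] \<open>norm x \<le> Q\<close> by linarith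
        hence "- (Q / \<kappa>) \<le> (x \<bullet> b) / \<kappa>" "(x \<bullet> b) / \<kappa> \<le> Q / \<kappa>"
          using \<kappa> by (auto simp: abs_le_iff field_simps)
        hence "- of_int N \<le> (x \<bullet> b) / \<kappa>" "(x \<bullet> b) / \<kappa> \<le> of_int N" using N by linarith+
        thus ?thesis by (auto simp: k_def le_floor_iff floor_le_iff intro: order_le_less_trans)
      qed
      hence "restrict k Basis \<in> PiE (Basis :: 'a set) (\<lambda>_. {- N..N})" by auto
      moreover have "s = (\<Sum>b\<in>Basis. (\<kappa> * of_int (restrict k Basis b)) *\<^sub>R b)" by (simp add: s_def)
      ultimately have "s \<in> S" unfolding S_def by blast
      have "dist x s \<le> (\<Sum>b\<in>Basis. \<bar>(x - s) \<bullet> b\<bar>)" unfolding dist_norm by (rule norm_le_l1)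
      also have "\<dots> \<le> (\<Sum>b\<in>(Basis :: 'a set). \<kappa>)"
      proof (rule sum_mono)
        fix b :: 'a assume b: "b \<in> Basis"
        have "s \<bullet> b = \<kappa> * of_int (k b)" using b unfolding s_def by (simp add: inner_sum_left_Basis)
        moreover have "of_int (k b) \<le> (x \<bullet> b) / \<kappa>" "(x \<bullet> b) / \<kappa> < of_int (k b) + 1" by (auto simp: k_def)
        hence "\<kappa> * of_int (k b) \<le> x \<bullet> b" "x \<bullet> b < \<kappa> * of_int (k b) + \<kappa>"
          using \<kappa> by (simp_all add: field_simps)
        ultimately show "\<bar>(x - s) \<bullet> b\<bar> \<le> \<kappa>" by (simp add: inner_diff_left)
      qed
      also have "\<dots> = \<delta>" using d by (simp add: \<kappa>_def d_def)
      finally show ?thesis using \<open>s \<in> S\<close> by blast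
    qed
    ultimately show ?thesis by blast
  qed
  moreover have "1 \<le> 2 * Q * d + 3" using Q d by simp
  ultimately show ?thesis using that by blast
qed

subsection \<open>Derivatives of the kernel density estimate\<close>

lemma norm_scaled: "0 < h \<Longrightarrow> norm (x /\<^sub>R h) = norm x / h" for x :: "'a::real_normed_vector"
  unfolding norm_scaleR by (simp add: divide_inverse mult.commute)

lemma norm_add_diff_le: "norm (a + b - c) \<le> norm a + norm b + norm c" for a :: "'a::real_normed_vector"
  using norm_triangle_ineq4[of "a + b" c] norm_triangle_ineq[of a b] by linarith

context compact_kernel
begin

lemma bounded_hess_K: "bounded (range (hess K))"
proof -
  obtain b where "0 < b" "\<And>x. norm (hess K x) \<le> b"
    using continuous_support_bounded[of "hess K" 0 \<rho>, OF continuous_hess_K supp_hess_K] by metis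
  thus ?thesis by (intro boundedI[of _ b]) auto
qed

definition "lip_K = (SOME L. 0 < L \<and> (\<forall>x. norm (hess K x) \<le> L) \<and> (\<forall>x y. norm (grad K x - grad K y) \<le> L * norm (x - y)))"

lemma lip_K: "0 < lip_K" "norm (hess K x) \<le> lip_K" "norm (grad K x - grad K y) \<le> lip_K * norm (x - y)"
proof -
  have "\<exists>L. 0 < L \<and> (\<forall>x. norm (hess K x) \<le> L) \<and> (\<forall>x y. norm (grad K x - grad K y) \<le> L * norm (x - y))"
    using bounded_hess_imp_lipschitz_grad[OF deriv_grad_K bounded_hess_K] by metis
  from someI_ex[OF this] show "0 < lip_K" "norm (hess K x) \<le> lip_K" "norm (grad K x - grad K y) \<le> lip_K * norm (x - y)"
    by (auto simp: lip_K_def)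
qed

lemma hess_K_entry_le:
  assumes "b \<in> Basis" "b' \<in> Basis"
  shows "\<bar>hess K x b \<bullet> b'\<bar> \<le> lip_K"
proof -
  have "\<bar>hess K x b \<bullet> b'\<bar> \<le> norm (hess K x b) * norm b'" by (rule Cauchy_Schwarz_ineq2)
  also have "\<dots> \<le> norm (hess K x) * norm b" using norm_blinfun[of "hess K x" b] assms by simp
  also have "\<dots> \<le> lip_K" using lip_K(2)[of x] assms by simp
  finally show ?thesis .
qed

lemma grad_kde:
  assumes h: "0 < h"
  shows "GDERIV (kde K h n xs) y :> (1 / (real n * h ^ (DIM('a) + 1))) *\<^sub>R (\<Sum>i<n. grad K ((y - xs i) /\<^sub>R h))"
    (is "GDERIV _ _ :> ?G")
    and "grad (kde K h n xs) y = (1 / (real n * h ^ (DIM('a) + 1))) *\<^sub>R (\<Sum>i<n. grad K ((y - xs i) /\<^sub>R h))"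
proof -
  have one: "((\<lambda>x. K ((x - xs i) /\<^sub>R h)) has_derivative (\<lambda>v. (v /\<^sub>R h) \<bullet> grad K ((y - xs i) /\<^sub>R h))) (at y)" for i
  proof -
    have "((\<lambda>x. (x - xs i) /\<^sub>R h) has_derivative (\<lambda>v. v /\<^sub>R h)) (at y)"
      by (auto intro!: derivative_eq_intros)
    from has_derivative_compose[OF this gderiv_K[unfolded gderiv_def]] show ?thesis .
  qed
  have "(kde K h n xs has_derivative (\<lambda>v. 1 / (real n * h ^ DIM('a)) * (\<Sum>i<n. (v /\<^sub>R h) \<bullet> grad K ((y - xs i) /\<^sub>R h)))) (at y)"
    unfolding kde_def by (intro has_derivative_mult_right has_derivative_sum one)
  also have "(\<lambda>v. 1 / (real n * h ^ DIM('a)) * (\<Sum>i<n. (v /\<^sub>R h) \<bullet> grad K ((y - xs i) /\<^sub>R h))) = (\<lambda>v. v \<bullet> ?G)"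
    using h by (simp add: fun_eq_iff inner_sum_right sum_distrib_left divide_inverse mult_ac)
  finally show gd: "GDERIV (kde K h n xs) y :> ?G" by (simp add: gderiv_def)
  thus "grad (kde K h n xs) y = ?G" by (rule GDERIV_imp_grad)
qed

lemma deriv_grad_kde:
  assumes h: "0 < h"
  shows "(grad (kde K h n xs) has_derivative
    (\<lambda>v. (1 / (real n * h ^ (DIM('a) + 2))) *\<^sub>R (\<Sum>i<n. hess K ((y - xs i) /\<^sub>R h) v))) (at y)"
proof -
  have one: "((\<lambda>x. grad K ((x - xs i) /\<^sub>R h)) has_derivative (\<lambda>v. hess K ((y - xs i) /\<^sub>R h) (v /\<^sub>R h))) (at y)" for i
  proof -
    have "((\<lambda>x. (x - xs i) /\<^sub>R h) has_derivative (\<lambda>v. v /\<^sub>R h)) (at y)"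
      by (auto intro!: derivative_eq_intros)
    from has_derivative_compose[OF this deriv_grad_K] show ?thesis .
  qed
  have "grad (kde K h n xs) = (\<lambda>x. (1 / (real n * h ^ (DIM('a) + 1))) *\<^sub>R (\<Sum>i<n. grad K ((x - xs i) /\<^sub>R h)))"
    using grad_kde(2)[OF h] by (simp add: fun_eq_iff)
  moreover have "((\<lambda>x. (1 / (real n * h ^ (DIM('a) + 1))) *\<^sub>R (\<Sum>i<n. grad K ((x - xs i) /\<^sub>R h))) has_derivative
      (\<lambda>v. (1 / (real n * h ^ (DIM('a) + 1))) *\<^sub>R (\<Sum>i<n. hess K ((y - xs i) /\<^sub>R h) (v /\<^sub>R h)))) (at y)"
    by (intro has_derivative_scaleR_right has_derivative_sum one)
  moreover have "(\<lambda>v. (1 / (real n * h ^ (DIM('a) + 1))) *\<^sub>R (\<Sum>i<n. hess K ((y - xs i) /\<^sub>R h) (v /\<^sub>R h)))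
    = (\<lambda>v. (1 / (real n * h ^ (DIM('a) + 2))) *\<^sub>R (\<Sum>i<n. hess K ((y - xs i) /\<^sub>R h) v))"
    using h by (simp add: fun_eq_iff blinfun.scaleR_right scaleR_sum_right[symmetric] divide_inverse mult_ac)
  ultimately show ?thesis by simp
qed

text \<open>The constant is uniform in the sample; it diverges as h tends to 0 but is polynomial in
  1/h, which is what a polynomial grid for the gradient needs.\<close>

lemma lipschitz_gradient_kde:
  assumes h: "0 < h" and n: "0 < n"
  shows "lipschitz_gradient (kde K h n xs) (lip_K / h ^ (DIM('a) + 2))"
proof
  show "GDERIV (kde K h n xs) x :> grad (kde K h n xs) x" for x
    using grad_kde[OF h] by metis
  show "0 < lip_K / h ^ (DIM('a) + 2)" using lip_K(1) h by simp
  fix x y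
  have "norm (\<Sum>i<n. grad K ((x - xs i) /\<^sub>R h) - grad K ((y - xs i) /\<^sub>R h)) \<le> (\<Sum>i<n. lip_K * (norm (x - y) / h))"
  proof (rule sum_norm_le)
    fix i
    have "(x - xs i) /\<^sub>R h - (y - xs i) /\<^sub>R h = (x - y) /\<^sub>R h" by (simp add: scaleR_diff_right[symmetric])
    thus "norm (grad K ((x - xs i) /\<^sub>R h) - grad K ((y - xs i) /\<^sub>R h)) \<le> lip_K * (norm (x - y) / h)"
      using lip_K(3)[of "(x - xs i) /\<^sub>R h" "(y - xs i) /\<^sub>R h"] norm_scaled[OF h, of "x - y"] by simp
  qed
  also have "\<dots> = real n * (lip_K * (norm (x - y) / h))" by simp
  finally have le: "norm (\<Sum>i<n. grad K ((x - xs i) /\<^sub>R h) - grad K ((y - xs i) /\<^sub>R h)) \<le> real n * (lip_K * (norm (x - y) / h))" .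
  have "norm (grad (kde K h n xs) x - grad (kde K h n xs) y)
      = (1 / (real n * h ^ (DIM('a) + 1))) * norm (\<Sum>i<n. grad K ((x - xs i) /\<^sub>R h) - grad K ((y - xs i) /\<^sub>R h))"
    unfolding grad_kde(2)[OF h] using h by (simp add: scaleR_diff_right[symmetric] sum_subtractf)
  also have "\<dots> \<le> (1 / (real n * h ^ (DIM('a) + 1))) * (real n * (lip_K * (norm (x - y) / h)))"
    using le h by (intro mult_left_mono) auto
  also have "\<dots> = lip_K / h ^ (DIM('a) + 2) * norm (x - y)" using n h by (simp add: divide_inverse)
  finally show "norm (grad (kde K h n xs) x - grad (kde K h n xs) y) \<le> lip_K / h ^ (DIM('a) + 2) * norm (x - y)" .
qed

text \<open>The kernel is negative definite at a maximum of \<open>K + \<epsilon> |x|\<^sup>2\<close> interior to the support, so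
  its gradient has a Lipschitz inverse nearby.\<close>

lemma grad_K_expands:
  obtains u0 r0 \<epsilon> where "0 < r0" "0 < \<epsilon>"
    "\<And>u u'. u \<in> ball u0 r0 \<Longrightarrow> u' \<in> ball u0 r0 \<Longrightarrow> \<epsilon> * norm (u - u') \<le> norm (grad K u - grad K u')"
proof -
  have "\<exists>x1. 0 < K x1"
  proof (rule ccontr)
    assume "\<not> (\<exists>x1. 0 < K x1)"
    hence "K x = 0" for x using nonneg[of x] by (metis order_le_less)
    thus False using integral_K by simp
  qed
  then obtain x1 where x1: "0 < K x1" ..
  \<comment> \<open>Off the support the added parabola stays below \<open>K x1\<close> on the whole
    ball of radius \<rho> + 1, so the maximum lies in the support; the extra 1 leaves a unit ball
    around it, which makes it a local maximum.\<close>
  define \<epsilon> where "\<epsilon> = K x1 / (2 * (\<rho> + 1)\<^sup>2)"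
  have \<epsilon>: "0 < \<epsilon>" "\<epsilon> * (\<rho> + 1)\<^sup>2 < K x1" using x1 \<rho>_pos by (auto simp: \<epsilon>_def field_simps add_pos_pos)
  define k where "k x = K x + \<epsilon> * (x \<bullet> x)" for x
  have gk: "GDERIV k x :> grad K x + (2 * \<epsilon>) *\<^sub>R x" for x
  proof -
    have "(k has_derivative (\<lambda>h. h \<bullet> grad K x + \<epsilon> * (x \<bullet> h + h \<bullet> x))) (at x)"
      unfolding k_def
      by (intro has_derivative_add has_derivative_mult_right has_derivative_inner has_derivative_ident
          gderiv_K[unfolded gderiv_def])
    also have "(\<lambda>h. h \<bullet> grad K x + \<epsilon> * (x \<bullet> h + h \<bullet> x)) = (\<lambda>h. h \<bullet> (grad K x + (2 * \<epsilon>) *\<^sub>R x))"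
      by (simp add: fun_eq_iff inner_add_right inner_commute)
    finally show ?thesis by (simp add: gderiv_def)
  qed
  hence gradk: "grad k = (\<lambda>x. grad K x + (2 * \<epsilon>) *\<^sub>R x)" using GDERIV_imp_grad by blast
  have contk: "continuous_on S k" for S
    unfolding k_def by (intro continuous_intros continuous_K)
  have "cball 0 (\<rho> + 1) \<noteq> ({} :: 'a set)" using \<rho>_pos by simp
  then obtain u0 :: 'a where u0: "u0 \<in> cball 0 (\<rho> + 1)" "\<And>x. x \<in> cball 0 (\<rho> + 1) \<Longrightarrow> k x \<le> k u0"
    using continuous_attains_sup[OF compact_cball _ contk] by metis
  have "x1 \<in> cball 0 \<rho>" using x1 supp_K by force
  hence "k x1 \<le> k u0" using u0(2)[of x1] by simp
  moreover have "K x1 \<le> k x1" using \<epsilon> by (simp add: k_def)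
  ultimately have big: "K x1 \<le> k u0" by simp
  have u0in: "u0 \<in> cball 0 \<rho>"
  proof (rule ccontr)
    assume "u0 \<notin> cball 0 \<rho>"
    hence "k u0 = \<epsilon> * (norm u0)\<^sup>2" using supp_K by (simp add: k_def power2_norm_eq_inner)
    also have "\<dots> \<le> \<epsilon> * (\<rho> + 1)\<^sup>2" using u0(1) \<epsilon> by (intro mult_left_mono power_mono) auto
    finally show False using big \<epsilon> by linarith
  qed
  have mode: "is_mode k u0"
    unfolding is_mode_def
  proof (intro exI[of _ 1] conjI ballI)
    fix y assume "y \<in> ball u0 1"
    hence "norm y \<le> \<rho> + 1" using u0in norm_triangle_sub[of y u0] by (simp add: dist_norm norm_minus_commute)
    thus "k y \<le> k u0" using u0(2) by simp
  qed simp
  have d2: "(grad k has_derivative (\<lambda>v. hess K u0 v + (2 * \<epsilon>) *\<^sub>R v)) (at u0)"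
    unfolding gradk by (intro has_derivative_add deriv_grad_K has_derivative_scaleR_right has_derivative_ident)
  have d1: "GDERIV k x :> grad k x" for x using gk gradk by simp
  have np: "(hess K u0 v + (2 * \<epsilon>) *\<^sub>R v) \<bullet> v \<le> 0" for v
    by (rule max_imp_second_derivative_nonpos[OF d1 d2 mode])
  have neg: "hess K u0 v \<bullet> v \<le> - (2 * \<epsilon> * (norm v)\<^sup>2)" for v
    using np[of v] by (simp add: inner_add_left power2_norm_eq_inner)
  \<comment> \<open>Half of the definiteness at \<open>u0\<close> is traded for a neighbourhood;
    there the gradient is strongly monotone and therefore expanding.\<close>
  have "isCont (hess K) u0" using continuous_hess_K by (simp add: continuous_on_eq_continuous_at)
  then obtain r0 where r0: "0 < r0" "\<And>u. dist u u0 < r0 \<Longrightarrow> dist (hess K u) (hess K u0) < \<epsilon>"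
    using \<epsilon>(1) unfolding continuous_at_eps_delta by metis
  have neg': "hess K u v \<bullet> v \<le> - (\<epsilon> * (norm v)\<^sup>2)" if "u \<in> ball u0 r0" for u v
  proof -
    have "(hess K u - hess K u0) v \<bullet> v \<le> norm ((hess K u - hess K u0) v) * norm v" by (rule norm_cauchy_schwarz)
    also have "\<dots> \<le> (norm (hess K u - hess K u0) * norm v) * norm v" by (intro mult_right_mono norm_blinfun) simp
    also have "\<dots> \<le> (\<epsilon> * norm v) * norm v"
      using r0(2)[of u] that by (intro mult_right_mono) (auto simp: dist_norm norm_minus_commute)
    finally show ?thesis
      using neg[of v] by (simp add: blinfun.diff_left inner_diff_left power2_eq_square mult.assoc)
  qed
  show ?thesis
  proof (rule that[OF r0(1) \<epsilon>(1)])
    fix u u' assume u: "u \<in> ball u0 r0" "u' \<in> ball u0 r0"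
    have "(grad K u - grad K u') \<bullet> (u - u') \<le> - (\<epsilon> * (norm (u - u'))\<^sup>2)"
      by (rule strongly_concave_gradient[OF deriv_grad_K convex_ball[of u0 r0] neg' u])
    hence "\<epsilon> * (norm (u - u'))\<^sup>2 \<le> norm (grad K u - grad K u') * norm (u - u')"
      using Cauchy_Schwarz_ineq2[of "grad K u - grad K u'" "u - u'"] by linarith
    thus "\<epsilon> * norm (u - u') \<le> norm (grad K u - grad K u')"
      by (cases "u = u'") (auto simp: power2_eq_square mult.assoc[symmetric])
  qed
qed

end

subsection \<open>Events of probability tending to one\<close>

lemma with_probability_mono:
  assumes "with_probability_tending_to_one M E" "\<And>n \<omega>. E n \<omega> \<Longrightarrow> E' n \<omega>"
  shows "with_probability_tending_to_one M E'"
  using assms unfolding with_probability_tending_to_one_def by metis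

context prob_space
begin

lemma with_probability_complement:
  assumes "\<forall>\<^sub>F n in sequentially. \<exists>B\<in>events. prob B \<le> q n \<and> (\<forall>\<omega>\<in>space M - B. E n \<omega>)"
    and q: "q \<longlonglongrightarrow> 0"
  shows "with_probability_tending_to_one M E"
proof -
  obtain N where N: "\<And>n. n \<ge> N \<Longrightarrow> \<exists>B\<in>events. prob B \<le> q n \<and> (\<forall>\<omega>\<in>space M - B. E n \<omega>)"
    using assms(1) unfolding eventually_sequentially by blast
  then obtain B where B: "\<And>n. n \<ge> N \<Longrightarrow> B n \<in> events \<and> prob (B n) \<le> q n \<and> (\<forall>\<omega>\<in>space M - B n. E n \<omega>)"
    by metis
  \<comment> \<open>The finitely many early indices get the empty event, so that nothing has to be
    shown for them.\<close>
  define A where "A n = (if N \<le> n then space M - B n else {})" for n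
  have lim: "(\<lambda>n. prob (A n)) \<longlonglongrightarrow> 1"
  proof (rule tendsto_sandwich)
    show "\<forall>\<^sub>F n in sequentially. 1 - q n \<le> prob (A n)"
    proof (rule eventually_sequentiallyI[of N])
      fix n assume "N \<le> n"
      thus "1 - q n \<le> prob (A n)" using B[of n] by (simp add: A_def prob_compl)
    qed
    show "\<forall>\<^sub>F n in sequentially. prob (A n) \<le> 1" by simp
    show "(\<lambda>n. 1 - q n) \<longlonglongrightarrow> 1" using tendsto_diff[OF tendsto_const[of 1] q] by simp
  qed simp
  show ?thesis unfolding with_probability_tending_to_one_def
  proof (intro exI[of _ A] conjI allI ballI lim)
    show "A n \<in> events" for n using B[of n] by (auto simp: A_def)
    show "E n \<omega>" if "\<omega> \<in> A n" for n \<omega> using B[of n] that by (auto simp: A_def split: if_splits)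
  qed
qed

lemma with_probability_conj:
  assumes "with_probability_tending_to_one M E" "with_probability_tending_to_one M E'"
  shows "with_probability_tending_to_one M (\<lambda>n \<omega>. E n \<omega> \<and> E' n \<omega>)"
proof -
  obtain A where A: "\<And>n. A n \<in> events" "\<And>n \<omega>. \<omega> \<in> A n \<Longrightarrow> E n \<omega>" "(\<lambda>n. prob (A n)) \<longlonglongrightarrow> 1"
    using assms(1) unfolding with_probability_tending_to_one_def by blast
  obtain A' where A': "\<And>n. A' n \<in> events" "\<And>n \<omega>. \<omega> \<in> A' n \<Longrightarrow> E' n \<omega>" "(\<lambda>n. prob (A' n)) \<longlonglongrightarrow> 1"
    using assms(2) unfolding with_probability_tending_to_one_def by blast
  show ?thesis
  proof (rule with_probability_complement)
    show "\<forall>\<^sub>F n in sequentially. \<exists>B\<in>events. prob B \<le> (1 - prob (A n)) + (1 - prob (A' n)) \<and> (\<forall>\<omega>\<in>space M - B. E n \<omega> \<and> E' n \<omega>)"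
    proof (rule always_eventually, intro allI bexI[of _ "(space M - A _) \<union> (space M - A' _)"] conjI ballI)
      fix n
      show "prob ((space M - A n) \<union> (space M - A' n)) \<le> (1 - prob (A n)) + (1 - prob (A' n))"
        using measure_Un_le[of "space M - A n" M "space M - A' n"] A(1)[of n] A'(1)[of n]
        by (simp add: prob_compl)
      show "(space M - A n) \<union> (space M - A' n) \<in> events" using A(1) A'(1) by auto
    qed (use A(2) A'(2) in auto)
    have "(\<lambda>n. (1 - prob (A n)) + (1 - prob (A' n))) \<longlonglongrightarrow> (1 - 1) + (1 - 1)"
      by (intro tendsto_intros A A')
    thus "(\<lambda>n. (1 - prob (A n)) + (1 - prob (A' n))) \<longlonglongrightarrow> 0" by simp
  qed
qed

lemma prob_Union_le:
  assumes "finite S" "\<And>s. s \<in> S \<Longrightarrow> A s \<in> events" "\<And>s. s \<in> S \<Longrightarrow> prob (A s) \<le> q"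
  shows "prob (\<Union>s\<in>S. A s) \<le> real (card S) * q"
proof -
  have "prob (\<Union>s\<in>S. A s) \<le> (\<Sum>s\<in>S. prob (A s))"
    using assms by (intro finite_measure_subadditive_finite) auto
  also have "\<dots> \<le> (\<Sum>s\<in>S. q)" using assms(3) by (rule sum_mono)
  finally show ?thesis by simp
qed

text \<open>Conditioning on \<open>Y\<close>, only the section of \<open>Q\<close> at \<open>Y\<close> matters.\<close>

lemma prob_indep_section_le:
  assumes ind: "indep_var N Y N' Z" and [measurable]: "A \<in> sets N"
    and Q: "Q \<in> sets (N \<Otimes>\<^sub>M N')" and q: "\<And>y. y \<in> space N \<Longrightarrow> prob {\<omega>\<in>space M. (y, Z \<omega>) \<in> Q} \<le> q" and q0: "0 \<le> q"
  shows "prob {\<omega>\<in>space M. Y \<omega> \<in> A \<and> (Y \<omega>, Z \<omega>) \<in> Q} \<le> prob {\<omega>\<in>space M. Y \<omega> \<in> A} * q"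
proof -
  have rv [measurable]: "random_variable N Y" "random_variable N' Z"
    using ind indep_var_rv1 indep_var_rv2 by blast+
  interpret Y: prob_space "distr M N Y" by (rule prob_space_distr) fact
  interpret Z: prob_space "distr M N' Z" by (rule prob_space_distr) fact
  have joint: "distr M N Y \<Otimes>\<^sub>M distr M N' Z = distr M (N \<Otimes>\<^sub>M N') (\<lambda>\<omega>. (Y \<omega>, Z \<omega>))"
    using ind by (simp add: indep_var_distribution_eq)
  define Q' where "Q' = Q \<inter> (A \<times> space N')"
  have Q' [measurable]: "Q' \<in> sets (N \<Otimes>\<^sub>M N')" unfolding Q'_def using Q by auto
  have Q'2: "Q' \<in> sets (distr M N Y \<Otimes>\<^sub>M distr M N' Z)" using Q' by (simp add: joint)
  have "{\<omega>\<in>space M. Y \<omega> \<in> A \<and> (Y \<omega>, Z \<omega>) \<in> Q} = (\<lambda>\<omega>. (Y \<omega>, Z \<omega>)) -` Q' \<inter> space M"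
    using measurable_space[OF rv(2)] by (auto simp: Q'_def)
  hence "emeasure M {\<omega>\<in>space M. Y \<omega> \<in> A \<and> (Y \<omega>, Z \<omega>) \<in> Q} = emeasure (distr M N Y \<Otimes>\<^sub>M distr M N' Z) Q'"
    unfolding joint by (simp add: emeasure_distr)
  also have "\<dots> = (\<integral>\<^sup>+y. emeasure (distr M N' Z) (Pair y -` Q') \<partial>distr M N Y)"
    by (rule Z.emeasure_pair_measure_alt[OF Q'2])
  also have "\<dots> \<le> (\<integral>\<^sup>+y. ennreal q * indicator A y \<partial>distr M N Y)"
  proof (rule nn_integral_mono)
    fix y assume "y \<in> space (distr M N Y)"
    hence y: "y \<in> space N" by simp
    show "emeasure (distr M N' Z) (Pair y -` Q') \<le> ennreal q * indicator A y"
    proof (cases "y \<in> A")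
      case True
      have sec: "Pair y -` Q' \<in> sets N'" using Q' by (rule sets_Pair1)
      have "emeasure (distr M N' Z) (Pair y -` Q') = emeasure M (Z -` (Pair y -` Q') \<inter> space M)"
        using sec by (simp add: emeasure_distr)
      also have "Z -` (Pair y -` Q') \<inter> space M = {\<omega>\<in>space M. (y, Z \<omega>) \<in> Q}"
        using True measurable_space[OF rv(2)] by (auto simp: Q'_def)
      also have "emeasure M \<dots> = ennreal (prob {\<omega>\<in>space M. (y, Z \<omega>) \<in> Q})" by (rule emeasure_eq_measure)
      finally show ?thesis using q[OF y] True by (simp add: ennreal_leI)
    next
      case False
      hence "Pair y -` Q' = {}" by (auto simp: Q'_def)
      thus ?thesis by simp
    qed
  qed
  also have "\<dots> = ennreal q * emeasure (distr M N Y) A" by (simp add: nn_integral_cmult_indicator)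
  also have "emeasure (distr M N Y) A = ennreal (prob {\<omega>\<in>space M. Y \<omega> \<in> A})"
    by (simp add: emeasure_distr emeasure_eq_measure vimage_def Int_def conj_commute)
  finally show ?thesis using q0
    by (simp add: emeasure_eq_measure ennreal_mult[symmetric] mult.commute)
qed

end

locale kde_sample = density_sample M X f F + compact_kernel K \<rho>
  for M :: "'w measure" and X :: "nat \<Rightarrow> 'w \<Rightarrow> 'a::euclidean_space" and f :: "'a \<Rightarrow> real" and F :: real
    and K :: "'a \<Rightarrow> real" and \<rho> :: real +
  fixes h :: "nat \<Rightarrow> real"
  assumes gderiv_f: "GDERIV f x :> grad f x"
    and deriv_grad_f: "(grad f has_derivative blinfun_apply (hess f x)) (at x)"
    and grad_f_le: "norm (grad f x) \<le> F" and hess_f_le: "norm (hess f x) \<le> F"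
    and lip_grad_f: "norm (grad f x - grad f y) \<le> F * norm (x - y)"
    and uc_hess_f: "uniformly_continuous_on UNIV (hess f)"
    and h_pos: "0 < h n" and h_lim: "h \<longlonglongrightarrow> 0"
    and h_rate: "(\<lambda>n. ln (real n) / (real n * h n ^ (DIM('a) + 4))) \<longlonglongrightarrow> 0"
begin

abbreviation "g n \<omega> \<equiv> kde K (h n) n (\<lambda>i. X i \<omega>)"

subsection \<open>Consequences of the bandwidth condition\<close>

lemma eventually_h_le: "0 < e \<Longrightarrow> \<forall>\<^sub>F n in sequentially. h n \<le> e"
  using order_tendstoD(2)[OF h_lim, of e] by (auto elim: eventually_mono)

lemma eventually_rate: 
  assumes "0 < e"
  shows "\<forall>\<^sub>F n in sequentially. ln (real n) \<le> e * (real n * h n ^ (DIM('a) + 4))"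
  using order_tendstoD(2)[OF h_rate assms] eventually_gt_at_top[of 0]
proof eventually_elim
  case (elim n)
  thus ?case using h_pos[of n] by (simp add: pos_divide_less_eq less_imp_le)
qed

text \<open>Makes every polynomial in 1/h a polynomial in n. The threshold 3 exceeds e, so that ln n
  >= 1.\<close>

lemma eventually_inverse_h_le: "\<forall>\<^sub>F n in sequentially. 1 / h n \<le> real n"
  using eventually_rate[OF zero_less_one] eventually_ge_at_top[of 3] eventually_h_le[OF zero_less_one]
proof eventually_elim
  case (elim n)
  have "1 \<le> ln (real n)"
  proof -
    have "exp 1 \<le> real n" using exp_le elim(2) by linarith
    thus ?thesis using elim(2) by (subst ln_ge_iff) auto
  qed
  hence "1 \<le> real n * h n ^ (DIM('a) + 4)" using elim by simp
  also have "h n ^ (DIM('a) + 4) \<le> h n ^ 1" using elim(3) h_pos[of n] by (intro power_decreasing) auto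
  hence "real n * h n ^ (DIM('a) + 4) \<le> real n * h n" by (simp add: mult_left_mono)
  finally show ?case using h_pos[of n] by (simp add: divide_le_eq)
qed

text \<open>Used to make the contribution of a single observation to a Hessian entry
  negligible.\<close>

lemma eventually_nh_ge: "\<forall>\<^sub>F n in sequentially. Q \<le> real n * h n ^ (DIM('a) + 2)"
proof -
  have "filterlim (\<lambda>n. ln (real n)) at_top sequentially"
    by (rule filterlim_compose[OF ln_at_top filterlim_real_sequentially])
  hence "\<forall>\<^sub>F n in sequentially. Q \<le> ln (real n)" by (simp add: filterlim_at_top)
  thus ?thesis using eventually_rate[OF zero_less_one] eventually_h_le[OF zero_less_one]
  proof eventually_elim
    case (elim n)
    have "h n ^ (DIM('a) + 4) \<le> h n ^ (DIM('a) + 2)" using elim(3) h_pos[of n] by (intro power_decreasing) auto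
    hence "real n * h n ^ (DIM('a) + 4) \<le> real n * h n ^ (DIM('a) + 2)" by (simp add: mult_left_mono)
    thus ?case using elim by linarith
  qed
qed

text \<open>Under the bandwidth condition c n h^(d+4) eventually exceeds (m + 1) ln n, so the
  exponential beats n^m with a factor 1/n to spare. All union bounds below are brought to this
  form.\<close>

lemma poly_exp_tendsto:
  assumes c: "0 < c"
  shows "(\<lambda>n. C * real n ^ m * exp (- (c * (real n * h n ^ (DIM('a) + 4))))) \<longlonglongrightarrow> 0"
proof (rule Lim_null_comparison)
  have cm: "0 < c / (real m + 1)" using c by (simp add: add_nonneg_pos)
  show "\<forall>\<^sub>F n in sequentially. norm (C * real n ^ m * exp (- (c * (real n * h n ^ (DIM('a) + 4))))) \<le> \<bar>C\<bar> / real n"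
    using eventually_rate[OF cm] eventually_gt_at_top[of 0]
  proof eventually_elim
    case (elim n)
    hence "ln (real n) \<le> c * (real n * h n ^ (DIM('a) + 4)) / (real m + 1)" by simp
    hence "ln (real n) * (real m + 1) \<le> c * (real n * h n ^ (DIM('a) + 4))"
      by (simp add: pos_le_divide_eq add_nonneg_pos)
    hence "exp (- (c * (real n * h n ^ (DIM('a) + 4)))) \<le> exp (- (ln (real n) * (real m + 1)))" by simp
    also have "\<dots> = 1 / real n ^ (m + 1)"
    proof -
      have "exp (ln (real n) * (real m + 1)) = exp (ln (real n)) ^ (m + 1)"
        by (simp add: exp_of_nat_mult[symmetric] algebra_simps exp_add)
      thus ?thesis using elim by (simp add: exp_minus divide_inverse)
    qed
    finally have le: "exp (- (c * (real n * h n ^ (DIM('a) + 4)))) \<le> 1 / real n ^ (m + 1)" .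
    have "norm (C * real n ^ m * exp (- (c * (real n * h n ^ (DIM('a) + 4))))) = \<bar>C\<bar> * real n ^ m * exp (- (c * (real n * h n ^ (DIM('a) + 4))))"
      by (simp add: abs_mult)
    also have "\<dots> \<le> \<bar>C\<bar> * real n ^ m * (1 / real n ^ (m + 1))" using le by (intro mult_left_mono) auto
    also have "\<dots> = \<bar>C\<bar> / real n" using elim by simp
    finally show ?case .
  qed
  show "(\<lambda>n. \<bar>C\<bar> / real n) \<longlonglongrightarrow> 0" by (rule lim_const_over_n)
qed

subsection \<open>Uniform consistency of the gradient\<close>

lemma measurable_kernel_sum:
  fixes \<phi> :: "'a \<Rightarrow> 'b::{second_countable_topology, real_normed_vector}"
  assumes "continuous_on UNIV \<phi>"
  shows "(\<lambda>\<omega>. \<Sum>i\<in>I. \<phi> ((y - X i \<omega>) /\<^sub>R r)) \<in> borel_measurable M"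
proof -
  have [measurable]: "\<phi> \<in> borel_measurable borel" using assms by (rule borel_measurable_continuous_onI)
  show ?thesis by measurable
qed

lemma exp_power_mono:
  assumes "0 < r" "r \<le> 1" "0 < c" "k \<le> l"
  shows "exp (- (c * (real n * r ^ k))) \<le> exp (- (c * (real n * r ^ l)))"
  using assms by (simp add: mult_left_mono power_decreasing)

lemma eventually_gradient_bias:
  assumes t: "0 < t"
  shows "\<forall>\<^sub>F n in sequentially. \<forall>y. \<forall>b\<in>Basis.
    \<bar>(\<integral>x. f x * (grad K ((y - x) /\<^sub>R h n) \<bullet> b) \<partial>lborel) - h n ^ (DIM('a) + 1) * (grad f y \<bullet> b)\<bar> \<le> h n ^ (DIM('a) + 1) * t"
proof -
  have tF: "0 < t / (F * \<rho>)" using t F_pos \<rho>_pos by simp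
  show ?thesis using eventually_h_le[OF tF]
  proof eventually_elim
    case (elim n)
    have cf: "continuous_on UNIV (grad f)"
      using deriv_grad_f by (meson continuous_at_imp_continuous_on has_derivative_continuous)
    show ?case
    proof (intro allI ballI)
      fix y b :: 'a assume b: "b \<in> Basis"
      have w: "\<bar>grad f (y - u) \<bullet> b - grad f y \<bullet> b\<bar> \<le> t" if u: "norm u \<le> h n * \<rho>" for u
      proof -
        have "\<bar>grad f (y - u) \<bullet> b - grad f y \<bullet> b\<bar> \<le> norm (grad f (y - u) - grad f y) * norm b"
          unfolding inner_diff_left[symmetric] by (rule Cauchy_Schwarz_ineq2)
        also have "\<dots> \<le> F * norm u" using lip_grad_f[of "y - u" y] b by simp
        also have "\<dots> \<le> F * (h n * \<rho>)" using u F_pos by simp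
        also have "\<dots> \<le> t" using elim F_pos \<rho>_pos by (simp add: pos_le_divide_eq mult_ac)
        finally show ?thesis .
      qed
      have "\<bar>f x\<bar> \<le> F" for x using f_le f_nonneg by simp
      from bias_grad[OF h_pos gderiv_f cf this grad_f_le w, of n]
      show "\<bar>(\<integral>x. f x * (grad K ((y - x) /\<^sub>R h n) \<bullet> b) \<partial>lborel) - h n ^ (DIM('a) + 1) * (grad f y \<bullet> b)\<bar> \<le> h n ^ (DIM('a) + 1) * t"
        by (simp add: mult.commute)
    qed
  qed
qed

text \<open>At a grid point each coordinate splits into a random deviation and a bias, t/2 each,
  which sum to \<epsilon>/4 over the coordinates. Moving from the grid point to y costs \<epsilon>/2
  more, by the Lipschitz bounds for the estimate and for f.\<close>

lemma gradient_consistent: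
  assumes \<epsilon>: "0 < \<epsilon>"
  shows "with_probability_tending_to_one M (\<lambda>n \<omega>. \<forall>y\<in>cball 0 R. norm (grad (g n \<omega>) y - grad f y) \<le> \<epsilon>)"
proof -
  define d where "d = DIM('a)"
  have d: "0 < d" by (simp add: d_def)
  define t where "t = \<epsilon> / (4 * real d)"
  have t: "0 < t" using \<epsilon> d by (simp add: t_def)
  define \<phi> where "\<phi> b u = grad K u \<bullet> b" for b u :: 'a
  have \<phi>: "continuous_on UNIV (\<phi> b)" "x \<notin> cball 0 \<rho> \<Longrightarrow> \<phi> b x = 0" for b x
    unfolding \<phi>_def by (auto intro!: continuous_intros continuous_grad_K simp: supp_grad_K)
  have "\<exists>c>0. exp_deviation (\<phi> b) (t / 2) c" for b
  proof -
    obtain B where "0 < B" "\<And>x. norm (\<phi> b x) \<le> B"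
      using continuous_support_bounded[of "\<phi> b" 0 \<rho>] \<phi> by metis
    thus ?thesis using \<phi> \<rho>_pos t by (intro deviation[of "\<phi> b" B \<rho>]) auto
  qed
  then obtain c' where c': "\<And>b. 0 < c' b" "\<And>b. exp_deviation (\<phi> b) (t / 2) (c' b)" by metis
  define c where "c = Min (c' ` Basis)"
  have c: "0 < c" "\<And>b. b \<in> Basis \<Longrightarrow> c \<le> c' b" using c'(1) by (auto simp: c_def)
  obtain C where C: "1 \<le> C" "\<And>\<delta>. 0 < \<delta> \<Longrightarrow> \<delta> \<le> 1 \<Longrightarrow>
    \<exists>S. finite S \<and> real (card S) \<le> (C / \<delta>) ^ DIM('a) \<and> (\<forall>x\<in>cball (0 :: 'a) R. \<exists>s\<in>S. dist x s \<le> \<delta>)"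
    using cball_grid by blast
  define \<kappa> where "\<kappa> = min 1 (\<epsilon> / (2 * (lip_K + F)))"
  have LF: "0 < lip_K + F" using lip_K(1) F_pos by simp
  have \<kappa>: "0 < \<kappa>" "\<kappa> \<le> 1" "(lip_K + F) * \<kappa> \<le> \<epsilon> / 2"
  proof -
    show "0 < \<kappa>" "\<kappa> \<le> 1" using LF \<epsilon> by (auto simp: \<kappa>_def)
    have "\<kappa> \<le> \<epsilon> / (2 * (lip_K + F))" by (simp add: \<kappa>_def)
    thus "(lip_K + F) * \<kappa> \<le> \<epsilon> / 2" using LF by (simp add: pos_le_divide_eq mult_ac)
  qed
  define q where "q n = (2 * real d * (C / \<kappa>) ^ d) * real n ^ ((d + 2) * d) * exp (- (c * (real n * h n ^ (DIM('a) + 4))))" for n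
  show ?thesis
  proof (rule with_probability_complement[of q])
    show "q \<longlonglongrightarrow> 0" unfolding q_def by (rule poly_exp_tendsto[OF c(1)])
    have t2: "0 < t / 2" using t by simp
    show "\<forall>\<^sub>F n in sequentially. \<exists>B\<in>events. prob B \<le> q n \<and> (\<forall>\<omega>\<in>space M - B. \<forall>y\<in>cball 0 R. norm (grad (g n \<omega>) y - grad f y) \<le> \<epsilon>)"
      using eventually_gradient_bias[OF t2] eventually_inverse_h_le eventually_h_le[OF zero_less_one] eventually_gt_at_top[of 0]
    proof eventually_elim
      case (elim n)
      note hp = h_pos[of n]
      \<comment> \<open>The Lipschitz constant of the estimate is at most lip_K n^(d+2), since 1/h
        <= n; this mesh compensates for it, with only polynomially many grid points.\<close>
      define \<delta> where "\<delta> = \<kappa> / real n ^ (d + 2)"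
      have np: "1 \<le> real n ^ (d + 2)" using elim(4) by (intro one_le_power) simp
      have \<delta>: "0 < \<delta>" "\<delta> \<le> 1" using \<kappa> np elim by (auto simp: \<delta>_def divide_le_eq)
      obtain S where S: "finite S" "real (card S) \<le> (C / \<delta>) ^ d" "\<And>x. x \<in> cball (0 :: 'a) R \<Longrightarrow> \<exists>s\<in>S. dist x s \<le> \<delta>"
        using C(2)[OF \<delta>] by (auto simp: d_def)
      define D where "D sb = {\<omega>\<in>space M. real n * h n ^ (DIM('a) + 1) * (t / 2) \<le>
        \<bar>\<Sum>i<n. \<phi> (snd sb) ((fst sb - X i \<omega>) /\<^sub>R h n) - (\<integral>x. f x * \<phi> (snd sb) ((fst sb - x) /\<^sub>R h n) \<partial>lborel)\<bar>}" for sb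
      define B where "B = (\<Union>sb\<in>S \<times> Basis. D sb)"
      have D_ev: "D sb \<in> events" for sb
      proof -
        have [measurable]: "(\<lambda>\<omega>. \<Sum>i<n. \<phi> (snd sb) ((fst sb - X i \<omega>) /\<^sub>R h n)) \<in> borel_measurable M"
          by (rule measurable_kernel_sum) (rule \<phi>)
        show ?thesis unfolding D_def sum_subtractf by measurable
      qed
      have D_le: "prob (D sb) \<le> 2 * exp (- (c * (real n * h n ^ (DIM('a) + 4))))" if "sb \<in> S \<times> Basis" for sb
      proof -
        have b: "snd sb \<in> Basis" using that by auto
        have "prob (D sb) \<le> 2 * exp (- (c' (snd sb) * (real n * h n ^ (DIM('a) + 2 * 1))))"
          unfolding D_def by (rule c'(2)[unfolded exp_deviation_def, rule_format]) (use elim hp in auto)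
        also have "\<dots> \<le> 2 * exp (- (c * (real n * h n ^ (DIM('a) + 2 * 1))))"
          using c(2)[OF b] hp by (simp add: mult_right_mono)
        also have "\<dots> \<le> 2 * exp (- (c * (real n * h n ^ (DIM('a) + 4))))"
          using exp_power_mono[OF hp elim(3) c(1), of "DIM('a) + 2 * 1" "DIM('a) + 4" n] by simp
        finally show ?thesis .
      qed
      have "prob B \<le> real (card (S \<times> (Basis :: 'a set))) * (2 * exp (- (c * (real n * h n ^ (DIM('a) + 4)))))"
        unfolding B_def using S(1) by (intro prob_Union_le D_ev D_le) auto
      also have "\<dots> = real (card S) * (real d * (2 * exp (- (c * (real n * h n ^ (DIM('a) + 4))))))"
        by (simp add: card_cartesian_product d_def)
      also have "\<dots> \<le> (C / \<delta>) ^ d * (real d * (2 * exp (- (c * (real n * h n ^ (DIM('a) + 4))))))"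
        using S(2) by (intro mult_right_mono) auto
      also have "(C / \<delta>) ^ d = (C / \<kappa>) ^ d * real n ^ ((d + 2) * d)"
      proof -
        have "C / \<delta> = (C / \<kappa>) * real n ^ (d + 2)" by (simp add: \<delta>_def)
        thus ?thesis by (simp only: power_mult_distrib power_mult)
      qed
      finally have PB: "prob B \<le> q n" by (simp add: q_def mult_ac)
      have "norm (grad (g n \<omega>) y - grad f y) \<le> \<epsilon>" if \<omega>: "\<omega> \<in> space M - B" and y: "y \<in> cball 0 R" for \<omega> y
      proof -
        obtain s where s: "s \<in> S" "dist y s \<le> \<delta>" using S(3)[OF y] by blast
        have coord: "\<bar>(grad (g n \<omega>) s - grad f s) \<bullet> b\<bar> \<le> t" if b: "b \<in> Basis" for b
        proof -
          define \<mu> where "\<mu> = (\<integral>x. f x * \<phi> b ((s - x) /\<^sub>R h n) \<partial>lborel)"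
          define \<Sigma> where "\<Sigma> = (\<Sum>i<n. \<phi> b ((s - X i \<omega>) /\<^sub>R h n) - \<mu>)"
          define P where "P = real n * h n ^ (DIM('a) + 1)"
          have P: "0 < P" using elim hp by (simp add: P_def)
          have "\<omega> \<notin> D (s, b)" using \<omega> s b by (auto simp: B_def)
          hence dev: "\<bar>\<Sigma>\<bar> \<le> P * (t / 2)" using \<omega> by (simp add: D_def \<Sigma>_def \<mu>_def P_def not_le less_imp_le)
          have bias: "\<bar>\<mu> - h n ^ (DIM('a) + 1) * (grad f s \<bullet> b)\<bar> \<le> h n ^ (DIM('a) + 1) * (t / 2)"
            using elim(1) b by (simp add: \<mu>_def \<phi>_def)
          hence bias': "\<bar>real n * (\<mu> - h n ^ (DIM('a) + 1) * (grad f s \<bullet> b))\<bar> \<le> P * (t / 2)"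
            unfolding abs_mult P_def mult.assoc by (intro mult_mono) auto
          have "P * ((grad (g n \<omega>) s - grad f s) \<bullet> b) = (\<Sum>i<n. \<phi> b ((s - X i \<omega>) /\<^sub>R h n)) - P * (grad f s \<bullet> b)"
          proof -
            have "grad (g n \<omega>) s = (1 / P) *\<^sub>R (\<Sum>i<n. grad K ((s - X i \<omega>) /\<^sub>R h n))"
              unfolding P_def by (rule grad_kde(2)[OF hp])
            hence "P * (grad (g n \<omega>) s \<bullet> b) = (\<Sum>i<n. \<phi> b ((s - X i \<omega>) /\<^sub>R h n))"
              using P by (simp add: inner_sum_left \<phi>_def)
            thus ?thesis by (simp add: inner_diff_left right_diff_distrib)
          qed
          also have "\<dots> = \<Sigma> + real n * (\<mu> - h n ^ (DIM('a) + 1) * (grad f s \<bullet> b))"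
            by (simp add: \<Sigma>_def sum_subtractf P_def algebra_simps)
          finally have "\<bar>P * ((grad (g n \<omega>) s - grad f s) \<bullet> b)\<bar> \<le> P * t"
            using dev bias' abs_triangle_ineq[of \<Sigma> "real n * (\<mu> - h n ^ (DIM('a) + 1) * (grad f s \<bullet> b))"]
            by linarith
          thus ?thesis using P by (simp add: abs_mult)
        qed
        have "norm (grad (g n \<omega>) s - grad f s) \<le> (\<Sum>b\<in>Basis. \<bar>(grad (g n \<omega>) s - grad f s) \<bullet> b\<bar>)" by (rule norm_le_l1)
        also have "\<dots> \<le> (\<Sum>b\<in>(Basis :: 'a set). t)" by (rule sum_mono) (rule coord)
        also have "\<dots> = \<epsilon> / 4" using d by (simp add: t_def d_def)
        finally have at_s: "norm (grad (g n \<omega>) s - grad f s) \<le> \<epsilon> / 4" .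
        interpret lg: lipschitz_gradient "g n \<omega>" "lip_K / h n ^ (DIM('a) + 2)"
          by (rule lipschitz_gradient_kde[OF hp]) (use elim in simp)
        have "1 / h n ^ (DIM('a) + 2) = (1 / h n) ^ (d + 2)" by (simp add: power_divide d_def power_one_over)
        also have "\<dots> \<le> real n ^ (d + 2)" using elim(2) hp by (intro power_mono) auto
        finally have hn: "1 / h n ^ (DIM('a) + 2) \<le> real n ^ (d + 2)" .
        have "norm (grad (g n \<omega>) y - grad (g n \<omega>) s) \<le> lip_K * (1 / h n ^ (DIM('a) + 2)) * norm (y - s)" using lg.lip[of y s] by simp
        also have "\<dots> \<le> lip_K * real n ^ (d + 2) * \<delta>"
          using hn s(2) lip_K(1) hp by (intro mult_mono) (auto simp: dist_norm)
        also have "\<dots> = lip_K * \<kappa>" using elim(4) by (simp add: \<delta>_def)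
        finally have g1: "norm (grad (g n \<omega>) y - grad (g n \<omega>) s) \<le> lip_K * \<kappa>" .
        have "norm (grad f y - grad f s) \<le> F * norm (y - s)" by (rule lip_grad_f)
        also have "\<dots> \<le> F * \<kappa>"
        proof (rule mult_left_mono)
          have "\<delta> \<le> \<kappa>" using np \<kappa> unfolding \<delta>_def by (simp add: divide_le_eq mult_le_cancel_left1)
          thus "norm (y - s) \<le> \<kappa>" using s(2) by (simp add: dist_norm)
        qed (use F_pos in simp)
        finally have g2: "norm (grad f y - grad f s) \<le> F * \<kappa>" .
        have "grad (g n \<omega>) y - grad f y = (grad (g n \<omega>) y - grad (g n \<omega>) s) + (grad (g n \<omega>) s - grad f s) - (grad f y - grad f s)"
          by simp
        hence "norm (grad (g n \<omega>) y - grad f y) \<le> norm (grad (g n \<omega>) y - grad (g n \<omega>) s) + norm (grad (g n \<omega>) s - grad f s) + norm (grad f y - grad f s)"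
          by (metis norm_add_diff_le)
        also have "\<dots> \<le> lip_K * \<kappa> + \<epsilon> / 4 + F * \<kappa>" using g1 g2 at_s by linarith
        also have "\<dots> \<le> \<epsilon>" using \<kappa>(3) \<epsilon> by (simp add: distrib_right)
        finally show ?thesis .
      qed
      moreover have "B \<in> events" unfolding B_def using S(1) D_ev by (intro sets.finite_UN) auto
      ultimately show ?case using PB by blast
    qed
  qed
qed

subsection \<open>Nondegeneracy of the critical points of the estimate\<close>

text \<open>The window condition says that \<open>X i\<close> lies in a ball of radius h r0 about y
  - h u0. Such a ball has probability of order h^d wherever f is bounded below, so missing it n
  times has probability exp(-c n h^d).\<close>

lemma sample_point_in_window:
  assumes r0: "0 < r0" and r: "0 \<le> r" "r < r1" and m: "0 < m" "\<And>x. x \<in> cball p r1 \<Longrightarrow> m \<le> f x"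
  shows "with_probability_tending_to_one M (\<lambda>n \<omega>. \<forall>y\<in>cball p r. \<exists>i<n. (y - X i \<omega>) /\<^sub>R h n \<in> ball u0 r0)"
proof -
  define d where "d = DIM('a)"
  obtain C where C: "1 \<le> C" "\<And>\<delta>. 0 < \<delta> \<Longrightarrow> \<delta> \<le> 1 \<Longrightarrow>
    \<exists>S. finite S \<and> real (card S) \<le> (C / \<delta>) ^ DIM('a) \<and> (\<forall>x\<in>cball p r. \<exists>s\<in>S. dist x s \<le> \<delta>)"
    using cball_grid by blast
  define \<kappa> where "\<kappa> = min 1 (r0 / 3)"
  have \<kappa>: "0 < \<kappa>" "\<kappa> \<le> 1" "\<kappa> \<le> r0 / 3" using r0 by (auto simp: \<kappa>_def)
  define c where "c = m * (unit_ball_vol (DIM('a)) * (r0 / 2) ^ d)"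
  have c: "0 < c" using m r0 by (simp add: c_def)
  define q where "q n = (C / \<kappa>) ^ d * real n ^ d * exp (- (c * (real n * h n ^ (DIM('a) + 4))))" for n
  show ?thesis
  proof (rule with_probability_complement[of q])
    show "q \<longlonglongrightarrow> 0" unfolding q_def by (rule poly_exp_tendsto[OF c])
    \<comment> \<open>The windows stick out of the ball by at most the grid error, at most h, the
      shift h |u0| and a radius below h r0; this must fit into the room up to r1.\<close>
    have "0 < (r1 - r) / (1 + norm u0 + r0)" using r r0 by (simp add: add_pos_nonneg)
    from eventually_h_le[OF this] eventually_inverse_h_le eventually_h_le[OF zero_less_one] eventually_gt_at_top[of 0]
    show "\<forall>\<^sub>F n in sequentially. \<exists>B\<in>events. prob B \<le> q n \<and>
        (\<forall>\<omega>\<in>space M - B. \<forall>y\<in>cball p r. \<exists>i<n. (y - X i \<omega>) /\<^sub>R h n \<in> ball u0 r0)"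
    proof eventually_elim
      case (elim n)
      note hp = h_pos[of n]
      have room: "h n * (1 + norm u0 + r0) \<le> r1 - r"
        using elim(1) r0 by (simp add: pos_le_divide_eq add_pos_nonneg)
      define \<delta> where "\<delta> = \<kappa> / real n"
      have \<delta>: "0 < \<delta>" "\<delta> \<le> 1" using \<kappa> elim(4) by (auto simp: \<delta>_def divide_le_eq)
      have \<delta>h: "\<delta> \<le> \<kappa> * h n"
      proof -
        have "1 \<le> real n * h n" using elim(2) hp by (simp add: divide_le_eq)
        hence "\<kappa> * 1 \<le> \<kappa> * (real n * h n)" using \<kappa> by (intro mult_left_mono) auto
        thus ?thesis using elim(4) by (simp add: \<delta>_def divide_le_eq mult_ac)
      qed
      obtain S where S: "finite S" "real (card S) \<le> (C / \<delta>) ^ d" "\<And>x. x \<in> cball p r \<Longrightarrow> \<exists>s\<in>S. dist x s \<le> \<delta>"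
        using C(2)[OF \<delta>] by (auto simp: d_def)
      \<comment> \<open>The grid may contain points far from the ball, where f has no lower bound;
        they are dropped, and no point of the ball loses its neighbour.\<close>
      define S' where "S' = {s\<in>S. dist s p \<le> r + \<delta>}"
      \<comment> \<open>Half the radius at grid points, so that with \<delta> <= h r0 / 3 the full
        window at a nearby y still contains the observation.\<close>
      define W where "W s = ball (s - h n *\<^sub>R u0) (h n * (r0 / 2))" for s
      define D where "D s = {\<omega>\<in>space M. \<forall>i<n. X i \<omega> \<notin> W s}" for s
      define B where "B = (\<Union>s\<in>S'. D s)"
      have W_meas: "W s \<in> sets borel" for s by (simp add: W_def)
      have D_ev: "D s \<in> events" for s
      proof -
        have "D s = space M - (\<Union>i\<in>{..<n}. {\<omega>\<in>space M. X i \<omega> \<in> W s})" by (auto simp: D_def)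
        thus ?thesis using events_X[OF W_meas] by auto
      qed
      have D_le: "prob (D s) \<le> exp (- (c * (real n * h n ^ (DIM('a) + 4))))" if s: "s \<in> S'" for s
      proof -
        have fin: "emeasure lborel (W s) < \<infinity>" unfolding W_def by (rule emeasure_bounded_finite) simp
        have "m * measure lborel (W s) \<le> prob {\<omega>\<in>space M. X i \<omega> \<in> W s}" for i
        proof (rule prob_X_ge[OF W_meas fin m(2)])
          fix x assume "x \<in> W s"
          hence "norm (x - (s - h n *\<^sub>R u0)) \<le> h n * (r0 / 2)" by (simp add: W_def dist_norm norm_minus_commute)
          moreover have "x - p = (x - (s - h n *\<^sub>R u0)) + (s - p) - h n *\<^sub>R u0" by simp
          hence "norm (x - p) \<le> norm (x - (s - h n *\<^sub>R u0)) + norm (s - p) + norm (h n *\<^sub>R u0)"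
            by (metis norm_add_diff_le)
          moreover have "norm (s - p) \<le> r + \<delta>" using s by (simp add: S'_def dist_norm)
          moreover have "\<delta> \<le> h n" using \<delta>h \<kappa>(2) hp mult_right_mono[of \<kappa> 1 "h n"] by linarith
          moreover have "0 \<le> h n * (r0 / 2)" using hp r0 by simp
          ultimately have "norm (x - p) \<le> r + h n * (1 + norm u0 + r0)" using hp by (simp add: distrib_left)
          thus "x \<in> cball p r1" using room by (simp add: dist_norm norm_minus_commute)
        qed
        hence "prob (D s) \<le> exp (- (real n * (m * measure lborel (W s))))"
          unfolding D_def by (rule prob_none_le[OF W_meas])
        also have "m * measure lborel (W s) = c * h n ^ d"
        proof -
          have "measure lborel (W s) = unit_ball_vol (DIM('a)) * (h n * (r0 / 2)) ^ DIM('a)"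
            using hp r0 by (simp add: W_def content_ball)
          thus ?thesis unfolding power_mult_distrib c_def d_def by (simp only: mult_ac)
        qed
        also have "real n * (c * h n ^ d) = c * (real n * h n ^ DIM('a))" by (simp add: d_def)
        also have "exp (- \<dots>) \<le> exp (- (c * (real n * h n ^ (DIM('a) + 4))))"
          by (rule exp_power_mono[OF hp elim(3) c]) simp
        finally show ?thesis .
      qed
      have "prob B \<le> real (card S') * exp (- (c * (real n * h n ^ (DIM('a) + 4))))"
        unfolding B_def using S(1) by (intro prob_Union_le D_ev D_le) (auto simp: S'_def)
      also have "\<dots> \<le> (C / \<delta>) ^ d * exp (- (c * (real n * h n ^ (DIM('a) + 4))))"
      proof (rule mult_right_mono)
        have "card S' \<le> card S" using S(1) by (intro card_mono) (auto simp: S'_def)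
        thus "real (card S') \<le> (C / \<delta>) ^ d" using S(2) by linarith
      qed simp
      also have "(C / \<delta>) ^ d = (C / \<kappa>) ^ d * real n ^ d"
      proof -
        have "C / \<delta> = (C / \<kappa>) * real n" by (simp add: \<delta>_def)
        thus ?thesis by (simp only: power_mult_distrib)
      qed
      finally have PB: "prob B \<le> q n" by (simp add: q_def)
      have "\<exists>i<n. (y - X i \<omega>) /\<^sub>R h n \<in> ball u0 r0" if \<omega>: "\<omega> \<in> space M - B" and y: "y \<in> cball p r" for \<omega> y
      proof -
        obtain s where s: "s \<in> S" "dist y s \<le> \<delta>" using S(3)[OF y] by blast
        have "dist s p \<le> r + \<delta>" using s(2) y dist_triangle[of s p y] by (simp add: dist_commute)
        hence "\<omega> \<notin> D s" using \<omega> s by (auto simp: B_def S'_def)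
        then obtain i where i: "i < n" "X i \<omega> \<in> W s" using \<omega> by (auto simp: D_def)
        have "(y - X i \<omega>) /\<^sub>R h n - u0 = ((y - s) + (s - h n *\<^sub>R u0 - X i \<omega>)) /\<^sub>R h n"
          using hp by (simp add: scaleR_diff_right scaleR_add_right)
        hence "norm ((y - X i \<omega>) /\<^sub>R h n - u0) = norm ((y - s) + (s - h n *\<^sub>R u0 - X i \<omega>)) / h n"
          using norm_scaled[OF hp] by metis
        also have "\<dots> < r0"
        proof -
          have "norm ((y - s) + (s - h n *\<^sub>R u0 - X i \<omega>)) \<le> norm (y - s) + norm (s - h n *\<^sub>R u0 - X i \<omega>)"
            by (rule norm_triangle_ineq)
          also have "\<dots> < \<kappa> * h n + h n * (r0 / 2)" using s(2) \<delta>h i(2) by (simp add: W_def dist_norm)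
          also have "\<dots> \<le> (r0 / 3) * h n + h n * (r0 / 2)" using \<kappa>(3) hp by simp
          also have "\<dots> \<le> r0 * h n" using r0 hp by (simp add: field_simps)
          finally show ?thesis using hp by (simp add: divide_less_eq)
        qed
        finally show ?thesis using i(1) by (auto simp: dist_norm norm_minus_commute)
      qed
      moreover have "B \<in> events" unfolding B_def using S(1) D_ev by (intro sets.finite_UN) (auto simp: S'_def)
      ultimately show ?case using PB by blast
    qed
  qed
qed

lemma eventually_hessian_bias:
  assumes t: "0 < t"
  shows "\<forall>\<^sub>F n in sequentially. \<forall>y. \<forall>b\<in>Basis. \<forall>b'\<in>Basis.
    \<bar>(\<integral>x. f x * (hess K ((y - x) /\<^sub>R h n) b \<bullet> b') \<partial>lborel) - h n ^ (DIM('a) + 2) * (hess f y b' \<bullet> b)\<bar> \<le> h n ^ (DIM('a) + 2) * t"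
proof -
  obtain e where e: "0 < e" "\<And>x y. dist x y < e \<Longrightarrow> dist (hess f x) (hess f y) < t"
    using uc_hess_f t unfolding uniformly_continuous_on_def by (metis UNIV_I)
  have e\<rho>: "0 < e / (2 * \<rho>)" using e \<rho>_pos by simp
  show ?thesis using eventually_h_le[OF e\<rho>]
  proof eventually_elim
    case (elim n)
    show ?case
    proof (intro allI ballI)
      fix y b b' :: 'a assume b: "b \<in> Basis" "b' \<in> Basis"
      have w: "\<bar>hess f (y - u) b' \<bullet> b - hess f y b' \<bullet> b\<bar> \<le> t" if u: "norm u \<le> h n * \<rho>" for u
      proof -
        have "h n * \<rho> \<le> e / 2" using elim \<rho>_pos by (simp add: field_simps)
        hence "dist (y - u) y < e" using u e by (simp add: dist_norm)
        hence n: "norm (hess f (y - u) - hess f y) \<le> t" using e(2) by (simp add: dist_norm less_imp_le)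
        have "\<bar>hess f (y - u) b' \<bullet> b - hess f y b' \<bullet> b\<bar> = \<bar>(hess f (y - u) - hess f y) b' \<bullet> b\<bar>"
          by (simp add: blinfun.diff_left inner_diff_left)
        also have "\<dots> \<le> norm ((hess f (y - u) - hess f y) b') * norm b" by (rule Cauchy_Schwarz_ineq2)
        also have "\<dots> \<le> norm (hess f (y - u) - hess f y) * norm b'"
          using norm_blinfun[of "hess f (y - u) - hess f y" b'] b by simp
        finally show ?thesis using n b by simp
      qed
      have "\<bar>f x\<bar> \<le> F" for x using f_le f_nonneg by simp
      from bias_hess[OF h_pos gderiv_f deriv_grad_f uniformly_continuous_imp_continuous[OF uc_hess_f] this grad_f_le hess_f_le w, of n]
      show "\<bar>(\<integral>x. f x * (hess K ((y - x) /\<^sub>R h n) b \<bullet> b') \<partial>lborel) - h n ^ (DIM('a) + 2) * (hess f y b' \<bullet> b)\<bar> \<le> h n ^ (DIM('a) + 2) * t"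
        by (simp add: mult.commute)
    qed
  qed
qed

text \<open>Entrywise errors are what deviation bounds provide; there are d^2 of them, and each
  coordinate of v is at most |v|.\<close>

lemma quadratic_form_entries:
  fixes E :: "'b::euclidean_space \<Rightarrow> 'b"
  assumes "linear E" and le: "\<And>b b'. b \<in> Basis \<Longrightarrow> b' \<in> Basis \<Longrightarrow> \<bar>E b \<bullet> b'\<bar> \<le> e"
  shows "E v \<bullet> v \<le> (real DIM('b))\<^sup>2 * e * (norm v)\<^sup>2"
proof -
  have "E v = E (\<Sum>b\<in>Basis. (v \<bullet> b) *\<^sub>R b)" by (simp add: euclidean_representation)
  also have "\<dots> = (\<Sum>b\<in>Basis. (v \<bullet> b) *\<^sub>R E b)" using assms(1) by (simp add: linear_sum linear_scale)
  finally have "E v \<bullet> v = (\<Sum>b\<in>Basis. (v \<bullet> b) * (E b \<bullet> v))" by (simp add: inner_sum_left)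
  also have "\<dots> = (\<Sum>b\<in>Basis. (v \<bullet> b) * (\<Sum>b'\<in>Basis. (E b \<bullet> b') * (v \<bullet> b')))"
    by (subst (2) euclidean_inner) (rule refl)
  also have "\<dots> \<le> (\<Sum>b\<in>(Basis :: 'b set). norm v * (real DIM('b) * (e * norm v)))"
  proof (rule sum_mono)
    fix b :: 'b assume b: "b \<in> Basis"
    have "\<bar>\<Sum>b'\<in>Basis. (E b \<bullet> b') * (v \<bullet> b')\<bar> \<le> (\<Sum>b'\<in>(Basis :: 'b set). e * norm v)"
    proof (rule order_trans[OF sum_abs sum_mono])
      fix b' :: 'b assume b': "b' \<in> Basis"
      show "\<bar>(E b \<bullet> b') * (v \<bullet> b')\<bar> \<le> e * norm v"
        unfolding abs_mult using le[OF b b'] Basis_le_norm[OF b', of v] by (intro mult_mono) auto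
    qed
    hence inner: "\<bar>\<Sum>b'\<in>Basis. (E b \<bullet> b') * (v \<bullet> b')\<bar> \<le> real DIM('b) * (e * norm v)" by simp
    have "(v \<bullet> b) * (\<Sum>b'\<in>Basis. (E b \<bullet> b') * (v \<bullet> b')) \<le> \<bar>v \<bullet> b\<bar> * \<bar>\<Sum>b'\<in>Basis. (E b \<bullet> b') * (v \<bullet> b')\<bar>"
      by (metis abs_ge_self abs_mult)
    also have "\<dots> \<le> norm v * (real DIM('b) * (e * norm v))"
      using inner Basis_le_norm[OF b, of v] by (intro mult_mono) auto
    finally show "(v \<bullet> b) * (\<Sum>b'\<in>Basis. (E b \<bullet> b') * (v \<bullet> b')) \<le> norm v * (real DIM('b) * (e * norm v))" .
  qed
  also have "\<dots> = (real DIM('b))\<^sup>2 * e * (norm v)\<^sup>2" by (simp add: power2_eq_square)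
  finally show ?thesis .
qed

text \<open>The sum over all other observations is independent of \<open>X i\<close>; given its gradient part, the estimate
  has a small gradient at \<open>s\<close> only if \<open>X i\<close> lies in a small ball, because \<open>grad K\<close> is expanding
  on the window.\<close>

lemma prob_small_gradient_and_deviation:
  fixes \<phi> :: "'a \<Rightarrow> real"
  assumes exp: "\<And>u u'. u \<in> ball u0 r0 \<Longrightarrow> u' \<in> ball u0 r0 \<Longrightarrow> \<epsilon> * norm (u - u') \<le> norm (grad K u - grad K u')"
    and \<epsilon>: "0 < \<epsilon>" and \<phi>: "continuous_on UNIV \<phi>" and r: "0 < r" and \<sigma>: "0 \<le> \<sigma>" and i: "i < n"
  shows "{\<omega>\<in>space M. (s - X i \<omega>) /\<^sub>R r \<in> ball u0 r0 \<and> norm (\<Sum>l<n. grad K ((s - X l \<omega>) /\<^sub>R r)) \<le> \<sigma> \<and>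
        a \<le> \<bar>\<Sum>l\<in>{..<n} - {i}. \<phi> ((s - X l \<omega>) /\<^sub>R r) - \<mu>\<bar>} \<in> events" (is "?E \<in> events")
    and "prob {\<omega>\<in>space M. (s - X i \<omega>) /\<^sub>R r \<in> ball u0 r0 \<and> norm (\<Sum>l<n. grad K ((s - X l \<omega>) /\<^sub>R r)) \<le> \<sigma> \<and>
        a \<le> \<bar>\<Sum>l\<in>{..<n} - {i}. \<phi> ((s - X l \<omega>) /\<^sub>R r) - \<mu>\<bar>}
      \<le> prob {\<omega>\<in>space M. a \<le> \<bar>\<Sum>l\<in>{..<n} - {i}. \<phi> ((s - X l \<omega>) /\<^sub>R r) - \<mu>\<bar>}
         * (F * (unit_ball_vol (DIM('a)) * (2 * r * \<sigma> / \<epsilon>) ^ DIM('a)))"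
proof -
  define I where "I = {..<n} - {i}"
  have [measurable]: "grad K \<in> borel_measurable borel" "\<phi> \<in> borel_measurable borel"
    using continuous_grad_K \<phi> by (auto intro: borel_measurable_continuous_onI)
  define V :: "(nat \<Rightarrow> 'a) \<Rightarrow> 'a" where "V z = (\<Sum>l\<in>I. grad K ((s - z l) /\<^sub>R r))" for z
  define U :: "(nat \<Rightarrow> 'a) \<Rightarrow> real" where "U z = (\<Sum>l\<in>I. \<phi> ((s - z l) /\<^sub>R r) - \<mu>)" for z
  define N where "N = PiM I (\<lambda>_. borel :: 'a measure)"
  define N' where "N' = PiM {i} (\<lambda>_. borel :: 'a measure)"
  define Y where "Y \<omega> = restrict (\<lambda>l. X l \<omega>) I" for \<omega>
  define Z where "Z \<omega> = restrict (\<lambda>l. X l \<omega>) {i}" for \<omega>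
  have Z [simp]: "Z \<omega> i = X i \<omega>" for \<omega> by (simp add: Z_def)
  have Y [simp]: "V (Y \<omega>) = (\<Sum>l\<in>I. grad K ((s - X l \<omega>) /\<^sub>R r))" "U (Y \<omega>) = (\<Sum>l\<in>I. \<phi> ((s - X l \<omega>) /\<^sub>R r) - \<mu>)" for \<omega>
    by (simp_all add: Y_def V_def U_def)
  have ind: "indep_var N Y N' Z"
    unfolding N_def N'_def Y_def[abs_def] Z_def[abs_def]
    by (rule indep_var_restrict[OF indep]) (auto simp: I_def)
  have rv: "random_variable N Y" "random_variable N' Z" using ind indep_var_rv1 indep_var_rv2 by blast+
  have [measurable]: "V \<in> borel_measurable N" "U \<in> borel_measurable N" "(\<lambda>z. z i) \<in> borel_measurable N'"
    unfolding V_def U_def N_def N'_def by measurable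
  define A where "A = {z\<in>space N. a \<le> \<bar>U z\<bar>}"
  have A: "A \<in> sets N" unfolding A_def by measurable
  \<comment> \<open>The Hessian deviation depends on the first block only and becomes the set
    \<open>A\<close>; the window and the small gradient are the conditions that still involve
    \<open>X i\<close>.\<close>
  define Q where "Q = {zw\<in>space (N \<Otimes>\<^sub>M N'). norm ((s - snd zw i) /\<^sub>R r - u0) < r0 \<and>
      norm (V (fst zw) + grad K ((s - snd zw i) /\<^sub>R r)) \<le> \<sigma>}"
  have Q: "Q \<in> sets (N \<Otimes>\<^sub>M N')" unfolding Q_def by measurable
  have split: "(\<Sum>l<n. grad K ((s - X l \<omega>) /\<^sub>R r)) = (\<Sum>l\<in>I. grad K ((s - X l \<omega>) /\<^sub>R r)) + grad K ((s - X i \<omega>) /\<^sub>R r)" for \<omega>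
    using i unfolding I_def by (subst sum.remove[of _ i]) (auto simp: add.commute)
  have spY: "Y \<omega> \<in> space N" "Z \<omega> \<in> space N'" if "\<omega> \<in> space M" for \<omega>
    using that measurable_space[OF rv(1)] measurable_space[OF rv(2)] by blast+
  have memQ: "(z, Z \<omega>) \<in> Q \<longleftrightarrow> norm ((s - X i \<omega>) /\<^sub>R r - u0) < r0 \<and> norm (V z + grad K ((s - X i \<omega>) /\<^sub>R r)) \<le> \<sigma>"
    if "z \<in> space N" "\<omega> \<in> space M" for z \<omega>
    using that spY by (simp add: Q_def space_pair_measure)
  have eq: "?E = {\<omega>\<in>space M. Y \<omega> \<in> A \<and> (Y \<omega>, Z \<omega>) \<in> Q}"
    unfolding split I_def[symmetric] using memQ[OF spY(1)] spY(1)
    by (auto simp: A_def dist_norm norm_minus_commute)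
  have "{\<omega>\<in>space M. Y \<omega> \<in> A \<and> (Y \<omega>, Z \<omega>) \<in> Q} = (Y -` A \<inter> space M) \<inter> ((\<lambda>\<omega>. (Y \<omega>, Z \<omega>)) -` Q \<inter> space M)" by auto
  also have "\<dots> \<in> events" using measurable_sets[OF rv(1) A] measurable_sets[OF measurable_Pair[OF rv] Q] by auto
  finally show "?E \<in> events" unfolding eq .
  define q where "q = F * (unit_ball_vol (DIM('a)) * (2 * r * \<sigma> / \<epsilon>) ^ DIM('a))"
  have q0: "0 \<le> q" using F_pos r \<sigma> \<epsilon> by (simp add: q_def)
  have sec: "prob {\<omega>\<in>space M. (z, Z \<omega>) \<in> Q} \<le> q" if z: "z \<in> space N" for z
  proof -
    define G where "G = {x. norm ((s - x) /\<^sub>R r - u0) < r0 \<and> norm (V z + grad K ((s - x) /\<^sub>R r)) \<le> \<sigma>}"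
    have eqG: "{\<omega>\<in>space M. (z, Z \<omega>) \<in> Q} = {\<omega>\<in>space M. X i \<omega> \<in> G}" using memQ[OF z] by (auto simp: G_def)
    show ?thesis
    proof (cases "G = {}")
      case False
      \<comment> \<open>No centre is known in advance, but any point of \<open>G\<close> will do:
        the contribution \<open>V z\<close> of the other observations cancels in the difference, so
        two points of \<open>G\<close> have gradients of K within 2 \<sigma> and, by expansion, are
        close themselves.\<close>
      then obtain x1 where x1: "x1 \<in> G" by blast
      have sub: "x \<in> cball x1 (2 * r * \<sigma> / \<epsilon>)" if x: "x \<in> G" for x
      proof -
        define u u1 where "u = (s - x) /\<^sub>R r" and "u1 = (s - x1) /\<^sub>R r"
        have "u \<in> ball u0 r0" "u1 \<in> ball u0 r0" using x x1 by (auto simp: G_def u_def u1_def dist_norm norm_minus_commute)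
        hence "\<epsilon> * norm (u - u1) \<le> norm (grad K u - grad K u1)" by (rule exp)
        also have "grad K u - grad K u1 = (V z + grad K u) - (V z + grad K u1)" by simp
        also have "norm \<dots> \<le> norm (V z + grad K u) + norm (V z + grad K u1)" by (rule norm_triangle_ineq4)
        also have "\<dots> \<le> \<sigma> + \<sigma>" using x x1 by (intro add_mono) (simp_all add: G_def u_def u1_def)
        finally have "norm (u - u1) \<le> 2 * \<sigma> / \<epsilon>" using \<epsilon> by (simp add: pos_le_divide_eq mult.commute)
        moreover have "u - u1 = (x1 - x) /\<^sub>R r" by (simp add: u_def u1_def scaleR_diff_right)
        hence "norm (u - u1) = norm (x1 - x) / r" using norm_scaled[OF r] by metis
        ultimately have "norm (x1 - x) \<le> (2 * \<sigma> / \<epsilon>) * r" using r by (simp add: pos_divide_le_eq)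
        also have "\<dots> = 2 * r * \<sigma> / \<epsilon>" by simp
        finally show ?thesis by (simp add: dist_norm)
      qed
      have "prob {\<omega>\<in>space M. X i \<omega> \<in> G} \<le> prob {\<omega>\<in>space M. X i \<omega> \<in> cball x1 (2 * r * \<sigma> / \<epsilon>)}"
        using sub by (intro finite_measure_mono events_X) auto
      also have "\<dots> \<le> F * measure lborel (cball x1 (2 * r * \<sigma> / \<epsilon>))"
        using emeasure_bounded_finite[OF bounded_cball, of x1 "2 * r * \<sigma> / \<epsilon>"] by (intro prob_X_le) auto
      also have "\<dots> = q" using r \<sigma> \<epsilon> by (simp add: q_def content_cball)
      finally show ?thesis unfolding eqG .
    next
      case True
      thus ?thesis unfolding eqG using q0 by simp
    qed
  qed
  have "prob ?E \<le> prob {\<omega>\<in>space M. Y \<omega> \<in> A} * q"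
    unfolding eq by (rule prob_indep_section_le[OF ind A Q sec q0])
  also have "{\<omega>\<in>space M. Y \<omega> \<in> A} = {\<omega>\<in>space M. a \<le> \<bar>\<Sum>l\<in>{..<n} - {i}. \<phi> ((s - X l \<omega>) /\<^sub>R r) - \<mu>\<bar>}"
    using spY(1) by (auto simp: A_def I_def[symmetric])
  finally show "prob ?E \<le> prob {\<omega>\<in>space M. a \<le> \<bar>\<Sum>l\<in>{..<n} - {i}. \<phi> ((s - X l \<omega>) /\<^sub>R r) - \<mu>\<bar>}
         * (F * (unit_ball_vol (DIM('a)) * (2 * r * \<sigma> / \<epsilon>) ^ DIM('a)))" unfolding q_def .
qed

text \<open>The mesh \<delta> may depend on n through the modulus of continuity of
  \<open>hess K\<close> without any rate. A grid of (C/\<delta>)^d points meets bad events of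
  probability proportional to \<delta>^d, and \<delta> cancels. The price is a factor n^d from the
  small balls and another n from the choice of the observation in the window.\<close>

lemma critical_points_nondegenerate:
  assumes exp: "\<And>u u'. u \<in> ball u0 r0 \<Longrightarrow> u' \<in> ball u0 r0 \<Longrightarrow> \<epsilon> * norm (u - u') \<le> norm (grad K u - grad K u')"
    and r0: "0 < r0" and \<epsilon>: "0 < \<epsilon>" and \<mu>: "0 < \<mu>"
    and neg: "\<And>x v. x \<in> cball p r \<Longrightarrow> hess f x v \<bullet> v \<le> - (\<mu> * (norm v)\<^sup>2)"
  shows "with_probability_tending_to_one M (\<lambda>n \<omega>. \<forall>i<n. \<forall>y\<in>cball p r.
    (y - X i \<omega>) /\<^sub>R h n \<in> ball u0 (r0 / 2) \<longrightarrow> grad (g n \<omega>) y = 0 \<longrightarrow>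
      (\<exists>H. (grad (g n \<omega>) has_derivative H) (at y) \<and> (\<forall>v. H v \<bullet> v \<le> - (\<mu> / 2 * (norm v)\<^sup>2))))"
proof -
  define d where "d = DIM('a)"
  have d: "0 < d" by (simp add: d_def)
  \<comment> \<open>Entry errors up to 4 t change the quadratic form by at most 4 t d^2 = \<mu>/2,
    half of the definiteness of f.\<close>
  define t where "t = \<mu> / (8 * (real d)\<^sup>2)"
  have t: "0 < t" using \<mu> d by (simp add: t_def)
  define \<phi> where "\<phi> bb u = hess K u (fst bb) \<bullet> snd bb" for bb :: "'a \<times> 'a" and u
  have \<phi>: "continuous_on UNIV (\<phi> bb)" "x \<notin> cball 0 \<rho> \<Longrightarrow> \<phi> bb x = 0" for bb x
    unfolding \<phi>_def by (auto intro!: continuous_intros continuous_hess_K simp: supp_hess_K)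
  have "\<exists>c>0. exp_deviation (\<phi> bb) t c" for bb
  proof -
    obtain B where "0 < B" "\<And>x. norm (\<phi> bb x) \<le> B"
      using continuous_support_bounded[of "\<phi> bb" 0 \<rho>] \<phi> by metis
    thus ?thesis using \<phi> \<rho>_pos t by (intro deviation[of "\<phi> bb" B \<rho>]) auto
  qed
  then obtain c' where c': "\<And>bb. 0 < c' bb" "\<And>bb. exp_deviation (\<phi> bb) t (c' bb)" by metis
  define BB where "BB = (Basis :: 'a set) \<times> (Basis :: 'a set)"
  have BB: "finite BB" "BB \<noteq> {}" "card BB = d * d" by (auto simp: BB_def d_def card_cartesian_product)
  define c where "c = Min (c' ` BB)"
  have c: "0 < c" "\<And>bb. bb \<in> BB \<Longrightarrow> c \<le> c' bb" using c'(1) BB by (auto simp: c_def)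
  obtain C where C: "1 \<le> C" "\<And>\<delta>. 0 < \<delta> \<Longrightarrow> \<delta> \<le> 1 \<Longrightarrow>
    \<exists>S. finite S \<and> real (card S) \<le> (C / \<delta>) ^ DIM('a) \<and> (\<forall>x\<in>cball p r. \<exists>s\<in>S. dist x s \<le> \<delta>)"
    using cball_grid by blast
  define V where "V = F * unit_ball_vol (DIM('a)) * (2 * lip_K / \<epsilon>) ^ d"
  define q where "q n = (2 * (real d)\<^sup>2 * C ^ d * V) * real n ^ (d + 1) * exp (- (c * (real n * h n ^ (DIM('a) + 4))))" for n
  have t2: "0 < t / 2" using t by simp
  obtain n0 :: nat where n0: "4 * (F + t) / t \<le> real n0" using real_arch_simple by blast
  show ?thesis
  proof (rule with_probability_complement[of q])
    show "q \<longlonglongrightarrow> 0" unfolding q_def by (rule poly_exp_tendsto[OF c(1)])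
    show "\<forall>\<^sub>F n in sequentially. \<exists>B\<in>events. prob B \<le> q n \<and> (\<forall>\<omega>\<in>space M - B. \<forall>i<n. \<forall>y\<in>cball p r.
      (y - X i \<omega>) /\<^sub>R h n \<in> ball u0 (r0 / 2) \<longrightarrow> grad (g n \<omega>) y = 0 \<longrightarrow>
        (\<exists>H. (grad (g n \<omega>) has_derivative H) (at y) \<and> (\<forall>v. H v \<bullet> v \<le> - (\<mu> / 2 * (norm v)\<^sup>2))))"
      using eventually_hessian_bias[OF t2] eventually_nh_ge[of "4 * lip_K / t"] eventually_h_le[OF zero_less_one]
        eventually_gt_at_top[of 0] eventually_ge_at_top[of n0]
    proof eventually_elim
      case (elim n)
      note hp = h_pos[of n]
      define N where "N = real n * h n ^ (DIM('a) + 2)"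
      have N: "0 < N" using elim(4) hp by (simp add: N_def)
      have lipN: "lip_K \<le> N * t / 4" using elim(2) t by (simp add: N_def pos_divide_le_eq mult.commute)
      have nF: "F + t \<le> real n * t / 4"
      proof -
        have "4 * (F + t) / t \<le> real n" using n0 elim(5) by linarith
        thus ?thesis using t by (simp add: pos_divide_le_eq)
      qed
      have th: "0 < t * h n ^ (DIM('a) + 2)" using t hp by simp
      obtain e1 where e1: "0 < e1" "\<And>u u'. dist u u' < e1 \<Longrightarrow> dist (hess K u) (hess K u') < t * h n ^ (DIM('a) + 2)"
        using continuous_support_uniformly_continuous[of "hess K" \<rho>, OF continuous_hess_K supp_hess_K] th
        unfolding uniformly_continuous_on_def by (metis UNIV_I)
      obtain e2 where e2: "0 < e2" "\<And>u u'. dist u u' < e2 \<Longrightarrow> dist (hess f u) (hess f u') < t"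
        using uc_hess_f t unfolding uniformly_continuous_on_def by (metis UNIV_I)
      \<comment> \<open>After the bound 1 for the grid: small oscillation of \<open>hess K\<close>,
        small oscillation of \<open>hess f\<close>, and a window at the grid point no larger than r0
        when y is in the half window.\<close>
      define \<delta> where "\<delta> = Min {1, h n * e1 / 2, e2 / 2, h n * r0 / 2}"
      have \<delta>: "0 < \<delta>" using e1 e2 r0 hp by (simp add: \<delta>_def)
      have \<delta>': "\<delta> \<le> 1" "\<delta> \<le> h n * e1 / 2" "\<delta> \<le> e2 / 2" "\<delta> \<le> h n * r0 / 2"
        unfolding \<delta>_def by (auto intro!: Min_le)
      obtain S where S: "finite S" "real (card S) \<le> (C / \<delta>) ^ d" "\<And>x. x \<in> cball p r \<Longrightarrow> \<exists>s\<in>S. dist x s \<le> \<delta>"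
        using C(2)[OF \<delta> \<delta>'(1)] by (auto simp: d_def)
      \<comment> \<open>If the gradient vanishes at y, this bounds the unnormalised gradient sum at
        a grid point within \<delta>.\<close>
      define \<sigma> where "\<sigma> = real n * lip_K * \<delta> / h n"
      have \<sigma>: "0 \<le> \<sigma>" using lip_K(1) \<delta> hp by (simp add: \<sigma>_def)
      define \<nu> where "\<nu> s bb = (\<integral>x. f x * \<phi> bb ((s - x) /\<^sub>R h n) \<partial>lborel)" for s bb
      define D where "D i s bb = {\<omega>\<in>space M. N * t \<le> \<bar>\<Sum>l\<in>{..<n} - {i}. \<phi> bb ((s - X l \<omega>) /\<^sub>R h n) - \<nu> s bb\<bar>}" for i s bb
      define E where "E i s bb = {\<omega>\<in>space M. (s - X i \<omega>) /\<^sub>R h n \<in> ball u0 r0 \<and>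
        norm (\<Sum>l<n. grad K ((s - X l \<omega>) /\<^sub>R h n)) \<le> \<sigma> \<and>
        N * t \<le> \<bar>\<Sum>l\<in>{..<n} - {i}. \<phi> bb ((s - X l \<omega>) /\<^sub>R h n) - \<nu> s bb\<bar>}" for i s bb
      have E_ev: "E i s bb \<in> events" if "i < n" for i s bb
        unfolding E_def by (rule prob_small_gradient_and_deviation(1)[OF exp \<epsilon> \<phi>(1) hp \<sigma> that])
      define e where "e = 2 * exp (- (c * (real n * h n ^ (DIM('a) + 4)))) * (V * real n ^ d * \<delta> ^ d)"
      have E_le: "prob (E i s bb) \<le> e" if i: "i < n" and bb: "bb \<in> BB" for i s bb
      proof -
        have "prob (E i s bb) \<le> prob (D i s bb) * (F * (unit_ball_vol (DIM('a)) * (2 * h n * \<sigma> / \<epsilon>) ^ DIM('a)))"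
          unfolding E_def D_def by (rule prob_small_gradient_and_deviation(2)[OF exp \<epsilon> \<phi>(1) hp \<sigma> i])
        also have "2 * h n * \<sigma> / \<epsilon> = (2 * lip_K / \<epsilon>) * real n * \<delta>" using hp by (simp add: \<sigma>_def)
        also have "F * (unit_ball_vol (DIM('a)) * ((2 * lip_K / \<epsilon>) * real n * \<delta>) ^ DIM('a)) = V * real n ^ d * \<delta> ^ d"
          unfolding power_mult_distrib V_def d_def by (simp only: mult_ac)
        also have "prob (D i s bb) * (V * real n ^ d * \<delta> ^ d) \<le> e"
          unfolding e_def
        proof (rule mult_right_mono)
          have "card ({..<n} - {i}) \<le> n" by (metis card_Diff_subset_Int card_lessThan diff_le_self finite_Int finite_lessThan)
          hence "prob (D i s bb) \<le> 2 * exp (- (c' bb * (real n * h n ^ (DIM('a) + 2 * 2))))"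
            unfolding D_def N_def \<nu>_def
            by (intro c'(2)[unfolded exp_deviation_def, rule_format]) (use elim hp in auto)
          also have "\<dots> \<le> 2 * exp (- (c * (real n * h n ^ (DIM('a) + 4))))"
            using c(2)[OF bb] hp by (simp add: mult_right_mono)
          finally show "prob (D i s bb) \<le> 2 * exp (- (c * (real n * h n ^ (DIM('a) + 4))))" .
          show "0 \<le> V * real n ^ d * \<delta> ^ d" using F_pos lip_K(1) \<epsilon> \<delta> by (simp add: V_def)
        qed
        finally show ?thesis .
      qed
      define IS where "IS = {..<n} \<times> S \<times> BB"
      define B where "B = (\<Union>(i, s, bb)\<in>IS. E i s bb)"
      have "prob B \<le> real (card IS) * e"
        unfolding B_def using S(1) BB by (intro prob_Union_le) (auto simp: IS_def intro: E_ev E_le)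
      also have "real (card IS) = real n * (real d)\<^sup>2 * real (card S)"
        by (simp add: IS_def card_cartesian_product BB power2_eq_square)
      also have "real n * (real d)\<^sup>2 * real (card S) * e \<le> real n * (real d)\<^sup>2 * (C / \<delta>) ^ d * e"
      proof (intro mult_right_mono mult_left_mono S(2))
        show "0 \<le> e" using F_pos lip_K(1) \<epsilon> \<delta> by (simp add: e_def V_def)
      qed simp_all
      \<comment> \<open>Here the powers of \<delta> from the number of grid points and from the
        small balls cancel.\<close>
      also have "\<dots> = q n"
        using \<delta> by (simp add: e_def q_def power_divide power_add)
      finally have PB: "prob B \<le> q n" .
      have B_ev: "B \<in> events" unfolding B_def using S(1) BB by (intro sets.finite_UN) (auto simp: IS_def intro: E_ev)
      have "\<exists>H. (grad (g n \<omega>) has_derivative H) (at y) \<and> (\<forall>v. H v \<bullet> v \<le> - (\<mu> / 2 * (norm v)\<^sup>2))"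
        if \<omega>: "\<omega> \<in> space M - B" and i: "i < n" and y: "y \<in> cball p r"
          and win: "(y - X i \<omega>) /\<^sub>R h n \<in> ball u0 (r0 / 2)" and crit: "grad (g n \<omega>) y = 0" for \<omega> i y
      proof -
        define H where "H v = (1 / N) *\<^sub>R (\<Sum>l<n. hess K ((y - X l \<omega>) /\<^sub>R h n) v)" for v
        have H: "(grad (g n \<omega>) has_derivative H) (at y)"
          unfolding H_def N_def by (rule deriv_grad_kde[OF hp])
        have entries: "\<bar>(H b - hess f y b) \<bullet> b'\<bar> \<le> 4 * t" if b: "b \<in> Basis" "b' \<in> Basis" for b b'
        proof (rule ccontr)
          assume "\<not> \<bar>(H b - hess f y b) \<bullet> b'\<bar> \<le> 4 * t"
          hence big: "4 * t < \<bar>(H b - hess f y b) \<bullet> b'\<bar>" by simp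
          obtain s where s: "s \<in> S" "dist y s \<le> \<delta>" using S(3)[OF y] by blast
          define A where "A x = (\<Sum>l<n. \<phi> (b, b') ((x - X l \<omega>) /\<^sub>R h n))" for x
          define T where "T x = hess f x b' \<bullet> b" for x
          have "hess f y b \<bullet> b' = T y"
            unfolding T_def by (rule second_derivative_symmetric[OF gderiv_f deriv_grad_f])
          moreover have "N * (H b \<bullet> b') = A y" using N by (simp add: H_def A_def \<phi>_def inner_sum_left)
          ultimately have "N * ((H b - hess f y b) \<bullet> b') = A y - N * T y"
            by (simp add: inner_diff_left right_diff_distrib)
          hence a1: "N * t * 4 < \<bar>A y - N * T y\<bar>"
            using mult_strict_left_mono[OF big N] N by (metis abs_mult abs_of_pos mult.assoc mult.commute)
          have a2: "\<bar>A y - A s\<bar> \<le> N * t"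
          proof -
            have "\<bar>A y - A s\<bar> = \<bar>\<Sum>l<n. \<phi> (b, b') ((y - X l \<omega>) /\<^sub>R h n) - \<phi> (b, b') ((s - X l \<omega>) /\<^sub>R h n)\<bar>"
              by (simp add: A_def sum_subtractf)
            also have "\<dots> \<le> (\<Sum>l<n. t * h n ^ (DIM('a) + 2))"
            proof (rule order_trans[OF sum_abs sum_mono])
              fix l
              define u u' where "u = (y - X l \<omega>) /\<^sub>R h n" and "u' = (s - X l \<omega>) /\<^sub>R h n"
              have "u - u' = (y - s) /\<^sub>R h n" by (simp add: u_def u'_def scaleR_diff_right)
              hence "norm (u - u') = norm (y - s) / h n" using norm_scaled[OF hp] by metis
              also have "\<dots> \<le> \<delta> / h n" using s(2) hp by (simp add: dist_norm divide_right_mono)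
              also have "\<dots> < e1" using \<delta>'(2) mult_pos_pos[OF hp e1(1)] hp by (simp add: pos_divide_less_eq mult.commute)
              finally have "dist (hess K u) (hess K u') < t * h n ^ (DIM('a) + 2)" using e1(2) by (simp add: dist_norm)
              hence nn: "norm (hess K u - hess K u') \<le> t * h n ^ (DIM('a) + 2)" by (simp add: dist_norm)
              have "\<bar>\<phi> (b, b') u - \<phi> (b, b') u'\<bar> = \<bar>(hess K u - hess K u') b \<bullet> b'\<bar>"
                by (simp add: \<phi>_def blinfun.diff_left inner_diff_left)
              also have "\<dots> \<le> norm ((hess K u - hess K u') b) * norm b'" by (rule Cauchy_Schwarz_ineq2)
              also have "\<dots> \<le> norm (hess K u - hess K u')" using norm_blinfun[of "hess K u - hess K u'" b] b by simp
              finally show "\<bar>\<phi> (b, b') ((y - X l \<omega>) /\<^sub>R h n) - \<phi> (b, b') ((s - X l \<omega>) /\<^sub>R h n)\<bar> \<le> t * h n ^ (DIM('a) + 2)"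
                using nn by (simp add: u_def u'_def)
            qed
            also have "\<dots> = N * t" by (simp add: N_def)
            finally show ?thesis .
          qed
          have a3: "\<bar>N * (T y - T s)\<bar> \<le> N * t"
          proof -
            have "dist y s < e2" using s(2) \<delta>'(3) e2(1) by linarith
            hence nn: "norm (hess f y - hess f s) \<le> t" using e2(2) by (simp add: dist_norm less_imp_le)
            have "\<bar>T y - T s\<bar> = \<bar>(hess f y - hess f s) b' \<bullet> b\<bar>" by (simp add: T_def blinfun.diff_left inner_diff_left)
            also have "\<dots> \<le> norm ((hess f y - hess f s) b') * norm b" by (rule Cauchy_Schwarz_ineq2)
            also have "\<dots> \<le> norm (hess f y - hess f s)" using norm_blinfun[of "hess f y - hess f s" b'] b by simp
            finally show ?thesis using nn N by (simp add: abs_mult)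
          qed
          have bias: "\<bar>\<nu> s (b, b') - h n ^ (DIM('a) + 2) * T s\<bar> \<le> h n ^ (DIM('a) + 2) * (t / 2)"
            using elim(1) b by (simp add: \<nu>_def \<phi>_def T_def)
          have a4: "\<bar>real n * \<nu> s (b, b') - N * T s\<bar> \<le> N * t / 2"
          proof -
            have "real n * \<nu> s (b, b') - N * T s = real n * (\<nu> s (b, b') - h n ^ (DIM('a) + 2) * T s)"
              by (simp add: N_def right_diff_distrib)
            hence "\<bar>real n * \<nu> s (b, b') - N * T s\<bar> = real n * \<bar>\<nu> s (b, b') - h n ^ (DIM('a) + 2) * T s\<bar>" by (simp add: abs_mult)
            also have "\<dots> \<le> real n * (h n ^ (DIM('a) + 2) * (t / 2))" using bias by (intro mult_left_mono) auto
            finally show ?thesis by (simp add: N_def)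
          qed
          have a5: "\<bar>\<nu> s (b, b')\<bar> \<le> N * t / 4"
          proof -
            have "\<bar>T s\<bar> \<le> norm (hess f s b') * norm b" unfolding T_def by (rule Cauchy_Schwarz_ineq2)
            also have "\<dots> \<le> norm (hess f s)" using norm_blinfun[of "hess f s" b'] b by simp
            finally have Ts: "\<bar>T s\<bar> \<le> F" using hess_f_le[of s] by simp
            have "\<bar>\<nu> s (b, b')\<bar> \<le> \<bar>h n ^ (DIM('a) + 2) * T s\<bar> + h n ^ (DIM('a) + 2) * (t / 2)" using bias by linarith
            also have "\<dots> = h n ^ (DIM('a) + 2) * (\<bar>T s\<bar> + t / 2)" using hp by (simp add: abs_mult distrib_left)
            also have "\<dots> \<le> h n ^ (DIM('a) + 2) * (real n * t / 4)"
              using Ts nF t hp by (intro mult_left_mono) auto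
            finally show ?thesis by (simp add: N_def mult_ac)
          qed
          have a6: "\<bar>\<phi> (b, b') ((s - X i \<omega>) /\<^sub>R h n)\<bar> \<le> N * t / 4"
            using hess_K_entry_le[OF b, of "(s - X i \<omega>) /\<^sub>R h n"] lipN by (simp add: \<phi>_def)
          \<comment> \<open>The observation in the window is removed, since the bad event measures
            the Hessian deviation on the others only.\<close>
          have "(\<Sum>l\<in>{..<n} - {i}. \<phi> (b, b') ((s - X l \<omega>) /\<^sub>R h n) - \<nu> s (b, b'))
            = (A s - real n * \<nu> s (b, b')) - (\<phi> (b, b') ((s - X i \<omega>) /\<^sub>R h n) - \<nu> s (b, b'))"
          proof -
            have "A s - real n * \<nu> s (b, b') = (\<Sum>l<n. \<phi> (b, b') ((s - X l \<omega>) /\<^sub>R h n) - \<nu> s (b, b'))"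
              by (simp add: A_def sum_subtractf)
            thus ?thesis using i by (simp add: sum_diff1)
          qed
          moreover have "A s - real n * \<nu> s (b, b') = (A y - N * T y) - (A y - A s) + N * (T y - T s) - (real n * \<nu> s (b, b') - N * T s)"
            by (simp add: right_diff_distrib)
          \<comment> \<open>In units of N t: more than 4 from the assumption, minus 1 for each of
            the two moves from y to s, 1/2 for the bias, and 1/4 each for the removed term and its
            mean.\<close>
          ultimately have dev: "N * t \<le> \<bar>\<Sum>l\<in>{..<n} - {i}. \<phi> (b, b') ((s - X l \<omega>) /\<^sub>R h n) - \<nu> s (b, b')\<bar>"
            using a1 a2 a3 a4 a5 a6 by linarith
          have window: "(s - X i \<omega>) /\<^sub>R h n \<in> ball u0 r0"
          proof -
            have "(s - X i \<omega>) /\<^sub>R h n - u0 = ((y - X i \<omega>) /\<^sub>R h n - u0) - (y - s) /\<^sub>R h n"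
              by (simp add: scaleR_diff_right)
            hence "norm ((s - X i \<omega>) /\<^sub>R h n - u0) \<le> norm ((y - X i \<omega>) /\<^sub>R h n - u0) + norm ((y - s) /\<^sub>R h n)"
              by (metis norm_triangle_ineq4)
            also have "norm ((y - s) /\<^sub>R h n) \<le> \<delta> / h n"
              unfolding norm_scaled[OF hp] using s(2) hp by (simp add: dist_norm divide_right_mono)
            also have "\<delta> / h n \<le> r0 / 2" using \<delta>'(4) hp by (simp add: pos_divide_le_eq mult.commute)
            also have "norm ((y - X i \<omega>) /\<^sub>R h n - u0) < r0 / 2" using win by (simp add: dist_norm norm_minus_commute)
            finally show ?thesis by (simp add: dist_norm norm_minus_commute)
          qed
          have small: "norm (\<Sum>l<n. grad K ((s - X l \<omega>) /\<^sub>R h n)) \<le> \<sigma>"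
          proof -
            interpret lg: lipschitz_gradient "g n \<omega>" "lip_K / h n ^ (DIM('a) + 2)"
              by (rule lipschitz_gradient_kde[OF hp elim(4)])
            have "norm (grad (g n \<omega>) s) \<le> lip_K / h n ^ (DIM('a) + 2) * norm (s - y)" using lg.lip[of s y] crit by simp
            also have "\<dots> \<le> lip_K / h n ^ (DIM('a) + 2) * \<delta>"
              using s(2) lip_K(1) hp by (intro mult_left_mono) (auto simp: dist_norm norm_minus_commute)
            finally have gs: "norm (grad (g n \<omega>) s) \<le> lip_K / h n ^ (DIM('a) + 2) * \<delta>" .
            define P where "P = real n * h n ^ (DIM('a) + 1)"
            have P: "0 < P" using elim(4) hp by (simp add: P_def)
            have "grad (g n \<omega>) s = (1 / P) *\<^sub>R (\<Sum>l<n. grad K ((s - X l \<omega>) /\<^sub>R h n))"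
              unfolding P_def by (rule grad_kde(2)[OF hp])
            hence "norm (\<Sum>l<n. grad K ((s - X l \<omega>) /\<^sub>R h n)) = P * norm (grad (g n \<omega>) s)" using P by simp
            also have "\<dots> \<le> P * (lip_K / h n ^ (DIM('a) + 2) * \<delta>)" using gs P by (intro mult_left_mono) auto
            also have "\<dots> = \<sigma>" using hp by (simp add: P_def \<sigma>_def)
            finally show ?thesis .
          qed
          have "\<omega> \<in> E i s (b, b')" using \<omega> window small dev by (simp add: E_def)
          moreover have "(i, s, (b, b')) \<in> IS" using i s(1) b by (simp add: IS_def BB_def)
          ultimately have "\<omega> \<in> B" unfolding B_def by blast
          thus False using \<omega> by blast
        qed
        have lin: "linear (\<lambda>v. H v - hess f y v)"
          by (intro linear_compose_sub has_derivative_linear[OF H] bounded_linear.linear[OF blinfun.bounded_linear_right])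
        have "H v \<bullet> v \<le> - (\<mu> / 2 * (norm v)\<^sup>2)" for v
        proof -
          have "(H v - hess f y v) \<bullet> v \<le> (real DIM('a))\<^sup>2 * (4 * t) * (norm v)\<^sup>2"
            by (rule quadratic_form_entries[OF lin]) (rule entries)
          also have "(real DIM('a))\<^sup>2 * (4 * t) = \<mu> / 2" using d by (simp add: t_def d_def)
          finally show ?thesis using neg[OF y, of v] by (simp add: inner_diff_left)
        qed
        with H show ?thesis by blast
      qed
      thus ?case using PB B_ev by blast
    qed
  qed
qed

end

section \<open>From the hypotheses on density and kernel to the consistency theorem\<close>

lemma smoothing_kernel_compact_kernel:
  fixes K :: "'a::euclidean_space \<Rightarrow> real"
  assumes K: "smoothing_kernel K"
  obtains \<rho> where "compact_kernel K \<rho>"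
proof -
  have "bounded (closure {x. K x \<noteq> 0})" using K by (simp add: smoothing_kernel_def compact_imp_bounded)
  then obtain \<rho> where \<rho>: "0 < \<rho>" "\<And>x. x \<in> closure {x. K x \<noteq> 0} \<Longrightarrow> norm x \<le> \<rho>"
    unfolding bounded_pos by blast
  have "compact_kernel K \<rho>"
  proof
    show "K x = 0" if "x \<notin> cball 0 \<rho>" for x
      using that \<rho>(2)[of x] closure_subset[of "{x. K x \<noteq> 0}"] by fastforce
  qed (use K \<rho> in \<open>auto simp: smoothing_kernel_def twice_differentiable_def intro: GDERIV_grad blinfun_apply_hess\<close>)
  thus ?thesis using that by blast
qed

lemma regular_density_bounds:
  fixes f :: "'a::euclidean_space \<Rightarrow> real"
  assumes f: "regular_density f"
  obtains F where "0 < F" "\<And>x. f x \<le> F" "\<And>x. norm (grad f x) \<le> F" "\<And>x. norm (hess f x) \<le> F"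
    "\<And>x y. norm (grad f x - grad f y) \<le> F * norm (x - y)"
proof -
  obtain b1 where b1: "0 < b1" "\<And>x. norm (f x) \<le> b1" using f by (auto simp: regular_density_def bounded_pos)
  obtain b2 where b2: "0 < b2" "\<And>x. norm (grad f x) \<le> b2" using f by (auto simp: regular_density_def bounded_pos)
  have "bounded (range (hess f))" using f by (simp add: regular_density_def)
  from bounded_hess_imp_lipschitz_grad[OF regular_densityD(2)[OF f] this]
  obtain L where L: "0 < L" "\<And>x. norm (hess f x) \<le> L" "\<And>x y. norm (grad f x - grad f y) \<le> L * norm (x - y)" by metis
  show ?thesis
  proof (rule that[of "b1 + b2 + L"])
    show "f x \<le> b1 + b2 + L" for x using b1(2)[of x] b2(1) L(1) by simp
    show "norm (grad f x) \<le> b1 + b2 + L" for x using b2(2)[of x] b1(1) L(1) by simp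
    show "norm (hess f x) \<le> b1 + b2 + L" for x using L(2)[of x] b1(1) b2(1) by simp
    show "norm (grad f x - grad f y) \<le> (b1 + b2 + L) * norm (x - y)" for x y
    proof -
      have "L * norm (x - y) \<le> (b1 + b2 + L) * norm (x - y)" using b1(1) b2(1) by (intro mult_right_mono) auto
      thus ?thesis using L(3)[of x y] by linarith
    qed
  qed (use b1 b2 L in simp)
qed

theorem theorem4p1:
  fixes M :: "'w measure"
    and X :: "nat \<Rightarrow> 'w \<Rightarrow> 'a::euclidean_space"
    and f K :: "'a \<Rightarrow> real"
    and h :: "nat \<Rightarrow> real"
    and c :: real
    and xstar x0 :: 'a
  assumes "prob_space M"
    and "regular_density f"
    and "smoothing_kernel K"
    and "prob_space.indep_vars M (\<lambda>_. borel) X UNIV"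
    and "\<And>i. distributed M lborel (X i) (\<lambda>x. ennreal (f x))"
    and "\<And>n. 0 < h n"
    and "h \<longlonglongrightarrow> 0"
    and "(\<lambda>n. ln (real n) / (real n * h n ^ (DIM('a) + 4))) \<longlonglongrightarrow> 0"
    and "0 < c" and "c < 1"
    and "is_mode f xstar"
    and "x0 \<in> basin_of_attraction f xstar"
  shows "\<forall>\<eta>>0. with_probability_tending_to_one M
           (\<lambda>n \<omega>. \<exists>z. is_mode (kde K (h n) n (\<lambda>i. X i \<omega>)) z \<and> dist z xstar < \<eta> \<and>
                       all_methods_climb_to c (kde K (h n) n (\<lambda>i. X i \<omega>)) x0 z)"
proof (intro allI impI)
  fix \<eta> :: real assume \<eta>: "0 < \<eta>"
  obtain \<rho> where "compact_kernel K \<rho>" using smoothing_kernel_compact_kernel[OF assms(3)] .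
  then interpret compact_kernel K \<rho> .
  obtain F where F: "0 < F" "\<And>x. f x \<le> F" "\<And>x. norm (grad f x) \<le> F" "\<And>x. norm (hess f x) \<le> F"
    "\<And>x y. norm (grad f x - grad f y) \<le> F * norm (x - y)"
    using regular_density_bounds[OF assms(2)] by blast
  interpret prob_space M by (rule assms(1))
  interpret kde_sample M X f F K \<rho> h
  proof
    show "f \<in> borel_measurable borel" using assms(2) by (simp add: regular_density_def probability_density_def)
    show "uniformly_continuous_on UNIV (hess f)" using assms(2) by (simp add: regular_density_def)
  qed (use assms F regular_densityD[OF assms(2)] in auto)
  obtain r1 \<mu> m where r1: "0 < r1" and \<mu>: "0 < \<mu>" and m: "0 < m" "\<And>x. x \<in> cball xstar r1 \<Longrightarrow> m \<le> f x"
    and neg: "\<And>x v. x \<in> cball xstar r1 \<Longrightarrow> hess f x v \<bullet> v \<le> - (\<mu> * (norm v)\<^sup>2)"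
    using regular_density_mode[OF assms(2) assms(11)] by blast
  \<comment> \<open>Strictly below r1 to leave room for the windows; at most \<eta> so that the mode
    found in the open ball is close enough.\<close>
  define r where "r = min (r1 / 2) \<eta>"
  have r: "0 < r" "r < r1" "r \<le> \<eta>" using r1 \<eta> by (auto simp: r_def)
  have neg': "hess f x v \<bullet> v \<le> - (\<mu> * (norm v)\<^sup>2)" if "x \<in> cball xstar r" for x v
    using neg[of x v] that r by simp
  obtain R \<epsilon> where \<epsilon>: "0 < \<epsilon>" and climb: "\<And>g L. lipschitz_gradient g L \<Longrightarrow>
      \<forall>x\<in>cball 0 R. norm (grad g x - grad f x) \<le> \<epsilon> \<Longrightarrow>
      \<forall>z\<in>cball xstar r. grad g z = 0 \<longrightarrow>
        (\<exists>H. (grad g has_derivative H) (at z) \<and> (\<forall>v. H v \<bullet> v \<le> - (\<mu> / 2 * (norm v)\<^sup>2))) \<Longrightarrow>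
      \<exists>z\<in>ball xstar r. is_mode g z \<and> all_methods_climb_to c g x0 z"
    using climbing_consistent[OF assms(2,11,12) r(1) \<mu> assms(9,10) neg'] by metis
  obtain u0 r0 \<epsilon>' where r0: "0 < r0" and \<epsilon>': "0 < \<epsilon>'" and exp:
    "\<And>u u'. u \<in> ball u0 r0 \<Longrightarrow> u' \<in> ball u0 r0 \<Longrightarrow> \<epsilon>' * norm (u - u') \<le> norm (grad K u - grad K u')"
    by (rule grad_K_expands) (rule that; assumption)
  have r02: "0 < r0 / 2" using r0 by simp
  show "with_probability_tending_to_one M
           (\<lambda>n \<omega>. \<exists>z. is_mode (g n \<omega>) z \<and> dist z xstar < \<eta> \<and> all_methods_climb_to c (g n \<omega>) x0 z)"
  proof (rule with_probability_mono)
    show "with_probability_tending_to_one M (\<lambda>n \<omega>. (\<forall>y\<in>cball 0 R. norm (grad (g n \<omega>) y - grad f y) \<le> \<epsilon>) \<and>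
      (\<forall>y\<in>cball xstar r. \<exists>i<n. (y - X i \<omega>) /\<^sub>R h n \<in> ball u0 (r0 / 2)) \<and>
      (\<forall>i<n. \<forall>y\<in>cball xstar r. (y - X i \<omega>) /\<^sub>R h n \<in> ball u0 (r0 / 2) \<longrightarrow> grad (g n \<omega>) y = 0 \<longrightarrow>
        (\<exists>H. (grad (g n \<omega>) has_derivative H) (at y) \<and> (\<forall>v. H v \<bullet> v \<le> - (\<mu> / 2 * (norm v)\<^sup>2)))))"
      by (intro with_probability_conj gradient_consistent[OF \<epsilon>] sample_point_in_window[OF r02 less_imp_le[OF r(1)] r(2) m]
          critical_points_nondegenerate[OF exp r0 \<epsilon>' \<mu> neg'])
    fix n \<omega>
    assume A: "(\<forall>y\<in>cball 0 R. norm (grad (g n \<omega>) y - grad f y) \<le> \<epsilon>) \<and>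
      (\<forall>y\<in>cball xstar r. \<exists>i<n. (y - X i \<omega>) /\<^sub>R h n \<in> ball u0 (r0 / 2)) \<and>
      (\<forall>i<n. \<forall>y\<in>cball xstar r. (y - X i \<omega>) /\<^sub>R h n \<in> ball u0 (r0 / 2) \<longrightarrow> grad (g n \<omega>) y = 0 \<longrightarrow>
        (\<exists>H. (grad (g n \<omega>) has_derivative H) (at y) \<and> (\<forall>v. H v \<bullet> v \<le> - (\<mu> / 2 * (norm v)\<^sup>2))))"
    \<comment> \<open>The covering event at the centre already provides an index below n, so the
      sample is not empty.\<close>
    have "xstar \<in> cball xstar r" using r by simp
    hence n: "0 < n" using A by (metis gr_zeroI not_less_zero)
    \<comment> \<open>Every critical point in the ball has an observation in its half window by the
      second event, so the third one makes it nondegenerate.\<close>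
    have "\<exists>z\<in>ball xstar r. is_mode (g n \<omega>) z \<and> all_methods_climb_to c (g n \<omega>) x0 z"
      by (rule climb[OF lipschitz_gradient_kde[OF h_pos n]]) (use A in meson)+
    thus "\<exists>z. is_mode (g n \<omega>) z \<and> dist z xstar < \<eta> \<and> all_methods_climb_to c (g n \<omega>) x0 z"
      using r(3) by (force simp: dist_commute)
  qed
qed

end
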